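(* Let $C>1$ be an integer. For all $j\in[t]$, let $G^{(j)}$ be a $d_j$-regular connected graph with $1<|V(G^{(j)})|\le C$. Let $G=\square_{j=1}^t G^{(j)}$, let $n:=|V(G)|$ and let $d:=\sum_{j=1}^t d_j$. Let $\epsilon>0$ be a small enough constant and let $p=\frac{1+\epsilon}{d}$. Let $L_1$ be the largest component in $G_p$. Then there exists a positive constant $c=c(\epsilon)$ such that whp for all subsets $S\subseteq V(L_1)$ with $|S|=k$ and $G_p[S]$ connected: (a) for all $\frac{9\ln C\cdot d}{\epsilon^2}\le k\le n^{\epsilon^5}$, $$|N_{G_p}(S)|\ge c|S|;$$ (b) for all $n^{\epsilon^5}\le k\le \frac{3\epsilon n}{2}$, $$|\partial_{G_p}(S)|\ge \frac{c|S|\ln\left(\frac{n}{|S|}\right)}{d\ln d}.$$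
   Context: Graphs are finite and simple; $[m]=\{1,\ldots,m\}$. The Cartesian product $\square_{j=1}^t G^{(j)}$ is the graph with vertex set $V(G^{(1)})\times\cdots\times V(G^{(t)})$ in which $u$ and $v$ are adjacent iff there is some $j\in[t]$ with $u_jv_j\in E(G^{(j)})$ and $u_m=v_m$ for all $m\ne j$. $G_p$ is the random subgraph of $G$ on $V(G)$ obtained by retaining every edge of $G$ independently with probability $p$. "Whp" means with probability tending to $1$ as $t\to\infty$, where $C,\epsilon$ are fixed and the base graphs may vary with $t$. "$\epsilon$ small enough" means $0<\epsilon\le\epsilon_0$ for some $\epsilon_0>0$ depending only on $C$; constants do not depend on $t$ or on the base graphs. The largest component is the one with most vertices (ties broken arbitrarily). $G_p[S]$ is the induced subgraph on $S$. For a graph $H$ and $S\subseteq V(H)$, $\partial_H(S)$ is the set of edges of $H$ with exactly one endpoint in $S$, and $N_H(S)$ is the set of vertices in $V(H)\setminus S$ having a neighbour in $S$ in $H$. *)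

theory Defs
  imports "HOL-Probability.Probability"
begin

datatype 'a graph = Graph (verts: "'a set") (edges: "'a set set")

definition simple_graph :: "'a graph \<Rightarrow> bool" where
  "simple_graph G \<longleftrightarrow> finite (verts G) \<and> (\<forall>e\<in>edges G. e \<subseteq> verts G \<and> card e = 2)"

definition degree :: "'a graph \<Rightarrow> 'a \<Rightarrow> nat" where
  "degree G v = card {e \<in> edges G. v \<in> e}"

definition regular_graph :: "nat \<Rightarrow> 'a graph \<Rightarrow> bool" where
  "regular_graph r G \<longleftrightarrow> (\<forall>v\<in>verts G. degree G v = r)"

definition reachable :: "'a graph \<Rightarrow> 'a \<Rightarrow> 'a \<Rightarrow> bool" where
  "reachable G u v \<longleftrightarrow> (u, v) \<in> {(x, y). {x, y} \<in> edges G}\<^sup>*"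

definition connected_graph :: "'a graph \<Rightarrow> bool" where
  "connected_graph G \<longleftrightarrow> verts G \<noteq> {} \<and> (\<forall>u\<in>verts G. \<forall>v\<in>verts G. reachable G u v)"

definition induced_subgraph :: "'a graph \<Rightarrow> 'a set \<Rightarrow> 'a graph" where
  "induced_subgraph G S = Graph (verts G \<inter> S) {e \<in> edges G. e \<subseteq> S}"

definition components :: "'a graph \<Rightarrow> 'a set set" where
  "components G = {{v \<in> verts G. reachable G u v} | u. u \<in> verts G}"

text \<open>Components are represented by their vertex sets. In case of a tie,
  several components are largest.\<close>

definition largest_component :: "'a graph \<Rightarrow> 'a set \<Rightarrow> bool" where
  "largest_component G L \<longleftrightarrow>
     L \<in> components G \<and> (\<forall>K\<in>components G. card K \<le> card L)"

definition edge_boundary :: "'a graph \<Rightarrow> 'a set \<Rightarrow> 'a set set" where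
  "edge_boundary G S = {e \<in> edges G. card (e \<inter> S) = 1}"

definition vertex_boundary :: "'a graph \<Rightarrow> 'a set \<Rightarrow> 'a set" where
  "vertex_boundary G S = {v \<in> verts G - S. \<exists>u\<in>S. {u, v} \<in> edges G}"

definition cartesian_product :: "'i set \<Rightarrow> ('i \<Rightarrow> 'a graph) \<Rightarrow> ('i \<Rightarrow> 'a) graph" where
  "cartesian_product I G =
     Graph (\<Pi>\<^sub>E j\<in>I. verts (G j))
       {{u, v} | u v. u \<in> (\<Pi>\<^sub>E j\<in>I. verts (G j)) \<and> v \<in> (\<Pi>\<^sub>E j\<in>I. verts (G j)) \<and>
          (\<exists>j\<in>I. {u j, v j} \<in> edges (G j) \<and> (\<forall>m\<in>I - {j}. u m = v m))}"

text \<open>Meaningful for graphs with finitely many edges and for \<^term>\<open>p\<close> in the unit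
  interval, to which the library's Bernoulli distribution clips its parameter.\<close>

definition random_subgraph :: "'a graph \<Rightarrow> real \<Rightarrow> 'a graph pmf" where
  "random_subgraph G p =
     map_pmf (\<lambda>keep. Graph (verts G) {e \<in> edges G. keep e})
       (Pi_pmf (edges G) False (\<lambda>_. bernoulli_pmf p))"

end

theory Submission
  imports Defs "HOL-Real_Asymp.Real_Asymp"
begin

text \<open>A union bound over connected sets \<open>S\<close> uses no count of subtrees. For fixed \<open>p'\<close> and \<open>v\<close> the events
  that \<open>S \<ni> v\<close> is connected and that no edge of its boundary is open are disjoint, so the weights
  \<open>P\<^sub>p\<^sub>'(S connected) * (1 - p') ^ |bd S|\<close> sum to at most \<open>1\<close>; and since a connected set contains a spanning tree,
  passing from \<open>p'\<close> to \<open>p\<close> costs a factor of at most \<open>(p / p') ^ (|S| - 1)\<close>. Together with the entropy form of edge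
  isoperimetry in product graphs, \<open>p' = 1/d\<close> gives vertex expansion of all connected sets of size up to
  \<open>n powr \<epsilon>^5\<close>, which is (a), and \<open>p' = (1 - 17/20 \<epsilon>) / d\<close> gives a lower bound of about \<open>17/10 \<epsilon>\<close> for the
  probability that a cluster has at least \<open>d^3\<close> vertices.

  For (b), expose \<open>p\<close> in two rounds, the second of density about \<open>\<epsilon>^3 / d\<close>. Changing two coordinates of a vertex
  leads to many disjoint copies of a product with slightly fewer factors, so after the first round every vertex has
  a positive proportion of its walks of length two ending in big clusters, and big clusters cover \<open>8/5 \<epsilon> n\<close>
  vertices. A connected \<open>S\<close> of size at most \<open>3/2 \<epsilon> n\<close> with few boundary edges contains a set \<open>W\<close> of vertices of big
  clusters, comparable to \<open>S\<close> in size, such that the second round has no path of length at most five from \<open>W\<close> to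
  the remaining big clusters, apart from paths using a boundary edge of \<open>S\<close>. Isoperimetry provides of order
  \<open>d^4 * |S| * ln (n / |S|)\<close> such walks in the host graph, each open with probability of order \<open>d^(-5)\<close>, and this
  beats the number of pairs consisting of \<open>W\<close> and the boundary edges near \<open>W\<close>.\<close>

section \<open>Expectations over random edge sets\<close>

text \<open>Walks of length two are taken at both ends because of the union bound over vertices.
  Changing one coordinate reaches only order \<open>t\<close> copies, whose failure probability
  \<open>exp (- const * t)\<close> with a small constant cannot outweigh up to \<open>C ^ t\<close>
  vertices; changing two reaches order \<open>t^2\<close>. One edge in between makes five.

  The factor \<open>d * ln d\<close> in (b) is the price of the encoding. The expected number of
  open paths is of order \<open>k * ln (n / k) / d\<close>. Boundary edges and marks are named by
  random sets of density \<open>d^(-10)\<close>, so each costs order \<open>ln d\<close>, and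
  \<open>c * k * ln (n / k) / (d * ln d)\<close> of them are affordable; getting the remaining order
  \<open>k * d^6\<close> positions right costs only order \<open>k / d^4\<close>. The cluster size
  \<open>d^3\<close> makes roots cheap: choosing \<open>k / d^3\<close> of them among
  \<open>n\<close> vertices costs order \<open>k / d^2\<close>.

  The threshold \<open>9 * ln C * d / \<epsilon>^2\<close> in (a) lets
  \<open>exp (- \<epsilon>^2 * k / 4)\<close> beat the number of vertices, and below
  \<open>n powr \<epsilon>^5\<close> the isoperimetric inequality still leaves all but a fraction
  \<open>\<epsilon>^3\<close> of the degrees of a set on its boundary.\<close>

definition pex :: "real \<Rightarrow> 'e set \<Rightarrow> ('e set \<Rightarrow> real) \<Rightarrow> real" where
  "pex p E g = (\<Sum>F\<in>Pow E. p ^ card F * (1 - p) ^ card (E - F) * g F)"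

lemma pex_empty [simp]: "pex p {} g = g {}"
  by (simp add: pex_def)

lemma pex_insert:
  assumes "finite E" "e \<notin> E"
  shows "pex p (insert e E) g = p * pex p E (\<lambda>F. g (insert e F)) + (1 - p) * pex p E g"
proof -
  have disj: "Pow E \<inter> insert e ` Pow E = {}" using assms by auto
  have inj: "inj_on (insert e) (Pow E)" using assms(2) by (auto simp: inj_on_def)
  have "pex p (insert e E) g =
     (\<Sum>F\<in>Pow E. p ^ card F * (1 - p) ^ card (insert e E - F) * g F) +
     (\<Sum>F\<in>insert e ` Pow E. p ^ card F * (1 - p) ^ card (insert e E - F) * g F)"
    unfolding pex_def Pow_insert using assms disj by (intro sum.union_disjoint) auto
  also have "(\<Sum>F\<in>Pow E. p ^ card F * (1 - p) ^ card (insert e E - F) * g F) = (1 - p) * pex p E g"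
    unfolding pex_def sum_distrib_left
  proof (intro sum.cong refl)
    fix F assume "F \<in> Pow E"
    then have "insert e E - F = insert e (E - F)" "e \<notin> E - F" "finite (E - F)" using assms by auto
    then show "p ^ card F * (1 - p) ^ card (insert e E - F) * g F
      = (1 - p) * (p ^ card F * (1 - p) ^ card (E - F) * g F)" by simp
  qed
  also have "(\<Sum>F\<in>insert e ` Pow E. p ^ card F * (1 - p) ^ card (insert e E - F) * g F)
     = p * pex p E (\<lambda>F. g (insert e F))"
    unfolding pex_def sum_distrib_left sum.reindex[OF inj] o_def
  proof (intro sum.cong refl)
    fix F assume "F \<in> Pow E"
    then have "insert e E - insert e F = E - F" "e \<notin> F" "finite F"
      using assms by (auto intro: finite_subset)
    then show "p ^ card (insert e F) * (1 - p) ^ card (insert e E - insert e F) * g (insert e F)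
      = p * (p ^ card F * (1 - p) ^ card (E - F) * g (insert e F))" by simp
  qed
  finally show ?thesis by simp
qed

lemma pex_cong: "(\<And>F. F \<subseteq> E \<Longrightarrow> g F = h F) \<Longrightarrow> pex p E g = pex p E h"
  unfolding pex_def by (intro sum.cong) auto

lemma pex_add: "pex p E (\<lambda>F. g F + h F) = pex p E g + pex p E h"
  by (simp add: pex_def sum.distrib algebra_simps)

lemma pex_cmult: "pex p E (\<lambda>F. c * g F) = c * pex p E g"
  by (simp add: pex_def sum_distrib_left algebra_simps)

lemma pex_sum: "pex p E (\<lambda>F. \<Sum>i\<in>I. g i F) = (\<Sum>i\<in>I. pex p E (g i))"
  unfolding pex_def by (subst sum.swap) (simp add: sum_distrib_left)

lemma pex_mono:
  assumes "0 \<le> p" "p \<le> 1" "\<And>F. F \<subseteq> E \<Longrightarrow> g F \<le> h F"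
  shows "pex p E g \<le> pex p E h"
  unfolding pex_def using assms by (intro sum_mono mult_left_mono) auto

lemma pex_nonneg:
  assumes "0 \<le> p" "p \<le> 1" "\<And>F. F \<subseteq> E \<Longrightarrow> 0 \<le> g F"
  shows "0 \<le> pex p E g"
  unfolding pex_def using assms by (intro sum_nonneg mult_nonneg_nonneg) auto

lemma pex_const: "finite E \<Longrightarrow> pex p E (\<lambda>_. c) = c"
  by (induction E rule: finite_induct) (simp_all add: pex_insert algebra_simps)

lemma pex_Un:
  assumes "finite A" "finite B" "A \<inter> B = {}"
  shows "pex p (A \<union> B) g = pex p A (\<lambda>F. pex p B (\<lambda>F'. g (F \<union> F')))"
  using assms(1,3)
proof (induction A arbitrary: g rule: finite_induct)
  case (insert a A)
  then show ?case using assms(2) by (simp add: pex_insert)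
qed simp

lemma pex_marginal:
  assumes "finite E" "A \<subseteq> E" 
  shows "pex p E (\<lambda>F. g (F \<inter> A)) = pex p A g"
proof -
  have f: "finite A" "finite (E - A)" using assms finite_subset by auto
  have "pex p E (\<lambda>F. g (F \<inter> A)) = pex p A (\<lambda>F. pex p (E - A) (\<lambda>F'. g ((F \<union> F') \<inter> A)))"
    using pex_Un[OF f, of p] assms by (simp add: Un_absorb1 Diff_disjoint)
  also have "\<dots> = pex p A (\<lambda>F. pex p (E - A) (\<lambda>F'. g F))"
    by (intro pex_cong arg_cong[where f=g]) auto
  finally show ?thesis using f by (simp add: pex_const)
qed

text \<open>Fubini over \<open>E \<inter> A\<close> and \<open>E - A\<close>. The hypotheses say
  that \<open>g\<close> reads only edges in \<open>A\<close> and \<open>h\<close> only edges in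
  \<open>B\<close>; the typical use is with the edges inside a set and the edges leaving it.\<close>

lemma pex_indep:
  assumes "finite E" "A \<inter> B = {}"
    and g: "\<And>F. F \<subseteq> E \<Longrightarrow> g F = g (F \<inter> A)" and h: "\<And>F. F \<subseteq> E \<Longrightarrow> h F = h (F \<inter> B)"
  shows "pex p E (\<lambda>F. g F * h F) = pex p E g * pex p E h"
proof -
  have f: "finite (E \<inter> A)" "finite (E - A)" using assms finite_subset by auto
  have EE: "E = (E \<inter> A) \<union> (E - A)" by auto
  have g': "g (F \<union> F') = g F" if "F \<subseteq> E \<inter> A" "F' \<subseteq> E - A" for F F'
  proof -
    have "g (F \<union> F') = g ((F \<union> F') \<inter> A)" using that by (intro g) auto
    also have "(F \<union> F') \<inter> A = F" using that by auto
    finally show ?thesis .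
  qed
  have h': "h (F \<union> F') = h F'" if "F \<subseteq> E \<inter> A" "F' \<subseteq> E - A" for F F'
  proof -
    have "h (F \<union> F') = h ((F \<union> F') \<inter> B)" using that by (intro h) auto
    also have "(F \<union> F') \<inter> B = F' \<inter> B" using that assms(2) by auto
    also have "h (F' \<inter> B) = h F'" using that by (intro h[symmetric]) auto
    finally show ?thesis .
  qed
  have spl: "pex p E u = pex p (E \<inter> A) (\<lambda>F. pex p (E - A) (\<lambda>F'. u (F \<union> F')))" for u
    using pex_Un[OF f, of p u] EE by (metis Diff_disjoint Int_Diff Int_assoc Int_empty_right inf.idem inf_commute)
  have "pex p E (\<lambda>F. g F * h F) = pex p (E \<inter> A) (\<lambda>F. pex p (E - A) (\<lambda>F'. g F * h F'))"
    unfolding spl[of "\<lambda>F. g F * h F"] by (intro pex_cong) (simp add: g' h')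
  also have "\<dots> = pex p (E \<inter> A) (\<lambda>F. pex p (E - A) h * g F)"
    by (simp add: pex_cmult mult.commute)
  also have "\<dots> = pex p (E - A) h * pex p (E \<inter> A) g" by (simp add: pex_cmult)
  also have "pex p (E \<inter> A) g = pex p E g"
    unfolding spl[of g] using f by (intro pex_cong) (simp add: g' pex_const cong: pex_cong)
  also have "pex p (E - A) h = pex p E h"
  proof -
    have "pex p E h = pex p (E \<inter> A) (\<lambda>F. pex p (E - A) h)"
      unfolding spl[of h] by (intro pex_cong) (simp add: h' cong: pex_cong)
    then show ?thesis using f by (simp add: pex_const)
  qed
  finally show ?thesis by simp
qed

lemma pex_prod:
  assumes "finite E" "finite I" "disjoint_family_on B I"
    and "\<And>i F. i \<in> I \<Longrightarrow> F \<subseteq> E \<Longrightarrow> g i F = g i (F \<inter> B i)"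
  shows "pex p E (\<lambda>F. \<Prod>i\<in>I. g i F) = (\<Prod>i\<in>I. pex p E (g i))"
  using assms(2,3,4)
proof (induction I rule: finite_induct)
  case empty then show ?case using assms(1) by (simp add: pex_const)
next
  case (insert i I)
  have "B i \<inter> (\<Union>j\<in>I. B j) = {}"
    using insert.prems(1) insert.hyps by (auto simp: disjoint_family_on_def)
  moreover have "(\<Prod>j\<in>I. g j F) = (\<Prod>j\<in>I. g j (F \<inter> (\<Union>j\<in>I. B j)))" if "F \<subseteq> E" for F
  proof (rule prod.cong[OF refl])
    fix j assume j: "j \<in> I"
    have "g j (F \<inter> (\<Union>j\<in>I. B j)) = g j (F \<inter> (\<Union>j\<in>I. B j) \<inter> B j)"
      using insert.prems(2)[of j "F \<inter> (\<Union>j\<in>I. B j)"] j that by auto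
    also have "F \<inter> (\<Union>j\<in>I. B j) \<inter> B j = F \<inter> B j" using j by auto
    finally show "g j F = g j (F \<inter> (\<Union>j\<in>I. B j))" using insert.prems(2)[of j F] j that by simp
  qed
  ultimately have "pex p E (\<lambda>F. g i F * (\<Prod>j\<in>I. g j F)) = pex p E (g i) * pex p E (\<lambda>F. \<Prod>j\<in>I. g j F)"
    using insert.prems(2) assms(1) by (intro pex_indep) auto
  moreover have "disjoint_family_on B I" using insert.prems(1) by (auto simp: disjoint_family_on_def)
  ultimately show ?case using insert by simp
qed

text \<open>An edge is missing from the union of two independent rounds iff both rounds miss it,
  which gives the relation between the densities. All sprinkling goes through this identity.\<close>

lemma pex_rounds:
  assumes "finite E" "1 - p = (1 - p1) * (1 - p2)"
  shows "pex p E g = pex p1 E (\<lambda>F1. pex p2 E (\<lambda>F2. g (F1 \<union> F2)))"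
  using assms(1)
proof (induction E arbitrary: g rule: finite_induct)
  case (insert e E)
  have p: "p = 1 - (1 - p1) * (1 - p2)" using assms(2) by simp
  show ?case unfolding pex_insert[OF insert.hyps] insert.IH
    by (simp only: pex_insert[OF insert.hyps] pex_add pex_cmult p Un_insert_left Un_insert_right
        insert_absorb2) (simp add: algebra_simps)
qed simp

text \<open>Keeping every edge of a random set of density \<open>p\<close> with probability
  \<open>r\<close> produces density \<open>p * r\<close>; this coupling compares connection
  probabilities at two densities.\<close>

lemma pex_thin:
  assumes "finite E"
  shows "pex (p * r) E g = pex p E (\<lambda>F. pex r F g)"
  using assms
proof (induction E arbitrary: g rule: finite_induct)
  case (insert e E)
  have "pex p E (\<lambda>F. pex r (insert e F) g) = pex p E (\<lambda>F. r * pex r F (\<lambda>F. g (insert e F)) + (1-r) * pex r F g)"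
    using insert.hyps by (intro pex_cong pex_insert) (auto intro: finite_subset)
  then show ?case unfolding pex_insert[OF insert.hyps] insert.IH
    by (simp only: pex_add pex_cmult) (simp add: algebra_simps)
qed simp

lemma pex_pattern:
  assumes "finite E" "A \<subseteq> E" "B \<subseteq> A"
  shows "pex p E (\<lambda>F. of_bool (F \<inter> A = B)) = p ^ card B * (1 - p) ^ card (A - B)"
proof -
  have fA: "finite A" using assms finite_subset by auto
  have "pex p E (\<lambda>F. of_bool (F \<inter> A = B)) = pex p A (\<lambda>F. of_bool (F = B))"
    using pex_marginal[OF assms(1,2), of p "\<lambda>F. of_bool (F = B)"] .
  also have "\<dots> = (\<Sum>F\<in>Pow A. if F = B then p ^ card B * (1 - p) ^ card (A - B) else 0)"
    unfolding pex_def by (intro sum.cong) auto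
  also have "\<dots> = p ^ card B * (1 - p) ^ card (A - B)" using fA assms by simp
  finally show ?thesis .
qed

lemma pex_superset:
  assumes "finite E" "B \<subseteq> E"
  shows "pex p E (\<lambda>F. of_bool (B \<subseteq> F)) = p ^ card B"
  using pex_pattern[OF assms(1,2) order_refl, of p] by (simp add: Int_absorb1 inf.absorb_iff2 inf_commute)

lemma pex_hit:
  assumes "finite E" "B \<subseteq> E"
  shows "pex p E (\<lambda>F. if F \<inter> B \<noteq> {} then y else 1) = y + (1 - y) * (1 - p) ^ card B"
proof -
  have "pex p E (\<lambda>F. if F \<inter> B \<noteq> {} then y else 1) = pex p E (\<lambda>F. y + (1 - y) * of_bool (F \<inter> B = {}))"
    by (intro pex_cong) auto
  also have "\<dots> = y + (1 - y) * (1 - p) ^ card B"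
    using pex_pattern[OF assms(1,2), of "{}" p] assms(1) by (simp add: pex_add pex_cmult pex_const)
  finally show ?thesis .
qed

text \<open>Counting by probability: a random subset of \<open>A\<close> equals a given member with
  probability at least \<open>p ^ b * (1 - p) ^ card A\<close>, and these events are disjoint. With
  \<open>p = 1 / card A\<close> this bounds the number of sets of at most \<open>b\<close> elements
  by a constant times \<open>card A ^ b\<close>.\<close>

lemma card_pow_le_weight:
  assumes "finite A" "0 < p" "p < 1" "\<And>B. B \<in> \<B> \<Longrightarrow> B \<subseteq> A \<and> card B \<le> b"
  shows "real (card \<B>) \<le> (1 / p) ^ b * (1 / (1 - p)) ^ card A"
proof -
  have fB: "finite \<B>" using assms by (meson finite_Pow_iff finite_subset PowI subsetI)
  have "p ^ b * (1 - p) ^ card A * card \<B> = (\<Sum>B\<in>\<B>. p ^ b * (1 - p) ^ card A)" by simp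
  also have "\<dots> \<le> (\<Sum>B\<in>\<B>. pex p A (\<lambda>F. of_bool (F \<inter> A = B)))"
  proof (intro sum_mono)
    fix B assume B: "B \<in> \<B>"
    have "card (A - B) \<le> card A" using assms(1) by (intro card_mono) auto
    then show "p ^ b * (1 - p) ^ card A \<le> pex p A (\<lambda>F. of_bool (F \<inter> A = B))"
      using assms B by (subst pex_pattern) (auto intro!: mult_mono power_decreasing)
  qed
  also have "\<dots> = pex p A (\<lambda>F. \<Sum>B\<in>\<B>. of_bool (F \<inter> A = B))" by (simp add: pex_sum)
  also have "\<dots> \<le> pex p A (\<lambda>F. 1)"
    using assms fB by (intro pex_mono) (auto simp: of_bool_def sum.delta if_distrib cong: if_cong)
  finally have "p ^ b * (1 - p) ^ card A * card \<B> \<le> 1" using assms(1) by (simp add: pex_const)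
  then show ?thesis using assms by (simp add: field_simps power_divide)
qed

text \<open>The passage from the pmf to finite sums: as the default value of the product is
  \<open>False\<close>, its support lies among the characteristic functions of subsets of
  \<open>edges G\<close>, and these are the terms of \<open>pex\<close>.\<close>

lemma prob_random_subgraph:
  assumes "finite (edges G)" "0 \<le> p" "p \<le> 1"
  shows "measure_pmf.prob (random_subgraph G p) {H. Q H} =
    pex p (edges G) (\<lambda>F. of_bool (Q (Graph (verts G) F)))"
proof -
  let ?E = "edges G" and ?M = "Pi_pmf (edges G) False (\<lambda>_. bernoulli_pmf p)"
  let ?c = "\<lambda>F e. e \<in> F"
  have sub: "set_pmf ?M \<subseteq> ?c ` Pow ?E"
  proof
    fix f assume "f \<in> set_pmf ?M"
    then have "\<And>x. x \<notin> ?E \<Longrightarrow> f x = False" using set_Pi_pmf_subset[OF assms(1)] by fastforce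
    then have "f = ?c {e. f e}" "{e. f e} \<in> Pow ?E" by auto
    then show "f \<in> ?c ` Pow ?E" by blast
  qed
  have inj: "inj_on ?c (Pow ?E)" by (auto simp: inj_on_def fun_eq_iff)
  have pm: "pmf ?M (?c F) = p ^ card F * (1 - p) ^ card (?E - F)" if "F \<subseteq> ?E" for F
  proof -
    have "pmf ?M (?c F) = (\<Prod>e\<in>?E. pmf (bernoulli_pmf p) (e \<in> F))"
      using that assms(1) by (subst pmf_Pi') auto
    also have "\<dots> = (\<Prod>e\<in>F. pmf (bernoulli_pmf p) (e \<in> F)) * (\<Prod>e\<in>?E-F. pmf (bernoulli_pmf p) (e \<in> F))"
      using that assms(1) by (metis prod.subset_diff mult.commute)
    also have "\<dots> = (\<Prod>e\<in>F. p) * (\<Prod>e\<in>?E-F. 1 - p)"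
      using assms by (intro arg_cong2[where f="(*)"] prod.cong) auto
    finally show ?thesis by simp
  qed
  have "measure_pmf.prob (random_subgraph G p) {H. Q H} =
      measure_pmf.prob ?M {f. Q (Graph (verts G) {e \<in> ?E. f e})}"
    unfolding random_subgraph_def by (simp add: vimage_def)
  also have "\<dots> = measure_pmf.expectation ?M (\<lambda>f. of_bool (Q (Graph (verts G) {e \<in> ?E. f e})))"
    by (subst Bochner_Integration.integral_cong[OF refl, of _ _ "indicator {f. Q (Graph (verts G) {e \<in> ?E. f e})}"])
      (auto simp: indicator_def)
  also have "\<dots> = (\<Sum>f\<in>?c ` Pow ?E. pmf ?M f *\<^sub>R of_bool (Q (Graph (verts G) {e \<in> ?E. f e})))"
    using sub assms(1) by (intro integral_measure_pmf) auto
  also have "\<dots> = (\<Sum>F\<in>Pow ?E. pmf ?M (?c F) *\<^sub>R of_bool (Q (Graph (verts G) {e \<in> ?E. e \<in> F})))"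
    by (subst sum.reindex[OF inj]) simp
  also have "\<dots> = pex p ?E (\<lambda>F. of_bool (Q (Graph (verts G) F)))"
    unfolding pex_def
  proof (intro sum.cong refl)
    fix F assume F: "F \<in> Pow ?E"
    then have "{e \<in> ?E. e \<in> F} = F" by auto
    then show "pmf ?M (?c F) *\<^sub>R of_bool (Q (Graph (verts G) {e \<in> ?E. e \<in> F})) =
      p ^ card F * (1 - p) ^ card (?E - F) * of_bool (Q (Graph (verts G) F))" using F pm by simp
  qed
  finally show ?thesis .
qed

section \<open>Connected sets and clusters\<close>

text \<open>Connectedness is expressed by cuts and not by paths: the condition is visibly monotone
  in \<open>F\<close>, involves only edges inside \<open>S\<close>, and supplies the next edge
  whenever a connected set is grown or decomposed.\<close>

definition conn :: "'v set set \<Rightarrow> 'v set \<Rightarrow> bool" where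
  "conn F S \<longleftrightarrow> S \<noteq> {} \<and> (\<forall>A\<subseteq>S. A \<noteq> {} \<and> A \<noteq> S \<longrightarrow> (\<exists>x\<in>A. \<exists>y\<in>S-A. {x,y} \<in> F))"

text \<open>The vertex set \<open>U\<close> is a parameter since clusters are compared in three
  places: in the whole graph, inside a set \<open>S\<close>, and inside a copy of a smaller
  product.\<close>

definition cluster :: "'v set set \<Rightarrow> 'v set \<Rightarrow> 'v \<Rightarrow> 'v set" where
  "cluster F U v = {u. (v, u) \<in> {(x, y). {x, y} \<in> F \<and> x \<in> U \<and> y \<in> U}\<^sup>*}"

definition bd :: "'v set set \<Rightarrow> 'v set \<Rightarrow> 'v set set" where
  "bd F S = {e \<in> F. card (e \<inter> S) = 1}"

lemma conn_cut: "conn F S \<Longrightarrow> A \<subseteq> S \<Longrightarrow> a \<in> A \<Longrightarrow> b \<in> S - A \<Longrightarrow> \<exists>x\<in>A. \<exists>y\<in>S-A. {x,y} \<in> F"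
  unfolding conn_def by blast

lemma conn_mono: "conn F S \<Longrightarrow> F \<subseteq> F' \<Longrightarrow> conn F' S"
  unfolding conn_def by blast

lemma conn_Int_Pow: "conn F S \<longleftrightarrow> conn (F \<inter> Pow S) S"
  unfolding conn_def by (rule conj_cong[OF refl], intro all_cong) blast

lemma conn_singleton: "conn F {v}"
  unfolding conn_def by blast

lemma conn_subset_closed:
  assumes "conn F S" "v \<in> S" "v \<in> K" "\<And>x y. x \<in> K \<Longrightarrow> x \<in> S \<Longrightarrow> y \<in> S \<Longrightarrow> {x,y} \<in> F \<Longrightarrow> y \<in> K"
  shows "S \<subseteq> K"
  using conn_cut[OF assms(1), of "S \<inter> K" v] assms(2-4) by fast

lemma conn_from_root:
  assumes "v \<in> S" "\<And>A. A \<subseteq> S \<Longrightarrow> v \<in> A \<Longrightarrow> A \<noteq> S \<Longrightarrow> \<exists>x\<in>A. \<exists>y\<in>S-A. {x,y} \<in> F"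
  shows "conn F S"
  unfolding conn_def
proof (intro conjI allI impI)
  fix A assume A: "A \<subseteq> S" "A \<noteq> {} \<and> A \<noteq> S"
  show "\<exists>x\<in>A. \<exists>y\<in>S - A. {x, y} \<in> F"
  proof (cases "v \<in> A")
    case True then show ?thesis using assms(2) A by blast
  next
    case False
    then obtain x y where "x \<in> S - A" "y \<in> S - (S - A)" "{x,y} \<in> F"
      using assms(2)[of "S - A"] assms(1) A by blast
    then show ?thesis using A by (metis DiffD1 DiffD2 Diff_iff insert_commute)
  qed
qed (use assms(1) in auto)

lemma conn_Un_edge:
  assumes "conn F A" "conn F B" "x \<in> A" "y \<in> B" "{x,y} \<in> F"
  shows "conn F (A \<union> B)"
proof (rule conn_from_root[of x])
  fix Z assume Z: "Z \<subseteq> A \<union> B" "x \<in> Z" "Z \<noteq> A \<union> B"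
  show "\<exists>x\<in>Z. \<exists>y\<in>A \<union> B - Z. {x, y} \<in> F"
  proof (rule ccontr)
    assume "\<not> ?thesis"
    then have cl: "\<And>x y. x \<in> Z \<Longrightarrow> y \<in> A \<union> B \<Longrightarrow> {x,y} \<in> F \<Longrightarrow> y \<in> Z" by blast
    have "A \<subseteq> Z" using conn_subset_closed[OF assms(1,3) Z(2)] cl by blast
    moreover have "y \<in> Z" using cl[OF Z(2) _ assms(5)] assms(4) by blast
    then have "B \<subseteq> Z" using conn_subset_closed[OF assms(2,4)] cl by blast
    ultimately show False using Z by blast
  qed
qed (use assms in auto)

lemma conn_Union_hub:
  assumes "conn F X" "\<And>K. K \<in> \<K> \<Longrightarrow> conn F K \<and> (\<exists>x\<in>X. \<exists>y\<in>K. {x,y} \<in> F)"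
  shows "conn F (X \<union> \<Union>\<K>)"
proof -
  obtain v where v: "v \<in> X" using assms(1) by (auto simp: conn_def)
  show ?thesis
  proof (rule conn_from_root[of v])
    fix Z assume Z: "Z \<subseteq> X \<union> \<Union>\<K>" "v \<in> Z" "Z \<noteq> X \<union> \<Union>\<K>"
    show "\<exists>x\<in>Z. \<exists>y\<in>X \<union> \<Union>\<K> - Z. {x, y} \<in> F"
    proof (rule ccontr)
      assume "\<not> ?thesis"
      then have cl: "\<And>x y. x \<in> Z \<Longrightarrow> y \<in> X \<union> \<Union>\<K> \<Longrightarrow> {x,y} \<in> F \<Longrightarrow> y \<in> Z" by blast
      have XZ: "X \<subseteq> Z" using conn_subset_closed[OF assms(1) v Z(2)] cl by blast
      have "K \<subseteq> Z" if K: "K \<in> \<K>" for K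
      proof -
        obtain x y where "x \<in> X" "y \<in> K" "{x,y} \<in> F" using assms(2)[OF K] by blast
        then have "y \<in> Z" using cl XZ K by blast
        then show ?thesis using conn_subset_closed[of F K y Z] assms(2)[OF K] cl K \<open>y \<in> K\<close> by blast
      qed
      then show False using XZ Z by blast
    qed
  qed (use v in auto)
qed

lemma cluster_refl [simp]: "v \<in> cluster F U v"
  by (simp add: cluster_def)

lemma cluster_step: "x \<in> cluster F U v \<Longrightarrow> x \<in> U \<Longrightarrow> y \<in> U \<Longrightarrow> {x,y} \<in> F \<Longrightarrow> y \<in> cluster F U v"
  unfolding cluster_def by (auto intro: rtrancl_into_rtrancl)

lemma cluster_subset: "v \<in> U \<Longrightarrow> cluster F U v \<subseteq> U"
proof
  fix u assume v: "v \<in> U" and "u \<in> cluster F U v"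
  then have "(v, u) \<in> {(x, y). {x, y} \<in> F \<and> x \<in> U \<and> y \<in> U}\<^sup>*" by (simp add: cluster_def)
  then show "u \<in> U" by (induction rule: rtrancl_induct) (use v in auto)
qed

lemma cluster_sub_closed:
  assumes "v \<in> Z" "\<And>x y. x \<in> Z \<Longrightarrow> x \<in> U \<Longrightarrow> y \<in> U \<Longrightarrow> {x,y} \<in> F \<Longrightarrow> y \<in> Z"
  shows "cluster F U v \<subseteq> Z"
proof
  fix u assume "u \<in> cluster F U v"
  then have "(v, u) \<in> {(x, y). {x, y} \<in> F \<and> x \<in> U \<and> y \<in> U}\<^sup>*" by (simp add: cluster_def)
  then show "u \<in> Z" by (induction rule: rtrancl_induct) (use assms in auto)
qed

lemma conn_cluster: "v \<in> U \<Longrightarrow> conn F (cluster F U v)"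
proof (rule conn_from_root[of v])
  fix A assume v: "v \<in> U" and A: "A \<subseteq> cluster F U v" "v \<in> A" "A \<noteq> cluster F U v"
  show "\<exists>x\<in>A. \<exists>y\<in>cluster F U v - A. {x, y} \<in> F"
  proof (rule ccontr)
    assume n: "\<not> ?thesis"
    have "cluster F U v \<subseteq> A"
      by (rule cluster_sub_closed[OF A(2)]) (use n A cluster_step[of _ F U v] in blast)
    then show False using A by blast
  qed
qed simp

lemma conn_sub_cluster: "conn F K \<Longrightarrow> K \<subseteq> U \<Longrightarrow> v \<in> K \<Longrightarrow> K \<subseteq> cluster F U v"
  by (rule conn_subset_closed[of F K v]) (use cluster_step[of _ F U v] in auto)

lemma cluster_eq: "v \<in> U \<Longrightarrow> u \<in> cluster F U v \<Longrightarrow> cluster F U u = cluster F U v"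
proof
  assume v: "v \<in> U" and u: "u \<in> cluster F U v"
  have uU: "u \<in> U" using cluster_subset[OF v] u by blast
  show "cluster F U v \<subseteq> cluster F U u" using conn_sub_cluster[OF conn_cluster[OF v] cluster_subset[OF v] u] .
  then have "v \<in> cluster F U u" by auto
  then show "cluster F U u \<subseteq> cluster F U v" using conn_sub_cluster[OF conn_cluster[OF uU] cluster_subset[OF uU]] by blast
qed

lemma cluster_mono: "F \<subseteq> F' \<Longrightarrow> U \<subseteq> U' \<Longrightarrow> v \<in> U \<Longrightarrow> cluster F U v \<subseteq> cluster F' U' v"
  using conn_sub_cluster[OF conn_mono[OF conn_cluster[of v U F]], of F' U' v] cluster_subset[of v U F] by auto

lemma conn_if_connected_graph:
  assumes "connected_graph (induced_subgraph (Graph V F) S)" "S \<subseteq> V"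
  shows "conn F S"
proof -
  have VS: "V \<inter> S = S" using assms(2) by auto
  have "S \<noteq> {}" using assms(1) VS by (simp add: connected_graph_def induced_subgraph_def)
  then obtain v where v: "v \<in> S" by blast
  have r: "S \<subseteq> cluster F S v"
  proof
    fix u assume "u \<in> S"
    then have "(v, u) \<in> {(x, y). {x, y} \<in> F \<and> {x,y} \<subseteq> S}\<^sup>*"
      using assms(1) v VS by (simp add: connected_graph_def induced_subgraph_def reachable_def)
    then show "u \<in> cluster F S v" by (simp add: cluster_def)
  qed
  then have "cluster F S v = S" using cluster_subset[OF v] by auto
  then show ?thesis using conn_cluster[OF v, of F] by simp
qed

text \<open>Greedy growth: \<open>A\<close> is the vertex set of a tree with \<open>j\<close> edges,
  and the cut between \<open>A\<close> and \<open>S - A\<close> offers the next edge.\<close>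

lemma conn_tree:
  assumes "conn F S" "finite S"
  shows "\<exists>T\<subseteq>F \<inter> Pow S. card T + 1 = card S \<and> finite T \<and> conn T S"
proof -
  have "j < card S \<Longrightarrow> \<exists>A T. A \<subseteq> S \<and> card A = Suc j \<and> T \<subseteq> F \<inter> Pow A \<and> card T = j \<and> finite T \<and> conn T A" for j
  proof (induction j)
    case 0
    obtain v where "v \<in> S" using assms(1) by (auto simp: conn_def)
    then show ?case by (intro exI[of _ "{v}"] exI[of _ "{}"]) (simp add: conn_singleton)
  next
    case (Suc j)
    then obtain A T where AT: "A \<subseteq> S" "card A = Suc j" "T \<subseteq> F \<inter> Pow A" "card T = j" "finite T" "conn T A"
      by auto
    then have "A \<noteq> {}" "A \<noteq> S" using Suc.prems by auto
    then obtain x y where xy: "x \<in> A" "y \<in> S - A" "{x,y} \<in> F"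
      using assms(1) AT(1) unfolding conn_def by blast
    have fA: "finite A" using AT assms finite_subset by auto
    have "{x,y} \<notin> T" using AT(3) xy by auto
    moreover have "conn (insert {x,y} T) (A \<union> {y})"
      by (rule conn_Un_edge[of _ _ _ x y]) (use conn_mono[OF AT(6)] xy conn_singleton in auto)
    ultimately show ?case using AT xy fA
      by (intro exI[of _ "A \<union> {y}"] exI[of _ "insert {x,y} T"]) auto
  qed
  from this[of "card S - 1"] obtain A T where AT: "A \<subseteq> S" "card A = card S"
     "T \<subseteq> F \<inter> Pow A" "card T = card S - 1" "finite T" "conn T A"
    using assms by (auto simp: conn_def card_gt_0_iff)
  then have "A = S" using assms(2) by (simp add: card_subset_eq)
  moreover have "card S > 0" using assms by (auto simp: conn_def card_gt_0_iff)
  ultimately show ?thesis using AT by (intro exI[of _ T]) auto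
qed

section \<open>Connected sets in a random subgraph of a regular graph\<close>

locale regular_host =
  fixes V :: "'v set" and E :: "'v set set" and d :: nat
  assumes finV: "finite V"
    and edgeE: "e \<in> E \<Longrightarrow> \<exists>x y. e = {x,y} \<and> x \<noteq> y \<and> x \<in> V \<and> y \<in> V"
    and degE: "v \<in> V \<Longrightarrow> card {e \<in> E. v \<in> e} = d"
begin

definition nb :: "'v \<Rightarrow> 'v set" where "nb v = {u. {v,u} \<in> E}"

lemma edge_V: "{x,y} \<in> E \<Longrightarrow> x \<in> V \<and> y \<in> V" using edgeE by (fastforce simp: doubleton_eq_iff)
lemma EPow: "E \<subseteq> Pow V" using edgeE by auto
lemma finE: "finite E" using EPow finV finite_subset by blast
lemma nb_V: "nb v \<subseteq> V" using edge_V by (auto simp: nb_def)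
lemma nb_sym: "u \<in> nb v \<longleftrightarrow> v \<in> nb u" by (simp add: nb_def insert_commute)
lemma fin_nb: "finite (nb v)" using nb_V finV finite_subset by blast

lemma card_nb: assumes "v \<in> V" shows "card (nb v) = d"
proof -
  have "bij_betw (\<lambda>u. {v,u}) (nb v) {e \<in> E. v \<in> e}"
  proof (rule bij_betwI')
    fix x y show "({v,x} = {v,y}) = (x = y)" by (auto simp: doubleton_eq_iff)
  next
    fix e assume "e \<in> {e \<in> E. v \<in> e}"
    then show "\<exists>x\<in>nb v. e = {v,x}" using edgeE by (fastforce simp: nb_def insert_commute)
  qed (auto simp: nb_def)
  then show ?thesis using degE[OF assms] by (simp add: bij_betw_same_card)
qed

lemma card_nb_le: "card (nb v) \<le> d"
proof (cases "v \<in> V")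
  case False
  then have "nb v = {}" using edge_V by (auto simp: nb_def)
  then show ?thesis by simp
qed (simp add: card_nb)

lemma bd_iff: "F \<subseteq> E \<Longrightarrow> e \<in> bd F S \<longleftrightarrow> e \<in> F \<and> (\<exists>x\<in>S. \<exists>y. y \<notin> S \<and> e = {x,y})"
proof -
  assume F: "F \<subseteq> E"
  show ?thesis
  proof
    assume e: "e \<in> bd F S"
    then have eF: "e \<in> F" and c: "card (e \<inter> S) = 1" by (auto simp: bd_def)
    obtain x y where xy: "e = {x,y}" "x \<noteq> y" using edgeE F eF by blast
    have "(x \<in> S \<and> y \<notin> S) \<or> (x \<notin> S \<and> y \<in> S)"
    proof (rule ccontr)
      assume "\<not> ?thesis"
      then have "e \<inter> S = {} \<or> e \<inter> S = {x,y}" using xy by auto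
      then show False using c xy by auto
    qed
    then show "e \<in> F \<and> (\<exists>x\<in>S. \<exists>y. y \<notin> S \<and> e = {x,y})" using eF xy by (auto simp: insert_commute)
  next
    assume "e \<in> F \<and> (\<exists>x\<in>S. \<exists>y. y \<notin> S \<and> e = {x,y})"
    then obtain x y where "e \<in> F" "x \<in> S" "y \<notin> S" "e = {x,y}" by blast
    then have "e \<inter> S = {x}" by auto
    then show "e \<in> bd F S" using \<open>e \<in> F\<close> by (simp add: bd_def)
  qed
qed

lemma bd_edge: "F \<subseteq> E \<Longrightarrow> {x,y} \<in> F \<Longrightarrow> x \<in> S \<Longrightarrow> y \<notin> S \<Longrightarrow> {x,y} \<in> bd F S"
  by (subst bd_iff) auto

lemma bd_sub: "bd F S \<subseteq> F" by (auto simp: bd_def)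
lemma fin_bd: "F \<subseteq> E \<Longrightarrow> finite (bd F S)" using bd_sub finE finite_subset by (metis subset_trans)

lemma card_bd: assumes "finite S" shows "card (bd E S) = (\<Sum>x\<in>S. card (nb x - S))"
proof -
  have "bij_betw (\<lambda>(x,y). {x,y}) (Sigma S (\<lambda>x. nb x - S)) (bd E S)"
  proof (rule bij_betwI')
    fix a b assume "a \<in> Sigma S (\<lambda>x. nb x - S)" "b \<in> Sigma S (\<lambda>x. nb x - S)"
    then show "((case a of (x, y) \<Rightarrow> {x, y}) = (case b of (x, y) \<Rightarrow> {x, y})) = (a = b)"
      by (auto simp: doubleton_eq_iff)
  next
    fix a assume "a \<in> Sigma S (\<lambda>x. nb x - S)"
    then show "(case a of (x, y) \<Rightarrow> {x, y}) \<in> bd E S" by (auto simp: nb_def bd_edge)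
  next
    fix e assume "e \<in> bd E S"
    then obtain x y where "e \<in> E" "x \<in> S" "y \<notin> S" "e = {x,y}" using bd_iff by blast
    then show "\<exists>a\<in>Sigma S (\<lambda>x. nb x - S). e = (case a of (x, y) \<Rightarrow> {x, y})"
      by (intro bexI[of _ "(x,y)"]) (auto simp: nb_def)
  qed
  then have "card (bd E S) = card (Sigma S (\<lambda>x. nb x - S))" by (simp add: bij_betw_same_card)
  also have "\<dots> = (\<Sum>x\<in>S. card (nb x - S))" using assms fin_nb by (intro card_SigmaI) auto
  finally show ?thesis .
qed

lemma degree_sum: assumes "S \<subseteq> V" shows "d * card S = (\<Sum>x\<in>S. card (nb x \<inter> S)) + card (bd E S)"
proof -
  have fS: "finite S" using assms finV finite_subset by blast
  have "(\<Sum>x\<in>S. card (nb x \<inter> S)) + (\<Sum>x\<in>S. card (nb x - S)) = (\<Sum>x\<in>S. card (nb x))"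
    unfolding sum.distrib[symmetric]
    by (intro sum.cong refl) (rule card_Int_Diff[symmetric, OF fin_nb])
  also have "\<dots> = d * card S" using card_nb assms by (simp add: subset_iff)
  finally show ?thesis using card_bd[OF fS] by simp
qed

section \<open>Weights of connected sets and the number of vertices met by open boundary
  edges\<close>

definition pconn :: "real \<Rightarrow> 'v set \<Rightarrow> real" where
  "pconn p S = pex p E (\<lambda>F. of_bool (conn F S))"

lemma pconn_nonneg: "0 \<le> p \<Longrightarrow> p \<le> 1 \<Longrightarrow> 0 \<le> pconn p S"
  unfolding pconn_def by (intro pex_nonneg) auto

lemma bd_Pow_disj: "Pow S \<inter> bd E S = {}"
  using bd_iff[OF order_refl] by blast

text \<open>The event says that \<open>S\<close> is a whole cluster. Connectedness depends on edges
  inside \<open>S\<close> and closedness on edges leaving it, so the two are independent.\<close>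

lemma pconn_closed:
  "pex p E (\<lambda>F. of_bool (conn F S \<and> F \<inter> bd E S = {})) = pconn p S * (1 - p) ^ card (bd E S)"
proof -
  have "pex p E (\<lambda>F. of_bool (conn F S \<and> F \<inter> bd E S = {}))
     = pex p E (\<lambda>F. of_bool (conn F S) * of_bool (F \<inter> bd E S = {}))"
    by (intro pex_cong) auto
  also have "\<dots> = pex p E (\<lambda>F. of_bool (conn F S)) * pex p E (\<lambda>F. of_bool (F \<inter> bd E S = {}))"
    using bd_Pow_disj by (intro pex_indep[where A="Pow S" and B="bd E S"] finE)
      (auto simp: conn_Int_Pow[symmetric])
  also have "pex p E (\<lambda>F. of_bool (F \<inter> bd E S = {})) = (1 - p) ^ card (bd E S)"
    using pex_pattern[OF finE bd_sub, where B="{}"] by simp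
  finally show ?thesis by (simp add: pconn_def)
qed

lemma conn_closed_unique:
  assumes "conn F S" "F \<inter> bd E S = {}" "conn F S'" "v \<in> S" "v \<in> S'" "F \<subseteq> E"
  shows "S' \<subseteq> S"
  by (rule conn_subset_closed[OF assms(3,5,4)]) (use assms(2,6) bd_edge[OF order_refl] in blast)

lemma animal_sum:
  assumes "0 \<le> p" "p \<le> 1" "finite \<S>" "\<And>S. S \<in> \<S> \<Longrightarrow> v \<in> S"
  shows "(\<Sum>S\<in>\<S>. pconn p S * (1 - p) ^ card (bd E S)) \<le> 1"
proof -
  have "(\<Sum>S\<in>\<S>. pconn p S * (1 - p) ^ card (bd E S))
    = pex p E (\<lambda>F. \<Sum>S\<in>\<S>. of_bool (conn F S \<and> F \<inter> bd E S = {}))"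
    by (simp only: pex_sum pconn_closed)
  also have "\<dots> \<le> pex p E (\<lambda>F. 1)"
  proof (rule pex_mono[OF assms(1,2)])
    fix F assume F: "F \<subseteq> E"
    let ?T = "{S\<in>\<S>. conn F S \<and> F \<inter> bd E S = {}}"
    have "S = S'" if "S \<in> ?T" "S' \<in> ?T" for S S'
      using conn_closed_unique[of F S S' v] conn_closed_unique[of F S' S v] that assms(4) F by blast
    then have "card ?T \<le> 1" using assms(3) by (subst One_nat_def, subst card_le_Suc0_iff_eq) auto
    then show "(\<Sum>S\<in>\<S>. of_bool (conn F S \<and> F \<inter> bd E S = {})) \<le> (1::real)"
      using assms(3) by (simp add: Int_def)
  qed
  finally show ?thesis using finE by (simp add: pex_const)
qed

lemma pconn_thin:
  assumes "0 \<le> p" "p \<le> 1" "0 \<le> r" "r \<le> 1" "finite S"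
  shows "r ^ (card S - 1) * pconn p S \<le> pconn (p * r) S"
proof -
  have "r ^ (card S - 1) * pconn p S = pex p E (\<lambda>F. r ^ (card S - 1) * of_bool (conn F S))"
    by (simp add: pconn_def pex_cmult)
  also have "\<dots> \<le> pex p E (\<lambda>F. pex r F (\<lambda>F'. of_bool (conn F' S)))"
  proof (rule pex_mono[OF assms(1,2)])
    fix F assume F: "F \<subseteq> E"
    have fF: "finite F" using F finE finite_subset by blast
    show "r ^ (card S - 1) * of_bool (conn F S) \<le> pex r F (\<lambda>F'. of_bool (conn F' S))"
    proof (cases "conn F S")
      case True
      then obtain T where T: "T \<subseteq> F \<inter> Pow S" "card T + 1 = card S" "conn T S"
        using conn_tree assms(5) by blast
      have "r ^ (card S - 1) = pex r F (\<lambda>F'. of_bool (T \<subseteq> F'))"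
        using pex_superset[OF fF, of T r] T(1) T(2)[symmetric] by simp
      also have "\<dots> \<le> pex r F (\<lambda>F'. of_bool (conn F' S))"
        using T(3) conn_mono assms by (intro pex_mono) (auto simp: of_bool_def)
      finally show ?thesis using True by simp
    next
      case False
      then show ?thesis using assms by (auto intro!: pex_nonneg)
    qed
  qed
  also have "\<dots> = pconn (p * r) S" unfolding pconn_def by (rule pex_thin[OF finE, symmetric])
  finally show ?thesis .
qed

lemma pconn_le:
  assumes "0 < p'" "p' \<le> p" "p \<le> 1" "finite S"
  shows "pconn p S \<le> (p / p') ^ (card S - 1) * pconn p' S"
proof -
  have "(p'/p) ^ (card S - 1) * pconn p S \<le> pconn (p * (p'/p)) S"
    using assms by (intro pconn_thin) auto
  then show ?thesis using assms by (simp add: field_simps power_divide)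
qed

text \<open>Markov's inequality for \<open>x\<close> to the power of the number of vertices met. The
  sets \<open>B v\<close> are disjoint, so the expectation factorizes; with
  \<open>y = p * card (B v) \<le> 2\<close> one factor is at most
  \<open>exp (-y) * (1 + x * (exp y - 1))\<close>, and
  \<open>exp y - 1 \<le> y * exp y \<le> 8 * y\<close> explains the \<open>8\<close>. For small
  \<open>x\<close> the exponential is close to the probability that the whole boundary is
  closed.\<close>

lemma hit_prob:
  fixes p x a :: real
  assumes "0 \<le> p" "p \<le> 1" "p * d \<le> 2" "0 < x" "x \<le> 1"
    and N: "finite N" "disjoint_family_on B N" "(\<Union>v\<in>N. B v) = bd E S" "\<And>v. v \<in> N \<Longrightarrow> card (B v) \<le> d"
  shows "pex p E (\<lambda>F. of_bool (real (card {v\<in>N. F \<inter> B v \<noteq> {}}) < a))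
     \<le> x powr (-a) * exp (- p * (1 - 8 * x) * card (bd E S))"
proof -
  have BE: "B v \<subseteq> E" if "v \<in> N" for v using N(3) that bd_sub by blast
  have "pex p E (\<lambda>F. of_bool (real (card {v\<in>N. F \<inter> B v \<noteq> {}}) < a))
    \<le> pex p E (\<lambda>F. x powr (-a) * (\<Prod>v\<in>N. if F \<inter> B v \<noteq> {} then x else 1))"
  proof (rule pex_mono[OF assms(1,2)])
    fix F assume F: "F \<subseteq> E"
    let ?j = "card {v\<in>N. F \<inter> B v \<noteq> {}}"
    have eq: "(\<Prod>v\<in>N. if F \<inter> B v \<noteq> {} then x else 1) = x ^ ?j"
      using N(1) by (simp add: prod.inter_filter[symmetric])
    show "of_bool (real ?j < a) \<le> x powr (-a) * (\<Prod>v\<in>N. if F \<inter> B v \<noteq> {} then x else 1)"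
    proof (cases "real ?j < a")
      case True
      have "1 \<le> x powr (real ?j - a)" using True assms powr_mono'[of "real ?j - a" 0 x] by simp
      then show ?thesis using True assms
        by (simp add: eq powr_diff powr_minus field_simps powr_realpow)
    qed (use assms in \<open>simp add: eq\<close>)
  qed
  also have "\<dots> = x powr (-a) * (\<Prod>v\<in>N. pex p E (\<lambda>F. if F \<inter> B v \<noteq> {} then x else 1))"
    unfolding pex_cmult using N by (subst pex_prod[OF finE N(1,2)]) auto
  also have "(\<Prod>v\<in>N. pex p E (\<lambda>F. if F \<inter> B v \<noteq> {} then x else 1))
      \<le> (\<Prod>v\<in>N. exp (- p * (1 - 8 * x) * card (B v)))"
  proof (rule prod_mono, intro conjI)
    fix v assume v: "v \<in> N"
    let ?y = "p * card (B v)"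
    have y: "0 \<le> ?y" "?y \<le> 2" using assms(1,3) N(4)[OF v] mult_left_mono[of "real (card (B v))" "real d" p] by auto
    have e: "exp 2 \<le> (8::real)" 
    proof -
      have "exp 2 = exp 1 * exp (1::real)" by (simp add: exp_add[symmetric])
      also have "\<dots> \<le> 2.75 * 2.75" using e_less_272 by (intro mult_mono) auto
      finally show ?thesis by simp
    qed
    have "exp ?y * (1 - ?y) \<le> 1" 
      using exp_ge_add_one_self[of "-?y"] mult_left_mono[of "1 - ?y" "exp(-?y)" "exp ?y"] by (simp add: exp_minus)
    then have "exp ?y - 1 \<le> ?y * exp ?y" by (simp add: algebra_simps)
    also have "\<dots> \<le> ?y * 8" using y e order_trans[of "exp ?y" "exp 2" 8] by (intro mult_left_mono) auto
    finally have ey: "exp ?y - 1 \<le> ?y * 8" .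
    have "(1 - p) ^ card (B v) \<le> exp (-p) ^ card (B v)"
      using assms exp_ge_add_one_self[of "-p"] by (intro power_mono) auto
    also have "\<dots> = exp (-?y)" by (simp add: exp_of_nat_mult[symmetric] mult.commute)
    finally have "x + (1 - x) * (1 - p) ^ card (B v) \<le> x + (1 - x) * exp (-?y)"
      using assms by (intro add_left_mono mult_left_mono) auto
    also have "\<dots> = exp (-?y) * (1 + x * (exp ?y - 1))" by (simp add: algebra_simps exp_minus)
    also have "\<dots> \<le> exp (-?y) * exp (x * (?y * 8))"
      using exp_ge_add_one_self[of "x * (?y * 8)"] mult_left_mono[OF ey less_imp_le[OF assms(4)]]
      by (intro mult_left_mono) (linarith, simp)
    also have "\<dots> = exp (- p * (1 - 8 * x) * card (B v))" by (simp add: exp_add[symmetric] algebra_simps)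
    finally show "pex p E (\<lambda>F. if F \<inter> B v \<noteq> {} then x else 1) \<le> exp (- p * (1 - 8 * x) * card (B v))"
      by (simp add: pex_hit[OF finE BE[OF v]])
    show "0 \<le> pex p E (\<lambda>F. if F \<inter> B v \<noteq> {} then x else 1)"
      using assms by (intro pex_nonneg) auto
  qed
  also have "(\<Prod>v\<in>N. exp (- p * (1 - 8 * x) * card (B v))) = exp (- p * (1 - 8 * x) * card (bd E S))"
  proof -
    have "card (bd E S) = (\<Sum>v\<in>N. card (B v))"
      unfolding N(3)[symmetric] using N(1,2) finite_subset[OF BE finE]
      by (intro card_UN_disjoint) (auto simp: disjoint_family_on_def)
    then show ?thesis using N(1) by (simp add: exp_sum sum_distrib_left)
  qed
  finally show ?thesis by (simp add: mult_left_mono)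
qed

text \<open>Connectedness may use both rounds while only boundary edges of the first round are
  counted: the expansion has to be present in \<open>F1\<close> already, before the second round is
  used for paths. Edges inside \<open>S\<close> and boundary edges are disjoint, so the two
  probabilities multiply.\<close>

lemma conn_hit_prob:
  fixes p p1 p2 x a :: real
  assumes "0 \<le> p1" "p1 \<le> 1" "p1 * d \<le> 2" "0 < x" "x \<le> 1" "1 - p = (1 - p1) * (1 - p2)"
    and N: "finite N" "disjoint_family_on B N" "(\<Union>v\<in>N. B v) = bd E S" "\<And>v. v \<in> N \<Longrightarrow> card (B v) \<le> d"
    and "0 \<le> p" "p \<le> 1"
  shows "pex p1 E (\<lambda>F1. pex p2 E (\<lambda>F2. of_bool (conn (F1 \<union> F2) S \<and> real (card {v\<in>N. F1 \<inter> B v \<noteq> {}}) < a)))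
     \<le> pconn p S * (x powr (-a) * exp (- p1 * (1 - 8 * x) * card (bd E S)))"
proof -
  let ?h = "\<lambda>F1. of_bool (real (card {v\<in>N. F1 \<inter> B v \<noteq> {}}) < a)"
  have "pex p1 E (\<lambda>F1. pex p2 E (\<lambda>F2. of_bool (conn (F1 \<union> F2) S \<and> real (card {v\<in>N. F1 \<inter> B v \<noteq> {}}) < a)))
    = pex p1 E (\<lambda>F1. pex p2 E (\<lambda>F2. of_bool (conn (F1 \<union> F2) S)) * ?h F1)"
    by (intro pex_cong) (auto simp: of_bool_conj pex_const[OF finE])
  also have "\<dots> = pex p1 E (\<lambda>F1. pex p2 E (\<lambda>F2. of_bool (conn (F1 \<union> F2) S))) * pex p1 E ?h"
  proof (rule pex_indep[OF finE bd_Pow_disj[of S]])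
    fix F1 assume "F1 \<subseteq> E"
    show "pex p2 E (\<lambda>F2. of_bool (conn (F1 \<union> F2) S)) = pex p2 E (\<lambda>F2. of_bool (conn (F1 \<inter> Pow S \<union> F2) S))"
    proof (rule pex_cong)
      fix F2
      have "conn (F1 \<union> F2) S \<longleftrightarrow> conn ((F1 \<union> F2) \<inter> Pow S) S" by (rule conn_Int_Pow)
      also have "(F1 \<union> F2) \<inter> Pow S = (F1 \<inter> Pow S \<union> F2) \<inter> Pow S" by auto
      also have "conn \<dots> S \<longleftrightarrow> conn (F1 \<inter> Pow S \<union> F2) S" by (rule conn_Int_Pow[symmetric])
      finally show "of_bool (conn (F1 \<union> F2) S) = of_bool (conn (F1 \<inter> Pow S \<union> F2) S)" by (rule arg_cong)
    qed
    have "F1 \<inter> bd E S \<inter> B v = F1 \<inter> B v" if "v \<in> N" for v using N(3) that by auto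
    then have "{v\<in>N. F1 \<inter> bd E S \<inter> B v \<noteq> {}} = {v\<in>N. F1 \<inter> B v \<noteq> {}}" by auto
    then show "?h F1 = ?h (F1 \<inter> bd E S)" by simp
  qed
  also have "pex p1 E (\<lambda>F1. pex p2 E (\<lambda>F2. of_bool (conn (F1 \<union> F2) S))) = pconn p S"
    unfolding pconn_def by (rule pex_rounds[OF finE assms(6), symmetric])
  finally show ?thesis using hit_prob[OF assms(1-5) N, of a] pconn_nonneg[OF assms(11,12)]
    by (simp add: mult_left_mono)
qed

text \<open>\<open>Bk v\<close> is the block of \<open>v\<close> in a partition of \<open>S\<close> into small connected blocks. A minimal union of blocks with at least
  \<open>s\<close> vertices that is connected and has connected complement is not much larger than \<open>s\<close>.\<close>

lemma conn_split:
  assumes FE: "F \<subseteq> E"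
    and Bk: "\<And>v. v \<in> S \<Longrightarrow> v \<in> Bk v \<and> conn F (Bk v) \<and> card (Bk v) \<le> m \<and> finite (Bk v)"
            "\<And>v u. v \<in> S \<Longrightarrow> u \<in> Bk v \<Longrightarrow> Bk u = Bk v"
    and S': "S' \<subseteq> S" "finite S" "conn F S'" "\<forall>v\<in>S'. Bk v \<subseteq> S'" "d * m * s + m < card S'" "s \<le> card S'"
  shows "\<exists>U. U \<subseteq> S' \<and> conn F U \<and> conn F (S' - U) \<and> (\<forall>v\<in>U. Bk v \<subseteq> U) \<and> s \<le> card U \<and> card U \<le> d * m * s + m"
proof -
  define P where "P U \<longleftrightarrow> U \<subseteq> S' \<and> conn F U \<and> (\<forall>v\<in>U. Bk v \<subseteq> U) \<and> (U = S' \<or> conn F (S' - U)) \<and> s \<le> card U" for U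
  have bound: "\<exists>K. P K \<and> card K < card U" if PU: "P U" and big: "d * m * s + m < card U" for U
  proof -
    have U: "U \<subseteq> S'" "conn F U" "\<And>v. v \<in> U \<Longrightarrow> Bk v \<subseteq> U" "U = S' \<or> conn F (S' - U)"
      using PU by (auto simp: P_def)
    have fU: "finite U" using U(1) S'(1,2) by (meson finite_subset)
    \<comment> \<open>\<open>x\<close> is chosen next to \<open>S' - U\<close>. Its block
      \<open>X\<close> is never part of the piece \<open>K\<close> found below, so the remainder
      \<open>U - K\<close> stays attached to \<open>S' - U\<close>.\<close>
    have "\<exists>x\<in>U. U = S' \<or> (\<exists>y\<in>S'-U. {x,y} \<in> F)"
      using S'(3) U(1,2) unfolding conn_def by blast
    then obtain x where x: "x \<in> U" "U = S' \<or> (\<exists>y\<in>S'-U. {x,y} \<in> F)" by blast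
    define X where "X = Bk x"
    have xS: "x \<in> S" using x U S' by blast
    have X: "X \<subseteq> U" "x \<in> X" "conn F X" "card X \<le> m" "finite X"
      using U(3)[OF x(1)] Bk(1)[OF xS] by (auto simp: X_def)
    define \<K> where "\<K> = cluster F (U - X) ` (U - X)"
    have Kp: "conn F K \<and> K \<subseteq> U - X \<and> (\<exists>a\<in>X. \<exists>k\<in>K. {a,k} \<in> F)" if KK: "K \<in> \<K>" for K
    proof -
      obtain v where v: "v \<in> U - X" "K = cluster F (U - X) v" using KK by (auto simp: \<K>_def)
      have K: "conn F K" "K \<subseteq> U - X" "v \<in> K" using conn_cluster[OF v(1)] cluster_subset[OF v(1)] v(2) by auto
      have "x \<in> U - K" using x X K by blast
      then obtain k y where ky: "k \<in> K" "y \<in> U - K" "{k,y} \<in> F"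
        using conn_cut[OF U(2), of K v x] K by blast
      then have "y \<in> X" using cluster_step[of k F "U - X" v y] K(2) v by blast
      then show ?thesis using K ky by (metis insert_commute)
    qed
    have Kdisj: "K = K'" if "K \<in> \<K>" "K' \<in> \<K>" "k \<in> K" "k \<in> K'" for K K' k
      using that cluster_eq[of _ "U - X"] unfolding \<K>_def by blast
    have UX: "U - X = \<Union>\<K>"
    proof
      show "U - X \<subseteq> \<Union>\<K>" unfolding \<K>_def using cluster_refl by fast
      show "\<Union>\<K> \<subseteq> U - X" using Kp by blast
    qed
    have fK: "finite \<K>" using fU by (auto simp: \<K>_def)
    \<comment> \<open>One edge from \<open>X\<close> to every component of \<open>U - X\<close>:
      distinct components give distinct pairs, so there are at most \<open>card X * d\<close> of
      them. Since \<open>U\<close> is too large for all of them to have fewer than \<open>s\<close>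
      vertices, some component qualifies as a smaller candidate.\<close>
    define f where "f K = (SOME ak. fst ak \<in> X \<and> snd ak \<in> K \<and> {fst ak, snd ak} \<in> F)" for K
    have f: "fst (f K) \<in> X \<and> snd (f K) \<in> K \<and> {fst (f K), snd (f K)} \<in> F" if "K \<in> \<K>" for K
      unfolding f_def by (rule someI_ex) (use Kp[OF that] in force)
    have "card \<K> \<le> card (Sigma X nb)"
    proof (rule card_inj_on_le[of f])
      show "inj_on f \<K>" using f Kdisj by (metis inj_onI)
      show "f ` \<K> \<subseteq> Sigma X nb"
      proof (rule image_subsetI)
        fix K assume "K \<in> \<K>"
        from f[OF this] FE show "f K \<in> Sigma X nb" by (cases "f K") (auto simp: nb_def)
      qed
      show "finite (Sigma X nb)" using X fin_nb by auto
    qed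
    also have "\<dots> = (\<Sum>x\<in>X. card (nb x))" using X fin_nb by (simp add: card_SigmaI)
    also have "\<dots> \<le> card X * d" using sum_bounded_above[of X "\<lambda>x. card (nb x)" d] card_nb_le by simp
    also have "\<dots> \<le> m * d" using X by simp
    finally have cK: "card \<K> \<le> m * d" .
    have "\<exists>K\<in>\<K>. s \<le> card K"
    proof (rule ccontr)
      assume "\<not> ?thesis"
      then have lt: "\<And>K. K \<in> \<K> \<Longrightarrow> card K \<le> s" by force
      have "card (U - X) \<le> (\<Sum>K\<in>\<K>. card K)" unfolding UX by (rule card_Union_le_sum_card)
      also have "\<dots> \<le> card \<K> * s" using sum_bounded_above[of \<K> card s] lt by simp
      also have "\<dots> \<le> m * d * s" using cK by simp
      finally have "card (U - X) \<le> m * d * s" .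
      moreover have "card U = card X + card (U - X)" using X fU by (metis card_mono card_Diff_subset le_add_diff_inverse)
      ultimately show False using big X(4) by (simp add: algebra_simps)
    qed
    then obtain K where K: "K \<in> \<K>" "s \<le> card K" by blast
    have KU: "K \<subseteq> U - X" "conn F K" using Kp[OF K(1)] by auto
    have ubK: "Bk v \<subseteq> K" if v: "v \<in> K" for v
    proof -
      have vS: "v \<in> S" "v \<in> U" using v KU U S' by auto
      have "Bk v \<inter> X = {}"
      proof (rule ccontr)
        assume "Bk v \<inter> X \<noteq> {}"
        then obtain z where "z \<in> Bk v" "z \<in> Bk x" by (auto simp: X_def)
        then have "Bk v = Bk x" using Bk(2) vS xS by metis
        then show False using Bk(1)[OF vS(1)] v KU by (auto simp: X_def)
      qed
      then have sub: "Bk v \<subseteq> U - X" using U(3) vS by blast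
      obtain w where w: "w \<in> U - X" "K = cluster F (U - X) w" using K(1) by (auto simp: \<K>_def)
      have "Bk v \<subseteq> cluster F (U - X) v" using conn_sub_cluster[of F "Bk v" "U - X" v] Bk(1)[OF vS(1)] sub by blast
      then show ?thesis using cluster_eq[OF w(1), of v F] v w(2) by simp
    qed
    have "conn F (X \<union> \<Union>(\<K> - {K}))" using X(3) Kp by (intro conn_Union_hub) auto
    moreover have "X \<union> \<Union>(\<K> - {K}) = U - K" using UX X(1) KU Kdisj K(1) by fast
    ultimately have cUK: "conn F (U - K)" by simp
    have "conn F (S' - K)"
    proof (cases "U = S'")
      case True then show ?thesis using cUK by simp
    next
      case False
      then obtain y where y: "y \<in> S' - U" "{x,y} \<in> F" using x by blast
      have "conn F ((U - K) \<union> (S' - U))"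
        using conn_Un_edge[OF cUK _ _ y(1) y(2)] U(4) False x X KU by blast
      moreover have "(U - K) \<union> (S' - U) = S' - K" using U(1) KU by blast
      ultimately show ?thesis by simp
    qed
    then have "P K" unfolding P_def using KU U(1) ubK K by blast
    moreover have "card K < card U" using KU x X fU by (intro psubset_card_mono) auto
    ultimately show ?thesis by blast
  qed
  have "P S'" unfolding P_def using S' by auto
  then obtain U where U: "P U" "\<And>K. P K \<Longrightarrow> card U \<le> card K" using ex_has_least_nat[of P S' card] by blast
  then have cU: "card U \<le> d * m * s + m" using bound[OF U(1)] by (meson leD not_le_imp_less)
  then have "U \<noteq> S'" using S'(5) by auto
  then show ?thesis using U(1) cU by (auto simp: P_def)
qed

text \<open>Pieces of bounded size are split off until the rest is bounded too, and their bounds are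
  added. A piece has at most \<open>d * m * s + m\<close> vertices; the extra \<open>s\<close> in
  the threshold guarantees that the remainder still has at least \<open>s\<close>.\<close>

lemma conn_pieces:
  assumes FE: "F \<subseteq> E"
    and Bk: "\<And>v. v \<in> S \<Longrightarrow> v \<in> Bk v \<and> conn F (Bk v) \<and> card (Bk v) \<le> m \<and> finite (Bk v)"
            "\<And>v u. v \<in> S \<Longrightarrow> u \<in> Bk v \<Longrightarrow> Bk u = Bk v"
    and S: "finite S"
    and w: "\<And>U. U \<subseteq> S \<Longrightarrow> conn F U \<Longrightarrow> \<forall>v\<in>U. Bk v \<subseteq> U \<Longrightarrow> s \<le> card U \<Longrightarrow> card U \<le> d * m * s + m + s
       \<Longrightarrow> c * real (card U) \<le> sum w U"
    and S': "S' \<subseteq> S" "conn F S'" "\<forall>v\<in>S'. Bk v \<subseteq> S'" "s \<le> card S'"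
  shows "c * real (card S') \<le> sum w S'"
  using S'
proof (induction "card S'" arbitrary: S' rule: less_induct)
  case less
  have fS': "finite S'" using less S finite_subset by blast
  show ?case
  proof (cases "card S' \<le> d * m * s + m + s")
    case True then show ?thesis using w less by blast
  next
    case False
    then obtain U where U: "U \<subseteq> S'" "conn F U" "conn F (S' - U)" "\<forall>v\<in>U. Bk v \<subseteq> U" "s \<le> card U" "card U \<le> d * m * s + m"
      using conn_split[OF FE Bk less.prems(1) S less.prems(2,3) _ less.prems(4)] by (auto simp: not_le)
    have fU: "finite U" using U fS' finite_subset by blast
    have c: "card (S' - U) = card S' - card U" using U fU by (simp add: card_Diff_subset)
    have "U \<noteq> {}" using U(2) by (auto simp: conn_def)
    then have "card U > 0" using fU by (simp add: card_gt_0_iff)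
    then have lt: "card (S' - U) < card S'" using c False by linarith
    have "\<forall>v\<in>S'-U. Bk v \<subseteq> S' - U"
    proof
      fix v assume v: "v \<in> S' - U"
      have "z \<notin> U" if z: "z \<in> Bk v" for z
      proof
        assume "z \<in> U"
        then have "Bk z \<subseteq> U" using U by blast
        moreover have "Bk z = Bk v" using Bk(2)[OF _ z] v less.prems by blast
        ultimately show False using Bk(1)[of v] v less.prems by blast
      qed
      then show "Bk v \<subseteq> S' - U" using v less.prems by blast
    qed
    moreover have "s \<le> card (S' - U)" using c False U by linarith
    ultimately have "c * real (card (S' - U)) \<le> sum w (S' - U)"
      using less.hyps[OF lt] U(3) less.prems(1) by blast
    moreover have "c * real (card U) \<le> sum w U" using w[of U] U less.prems by auto
    moreover have "sum w S' = sum w U + sum w (S' - U)" using U fS' by (metis sum.subset_diff add.commute)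
    moreover have "real (card S') = real (card U) + real (card (S' - U))"
      using c U fS' card_mono[OF fS' U(1)] by simp
    ultimately show ?thesis by (simp add: algebra_simps)
  qed
qed

text \<open>Expansion of sets of moderate size by \<open>F1\<close> edges forces a positive
  proportion of \<open>S\<close> into \<open>F1\<close>-clusters inside \<open>S\<close> with at
  least \<open>m\<close> vertices, unless the boundary of \<open>S\<close> is large. The blocks are
  the smaller clusters and the single vertices of the larger ones. If a vertex of a piece
  \<open>U\<close> lies in a small cluster and has an \<open>F1\<close> edge leaving
  \<open>U\<close>, that edge leaves \<open>S\<close> as well, since the cluster is contained in
  \<open>U\<close>; hence the weight \<open>w\<close>, which counts vertices of large clusters and
  boundary edges of \<open>S\<close>.\<close>

lemma large_pieces:
  assumes F1: "F1 \<subseteq> F" and FE: "F \<subseteq> E" and S: "S \<subseteq> V" "conn F S" "s \<le> card S" and m: "1 \<le> m"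
    and inner: "\<And>U. U \<subseteq> V \<Longrightarrow> conn F U \<Longrightarrow> s \<le> card U \<Longrightarrow> card U \<le> d * m * s + m + s
       \<Longrightarrow> c * real (card U) \<le> card {v\<in>U. F1 \<inter> {e\<in>bd E U. v \<in> e} \<noteq> {}}"
  shows "c * card S \<le> card {v\<in>S. m \<le> card (cluster F1 S v)} + card (bd F S)"
proof -
  let ?W = "{v\<in>S. m \<le> card (cluster F1 S v)}"
  define Bk where "Bk v = (if v \<in> ?W then {v} else cluster F1 S v)" for v
  define w where "w v = real (of_bool (v \<in> ?W) + card {e\<in>bd F S. v \<in> e})" for v
  have fS: "finite S" using S finV finite_subset by blast
  have cs: "cluster F1 S v \<subseteq> S" if "v \<in> S" for v using cluster_subset[OF that] .
  have weq: "u \<in> ?W \<longleftrightarrow> v \<in> ?W" if "v \<in> S" "u \<in> cluster F1 S v" for u v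
    using cluster_eq[OF that] cs[OF that(1)] that by auto
  have Bk1: "v \<in> Bk v \<and> conn F (Bk v) \<and> card (Bk v) \<le> m \<and> finite (Bk v)" if v: "v \<in> S" for v
    using v m conn_singleton[of F v] conn_mono[OF conn_cluster[OF v] F1] finite_subset[OF cs[OF v] fS]
    by (auto simp: Bk_def)
  have Bk2: "Bk u = Bk v" if "v \<in> S" "u \<in> Bk v" for u v
    using that weq[of v u] cluster_eq[of v S u F1] by (auto simp: Bk_def split: if_splits)
  have main: "c * real (card S) \<le> sum w S"
  proof (rule conn_pieces[OF FE Bk1 Bk2 fS _ order_refl S(2) _ S(3)])
    show "\<forall>v\<in>S. Bk v \<subseteq> S" using cs by (auto simp: Bk_def)
    fix U assume U: "U \<subseteq> S" "conn F U" "\<forall>v\<in>U. Bk v \<subseteq> U" "s \<le> card U" "card U \<le> d * m * s + m + s"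
    have fU: "finite U" using U fS finite_subset by blast
    have "c * real (card U) \<le> card {v\<in>U. F1 \<inter> {e\<in>bd E U. v \<in> e} \<noteq> {}}"
      using inner U S by blast
    also have "\<dots> = (\<Sum>v\<in>U. of_bool (F1 \<inter> {e\<in>bd E U. v \<in> e} \<noteq> {}))" using fU by (simp add: Int_def)
    also have "\<dots> \<le> sum w U"
    proof (rule sum_mono)
      fix v assume v: "v \<in> U"
      have vS: "v \<in> S" using v U by blast
      show "of_bool (F1 \<inter> {e\<in>bd E U. v \<in> e} \<noteq> {}) \<le> w v"
      proof (cases "F1 \<inter> {e\<in>bd E U. v \<in> e} \<noteq> {} \<and> v \<notin> ?W")
        case True
        then obtain e where e: "e \<in> F1" "e \<in> bd E U" "v \<in> e" by blast
        obtain x y where xy: "x \<in> U" "y \<notin> U" "e = {x,y}" using e(2) bd_iff[OF order_refl] by blast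
        have vx: "x = v" using e v xy by auto
        have "y \<notin> S"
        proof
          assume "y \<in> S"
          then have "y \<in> cluster F1 S v" using cluster_step[of v F1 S v y] vS e xy vx by auto
          moreover have "Bk v = cluster F1 S v" unfolding Bk_def using True by (intro if_not_P) blast
          ultimately have "y \<in> Bk v" by simp
          then show False using U v xy by blast
        qed
        then have "e \<in> bd F S" using bd_edge[OF FE, of v y S] e xy vx F1 vS by blast
        then have "{e\<in>bd F S. v \<in> e} \<noteq> {}" using e by blast
        then have "card {e\<in>bd F S. v \<in> e} \<ge> 1" using fin_bd[OF FE] by (simp add: Suc_le_eq card_gt_0_iff)
        then show ?thesis by (simp add: w_def)
      qed (use vS in \<open>auto simp: w_def\<close>)
    qed
    finally show "c * real (card U) \<le> sum w U" .
  qed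
  have "(\<Sum>v\<in>S. card {e\<in>bd F S. v \<in> e}) = (\<Sum>v\<in>S. \<Sum>e\<in>bd F S. of_bool (v \<in> e))"
    using fin_bd[OF FE] by (simp add: Int_def)
  also have "\<dots> = (\<Sum>e\<in>bd F S. \<Sum>v\<in>S. of_bool (v \<in> e))" by (rule sum.swap)
  also have "\<dots> = (\<Sum>e\<in>bd F S. card (e \<inter> S))" using fS by (simp add: Int_def conj_commute)
  also have "\<dots> = card (bd F S)" by (simp add: bd_def)
  finally have "sum w S = card ?W + card (bd F S)"
    using fS by (simp add: w_def sum.distrib flip: of_nat_sum) (simp add: Int_def)
  then show ?thesis using main by simp
qed

end

section \<open>Edge isoperimetry in product graphs\<close>

text \<open>Han's inequality in combinatorial form. For a uniformly random point of
  \<open>S\<close>, the logarithm of the number of points of \<open>S\<close> that differ from it at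
  most in coordinate \<open>j\<close> has as its mean the conditional entropy of coordinate
  \<open>j\<close> given the others, and these entropies add up to at most
  \<open>ln (card S)\<close>. The induction splits off coordinate \<open>i\<close>.\<close>

lemma fibre_entropy:
  fixes S :: "('i \<Rightarrow> 'a) set"
  assumes "finite I" "finite S" "\<And>x y. x \<in> S \<Longrightarrow> y \<in> S \<Longrightarrow> (\<forall>i\<in>I. x i = y i) \<Longrightarrow> x = y"
  shows "(\<Sum>x\<in>S. \<Sum>j\<in>I. ln (real (card {y\<in>S. \<forall>l\<in>I-{j}. y l = x l}))) \<le> card S * ln (card S)"
  using assms
proof (induction I arbitrary: S rule: finite_induct)
  case empty
  show ?case by (cases "S = {}") (auto simp: card_gt_0_iff Suc_le_eq empty.prems(1))
next
  case (insert i I)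
  let ?m = "\<lambda>S I j x. ln (real (card {y\<in>S. \<forall>l\<in>I-{j}. y l = x l}))"
  define K where "K x = {z\<in>S. z i = x i}" for x :: "'i \<Rightarrow> 'a"
  define A where "A x = {y\<in>S. \<forall>l\<in>I. y l = x l}" for x :: "'i \<Rightarrow> 'a"
  let ?k = "real (card S)"
  note fS = insert.prems(1)
  show ?case
  proof (cases "S = {}")
    case False
    then have k0: "?k > 0" using fS by (simp add: card_gt_0_iff)
    have grp: "(\<Sum>x\<in>S. f x) = (\<Sum>a\<in>(\<lambda>x. x i) ` S. \<Sum>x\<in>{x\<in>S. x i = a}. f x)" for f :: "_ \<Rightarrow> real"
      using sum.image_gen[OF fS] .
    have "(\<Sum>x\<in>S. \<Sum>j\<in>I. ?m S (insert i I) j x) =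
        (\<Sum>a\<in>(\<lambda>x. x i) ` S. \<Sum>x\<in>{x\<in>S. x i = a}. \<Sum>j\<in>I. ?m {x\<in>S. x i = a} I j x)"
      unfolding grp
    proof (intro sum.cong refl)
      fix a x j assume x: "x \<in> {x \<in> S. x i = a}" and j: "j \<in> I"
      have "{y \<in> S. \<forall>l\<in>insert i I - {j}. y l = x l} = {y \<in> {x \<in> S. x i = a}. \<forall>l\<in>I - {j}. y l = x l}"
        using x j insert.hyps by auto
      then show "?m S (insert i I) j x = ?m {x \<in> S. x i = a} I j x" by simp
    qed
    also have "\<dots> \<le> (\<Sum>a\<in>(\<lambda>x. x i) ` S. real (card {x\<in>S. x i = a}) * ln (card {x\<in>S. x i = a}))"
    proof (rule sum_mono)
      fix a
      show "(\<Sum>x\<in>{x\<in>S. x i = a}. \<Sum>j\<in>I. ?m {x\<in>S. x i = a} I j x) \<le> real (card {x\<in>S. x i = a}) * ln (card {x\<in>S. x i = a})"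
        using fS insert.prems(2) by (intro insert.IH) auto
    qed
    also have "\<dots> = (\<Sum>x\<in>S. ln (card (K x)))"
      unfolding grp by (intro sum.cong refl) (simp add: K_def)
    finally have 1: "(\<Sum>x\<in>S. \<Sum>j\<in>I. ?m S (insert i I) j x) \<le> (\<Sum>x\<in>S. ln (card (K x)))" .
    have Ai: "{y \<in> S. \<forall>l\<in>insert i I - {i}. y l = x l} = A x" for x
      using insert.hyps by (auto simp: A_def)
    have pos: "card (A x) > 0" "card (K x) > 0" if "x \<in> S" for x
      using that fS by (auto simp: A_def K_def card_gt_0_iff)
    \<comment> \<open>\<open>A x\<close> is the fibre in direction \<open>i\<close> and
      \<open>K x\<close> the slice with the same coordinate \<open>i\<close>. A pair from
      \<open>A x \<times> K x\<close> determines \<open>x\<close>, its coordinates in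
      \<open>I\<close> by the first entry and coordinate \<open>i\<close> by the second, so these
      products have total size at most \<open>card S ^ 2\<close>; \<open>ln y \<le> y - 1\<close>
      turns this into the logarithmic bound.\<close>
    have "(\<Sum>x\<in>S. ln (card (A x)) + ln (card (K x)) - ln ?k) = (\<Sum>x\<in>S. ln (card (A x) * card (K x) / ?k))"
      using pos k0 by (intro sum.cong refl) (simp add: ln_mult ln_div)
    also have "\<dots> \<le> (\<Sum>x\<in>S. card (A x) * card (K x) / ?k - 1)"
      using pos k0 by (intro sum_mono ln_le_minus_one) (simp add: field_simps)
    also have "\<dots> = real (\<Sum>x\<in>S. card (A x \<times> K x)) / ?k - ?k"
      by (simp add: sum_subtractf sum_divide_distrib card_cartesian_product)
    also have "(\<Sum>x\<in>S. card (A x \<times> K x)) = card (Sigma S (\<lambda>x. A x \<times> K x))"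
      using fS by (intro card_SigmaI[symmetric]) (auto simp: A_def K_def)
    also have "\<dots> \<le> card (S \<times> S)"
    proof (rule card_inj_on_le[of snd])
      have "x = x'" if "x \<in> S" "x' \<in> S" "y \<in> A x" "y \<in> A x'" "z \<in> K x" "z \<in> K x'" for x x' y z
        using that by (intro insert.prems(2)) (auto simp: A_def K_def)
      then show "inj_on snd (Sigma S (\<lambda>x. A x \<times> K x))" by (fastforce simp: inj_on_def)
    qed (use fS in \<open>auto simp: A_def K_def\<close>)
    finally have "(\<Sum>x\<in>S. ln (card (A x)) + ln (card (K x)) - ln ?k) \<le> ?k * ?k / ?k - ?k"
      by (simp add: divide_right_mono card_cartesian_product flip: of_nat_mult)
    then have 2: "(\<Sum>x\<in>S. ln (card (A x))) + (\<Sum>x\<in>S. ln (card (K x))) \<le> ?k * ln ?k"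
      using k0 by (simp add: sum.distrib sum_subtractf)
    have "(\<Sum>x\<in>S. \<Sum>j\<in>insert i I. ?m S (insert i I) j x)
      = (\<Sum>x\<in>S. ln (card (A x))) + (\<Sum>x\<in>S. \<Sum>j\<in>I. ?m S (insert i I) j x)"
      unfolding sum.distrib[symmetric]
      by (intro sum.cong refl) (subst sum.insert, use insert.hyps in \<open>simp_all only: Ai not_False_eq_True\<close>)
    then show ?thesis using 1 2 by simp
  qed simp
qed

locale product_host =
  fixes I :: "'i set" and G :: "'i \<Rightarrow> 'a graph" and dg :: "'i \<Rightarrow> nat" and C :: nat
  assumes finI: "finite I"
    and simpG: "j \<in> I \<Longrightarrow> simple_graph (G j)"
    and regG: "j \<in> I \<Longrightarrow> regular_graph (dg j) (G j)"
    and connG: "j \<in> I \<Longrightarrow> connected_graph (G j)"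
    and sizeG: "j \<in> I \<Longrightarrow> 1 < card (verts (G j))" "j \<in> I \<Longrightarrow> card (verts (G j)) \<le> C"
begin

definition "PV = (\<Pi>\<^sub>E j\<in>I. verts (G j))"
definition "PE = edges (cartesian_product I G)"
text \<open>The copy of the product over \<open>J\<close> through \<open>c\<close>: the coordinates
  outside \<open>J\<close> are frozen. Copies keep the full coordinate functions, so that their
  edges are edges of the whole product.\<close>

definition "VJ J c = {x \<in> PV. \<forall>i\<in>I-J. x i = c i}"
definition "EJ J c = {e \<in> PE. e \<subseteq> VJ J c}"
definition "nbj j b = {a. {b, a} \<in> edges (G j)}"
definition "agree j x y \<longleftrightarrow> (\<forall>l\<in>I-{j}. y l = x l)"

lemma verts_cartesian_product: "verts (cartesian_product I G) = PV"
  by (simp add: cartesian_product_def PV_def)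

lemma finite_verts: "j \<in> I \<Longrightarrow> finite (verts (G j))"
  using simpG by (simp add: simple_graph_def)

lemma finite_PV: "finite PV"
  unfolding PV_def using finI finite_verts by (intro finite_PiE) auto

lemma edge_G: "j \<in> I \<Longrightarrow> {a,b} \<in> edges (G j) \<Longrightarrow> a \<in> verts (G j) \<and> b \<in> verts (G j) \<and> a \<noteq> b"
  using simpG by (fastforce simp: simple_graph_def)

lemma PE_alt: "PE = {{u, v} | u v. u \<in> PV \<and> v \<in> PV \<and>
    (\<exists>j\<in>I. {u j, v j} \<in> edges (G j) \<and> (\<forall>m\<in>I - {j}. u m = v m))}"
  by (simp add: PE_def cartesian_product_def PV_def)

lemma PE_iff: "{u,v} \<in> PE \<longleftrightarrow> u \<in> PV \<and> v \<in> PV \<and> (\<exists>j\<in>I. {u j, v j} \<in> edges (G j) \<and> agree j u v)"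
proof
  assume "{u,v} \<in> PE"
  then obtain u' v' j where uv: "{u,v} = {u',v'}" "u' \<in> PV" "v' \<in> PV" "j \<in> I"
    "{u' j, v' j} \<in> edges (G j)" "\<forall>m\<in>I-{j}. u' m = v' m"
    unfolding PE_alt by blast
  then have "u = u' \<and> v = v' \<or> u = v' \<and> v = u'" by (auto simp: doubleton_eq_iff)
  moreover have "\<forall>m\<in>I-{j}. v' m = u' m" using uv(6) by metis
  ultimately have "u \<in> PV" "v \<in> PV" "{u j, v j} \<in> edges (G j)" "agree j u v"
    using uv(2,3,5,6) unfolding agree_def by (metis insert_commute)+
  then show "u \<in> PV \<and> v \<in> PV \<and> (\<exists>j\<in>I. {u j, v j} \<in> edges (G j) \<and> agree j u v)"
    using uv(4) by blast
next
  assume "u \<in> PV \<and> v \<in> PV \<and> (\<exists>j\<in>I. {u j, v j} \<in> edges (G j) \<and> agree j u v)"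
  then obtain j where "u \<in> PV" "v \<in> PV" "j \<in> I" "{u j, v j} \<in> edges (G j)" "\<forall>m\<in>I-{j}. u m = v m"
    unfolding agree_def by auto
  then show "{u,v} \<in> PE" unfolding PE_alt by blast
qed

lemma PE_doubleton: assumes "e \<in> PE" shows "\<exists>x y. e = {x,y} \<and> x \<noteq> y \<and> x \<in> PV \<and> y \<in> PV"
proof -
  obtain u v where e: "e = {u,v}" using assms unfolding PE_alt by blast
  then show ?thesis using assms PE_iff[of u v] edge_G by fastforce
qed

lemma agree_upd: assumes "x \<in> PV" "y \<in> PV" "j \<in> I" shows "agree j x y \<longleftrightarrow> y = x(j := y j)"
proof
  assume a: "agree j x y"
  show "y = x(j := y j)"
  proof
    fix l
    show "y l = (x(j := y j)) l"
      using a assms by (cases "l \<in> I") (auto simp: agree_def PV_def PiE_def extensional_def)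
  qed
next
  assume "y = x(j := y j)"
  then have "y l = x l" if "l \<noteq> j" for l using that by (metis fun_upd_other)
  then show "agree j x y" by (auto simp: agree_def)
qed

lemma upd_PV: "x \<in> PV \<Longrightarrow> j \<in> I \<Longrightarrow> a \<in> verts (G j) \<Longrightarrow> x(j := a) \<in> PV"
  unfolding PV_def by (auto simp: PiE_def extensional_def Pi_def)

lemma PV_verts: "x \<in> PV \<Longrightarrow> j \<in> I \<Longrightarrow> x j \<in> verts (G j)"
  unfolding PV_def by auto

lemma card_nbj: assumes "j \<in> I" "b \<in> verts (G j)" shows "card (nbj j b) = dg j" "finite (nbj j b)"
proof -
  have "bij_betw (\<lambda>u. {b,u}) (nbj j b) {e \<in> edges (G j). b \<in> e}"
  proof (rule bij_betwI')
    fix x y show "({b,x} = {b,y}) = (x = y)" by (auto simp: doubleton_eq_iff)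
  next
    fix e assume e: "e \<in> {e \<in> edges (G j). b \<in> e}"
    then have "card e = 2" using simpG[OF assms(1)] by (auto simp: simple_graph_def)
    then obtain x y where "e = {x,y}" by (auto simp: card_2_iff)
    then show "\<exists>x\<in>nbj j b. e = {b,x}" using e by (auto simp: nbj_def insert_commute)
  qed (auto simp: nbj_def)
  then show "card (nbj j b) = dg j"
    using regG[OF assms(1)] assms(2) by (simp add: bij_betw_same_card regular_graph_def degree_def)
  show "finite (nbj j b)"
    using finite_verts[OF assms(1)] edge_G[OF assms(1)] by (auto simp: nbj_def intro: finite_subset)
qed

lemma EJ_nb:
  assumes "J \<subseteq> I" "x \<in> VJ J c"
  shows "{u. {x,u} \<in> EJ J c} = (\<Union>j\<in>J. (\<lambda>a. x(j := a)) ` nbj j (x j))"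
proof (intro equalityI subsetI)
  fix u assume "u \<in> {u. {x,u} \<in> EJ J c}"
  then have u: "{x,u} \<in> PE" "u \<in> VJ J c" by (auto simp: EJ_def)
  then obtain j where j: "j \<in> I" "{x j, u j} \<in> edges (G j)" "agree j x u" "x \<in> PV" "u \<in> PV"
    using PE_iff by blast
  have "x j \<noteq> u j" using edge_G j by blast
  have "j \<in> J"
  proof (rule ccontr)
    assume "j \<notin> J"
    then have "x j = c j" "u j = c j" using u(2) assms(2) j(1) unfolding VJ_def by blast+
    then show False using \<open>x j \<noteq> u j\<close> by simp
  qed
  moreover have "u = x(j := u j)" using agree_upd j by blast
  ultimately show "u \<in> (\<Union>j\<in>J. (\<lambda>a. x(j := a)) ` nbj j (x j))" using j by (auto simp: nbj_def)
next
  fix u assume "u \<in> (\<Union>j\<in>J. (\<lambda>a. x(j := a)) ` nbj j (x j))"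
  then obtain j a where j: "j \<in> J" "{x j, a} \<in> edges (G j)" "u = x(j := a)" by (auto simp: nbj_def)
  have jI: "j \<in> I" and xP: "x \<in> PV" using j assms by (auto simp: VJ_def)
  have uP: "u \<in> PV" using upd_PV[OF xP jI] edge_G[OF jI j(2)] j(3) by blast
  have "{x,u} \<in> PE" unfolding PE_iff using xP uP jI j by (intro conjI bexI[of _ j]) (auto simp: agree_def)
  moreover have "u \<in> VJ J c" using assms j uP by (auto simp: VJ_def)
  ultimately show "u \<in> {u. {x,u} \<in> EJ J c}" using assms by (auto simp: EJ_def)
qed

lemma regular_EJ: assumes "J \<subseteq> I" shows "regular_host (VJ J c) (EJ J c) (\<Sum>j\<in>J. dg j)"
proof
  show "finite (VJ J c)" using finite_PV by (simp add: VJ_def)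
  show "\<exists>x y. e = {x, y} \<and> x \<noteq> y \<and> x \<in> VJ J c \<and> y \<in> VJ J c" if "e \<in> EJ J c" for e
    using PE_doubleton[of e] that by (auto simp: EJ_def)
  fix v assume v: "v \<in> VJ J c"
  have vP: "v \<in> PV" using v by (simp add: VJ_def)
  have "bij_betw (\<lambda>u. {v,u}) {u. {v,u} \<in> EJ J c} {e \<in> EJ J c. v \<in> e}"
  proof (rule bij_betwI')
    fix x y show "({v,x} = {v,y}) = (x = y)" by (auto simp: doubleton_eq_iff)
  next
    fix e assume "e \<in> {e \<in> EJ J c. v \<in> e}"
    then show "\<exists>x\<in>{u. {v,u} \<in> EJ J c}. e = {v,x}"
      using PE_doubleton[of e] by (fastforce simp: EJ_def insert_commute)
  qed auto
  then have "card {e \<in> EJ J c. v \<in> e} = card {u. {v,u} \<in> EJ J c}" by (simp add: bij_betw_same_card)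
  also have "\<dots> = (\<Sum>j\<in>J. card ((\<lambda>a. v(j := a)) ` nbj j (v j)))"
    unfolding EJ_nb[OF assms v]
  proof (rule card_UN_disjoint)
    show "finite J" using assms finI finite_subset by blast
    show "\<forall>j\<in>J. finite ((\<lambda>a. v(j := a)) ` nbj j (v j))" using card_nbj(2) PV_verts[OF vP] assms by blast
    have "a = v j" if "v(j := a) = v(l := b)" "j \<noteq> l" for a b j l
      using that by (metis fun_upd_same fun_upd_other)
    then have "(\<lambda>a. v(i := a)) ` nbj i (v i) \<inter> (\<lambda>a. v(j := a)) ` nbj j (v j) = {}"
      if "i \<in> J" "i \<noteq> j" for i j
      using edge_G[of i "v i" "v i"] assms that unfolding nbj_def by blast
    then show "\<forall>i\<in>J. \<forall>j\<in>J. i \<noteq> j \<longrightarrow> (\<lambda>a. v(i := a)) ` nbj i (v i) \<inter> (\<lambda>a. v(j := a)) ` nbj j (v j) = {}"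
      by blast
  qed
  also have "\<dots> = (\<Sum>j\<in>J. dg j)"
  proof (rule sum.cong[OF refl])
    fix j assume j: "j \<in> J"
    have "inj_on (\<lambda>a. v(j := a)) (nbj j (v j))" by (auto simp: inj_on_def fun_upd_eqD)
    then show "card ((\<lambda>a. v(j := a)) ` nbj j (v j)) = dg j"
      using card_nbj(1) j assms PV_verts[OF vP] by (simp add: card_image subset_iff)
  qed
  finally show "card {e \<in> EJ J c. v \<in> e} = (\<Sum>j\<in>J. dg j)" .
qed

lemma VJ_I: "VJ I c = PV" by (simp add: VJ_def)
lemma EJ_I: "EJ I c = PE" using PE_doubleton by (auto simp: EJ_def VJ_I)

lemma regular_PE: "regular_host PV PE (\<Sum>j\<in>I. dg j)"
  using regular_EJ[OF order_refl, of undefined] by (simp add: VJ_I EJ_I)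

lemma conn_G: assumes "j \<in> I" shows "conn (edges (G j)) (verts (G j))"
proof (rule conn_if_connected_graph)
  have "induced_subgraph (Graph (verts (G j)) (edges (G j))) (verts (G j)) = G j"
    using simpG[OF assms] by (cases "G j") (auto simp: induced_subgraph_def simple_graph_def)
  then show "connected_graph (induced_subgraph (Graph (verts (G j)) (edges (G j))) (verts (G j)))"
    using connG[OF assms] by simp
qed simp

definition "fib S j x = {y\<in>S. agree j x y}"

lemma fib_card:
  assumes "S \<subseteq> PV" "x \<in> S" "j \<in> I"
  shows "1 \<le> card (fib S j x)" "card (fib S j x) \<le> card (verts (G j))"
proof -
  have "finite (fib S j x)" using finite_subset[OF assms(1) finite_PV] by (simp add: fib_def)
  moreover have "x \<in> fib S j x" using assms by (simp add: fib_def agree_def)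
  ultimately show "1 \<le> card (fib S j x)" by (auto simp: Suc_le_eq card_gt_0_iff)
  show "card (fib S j x) \<le> card (verts (G j))"
  proof (rule card_inj_on_le[of "\<lambda>y. y j"])
    show "inj_on (\<lambda>y. y j) (fib S j x)"
      using agree_upd assms by (intro inj_onI) (metis (no_types, lifting) fib_def mem_Collect_eq subsetD)
    show "(\<lambda>y. y j) ` fib S j x \<subseteq> verts (G j)" using PV_verts assms by (auto simp: fib_def)
  qed (use finite_verts assms in auto)
qed

lemma entropy:
  assumes "S \<subseteq> PV"
  shows "(\<Sum>x\<in>S. \<Sum>j\<in>I. ln (real (card (fib S j x)))) \<le> card S * ln (card S)"
  unfolding fib_def agree_def
proof (rule fibre_entropy[OF finI])
  show "finite S" using assms finite_PV finite_subset by blast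
  fix x y assume "x \<in> S" "y \<in> S" "\<forall>i\<in>I. x i = y i"
  then show "x = y" using assms unfolding PV_def by (intro PiE_ext[of x I _ y]) auto
qed

text \<open>A vertex has at most \<open>card (fib S j x) - 1\<close> neighbours in \<open>S\<close>
  in direction \<open>j\<close>, and \<open>m - 1 \<le> (C - 1) * ln m / ln 2\<close> for
  \<open>1 \<le> m \<le> C\<close>; the entropy inequality sums this up. Small sets therefore keep
  almost all of their degree on the boundary.\<close>

lemma inner_degree_sum:
  assumes "S \<subseteq> PV" "1 < C"
  shows "(\<Sum>x\<in>S. real (card ({u. {x,u} \<in> PE} \<inter> S))) \<le> (C - 1) * (card S * (ln (card S) / ln 2))"
proof -
  have fS: "finite S" using assms finite_PV finite_subset by blast
  have "(\<Sum>x\<in>S. real (card ({u. {x,u} \<in> PE} \<inter> S))) \<le> (\<Sum>x\<in>S. \<Sum>j\<in>I. (C - 1) * (ln (card (fib S j x)) / ln 2))"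
  proof (rule sum_mono)
    fix x assume x: "x \<in> S"
    have fin: "finite (fib S j x)" for j using fS by (simp add: fib_def)
    have "{u. {x,u} \<in> PE} \<inter> S \<subseteq> (\<Union>j\<in>I. fib S j x - {x})"
      using PE_iff edge_G unfolding fib_def by fastforce
    then have "card ({u. {x,u} \<in> PE} \<inter> S) \<le> card (\<Union>j\<in>I. fib S j x - {x})"
      using finI fin by (intro card_mono) auto
    also have "\<dots> \<le> (\<Sum>j\<in>I. card (fib S j x - {x}))" by (rule card_UN_le[OF finI])
    finally have "real (card ({u. {x,u} \<in> PE} \<inter> S)) \<le> (\<Sum>j\<in>I. real (card (fib S j x - {x})))"
      by (metis of_nat_le_iff of_nat_sum)
    also have "\<dots> \<le> (\<Sum>j\<in>I. (C - 1) * (ln (card (fib S j x)) / ln 2))"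
    proof (rule sum_mono)
      fix j assume j: "j \<in> I"
      let ?m = "card (fib S j x)"
      have m: "1 \<le> ?m" "?m \<le> C" using fib_card[OF assms(1) x j] sizeG[OF j] by auto
      have "x \<in> fib S j x" using x by (simp add: fib_def agree_def)
      then have e: "real (card (fib S j x - {x})) = real ?m - 1" using fin m by (simp add: of_nat_diff)
      show "real (card (fib S j x - {x})) \<le> (C - 1) * (ln ?m / ln 2)"
      proof (cases "?m = 1")
        case True then show ?thesis using e by simp
      next
        case False
        then have "ln 2 \<le> ln (real ?m)" using m by (subst ln_le_cancel_iff) auto
        then have "1 \<le> ln (real ?m) / ln 2" by simp
        then have "real (C - 1) * 1 \<le> real (C - 1) * (ln ?m / ln 2)" by (intro mult_left_mono) auto
        moreover have "real ?m - 1 \<le> real (C - 1)" using m by simp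
        ultimately show ?thesis using e by linarith
      qed
    qed
    finally show "real (card ({u. {x,u} \<in> PE} \<inter> S)) \<le> (\<Sum>j\<in>I. (C - 1) * (ln (card (fib S j x)) / ln 2))" .
  qed
  also have "\<dots> = (C - 1) / ln 2 * (\<Sum>x\<in>S. \<Sum>j\<in>I. ln (real (card (fib S j x))))"
    by (simp add: sum_distrib_left)
  also have "\<dots> \<le> (C - 1) / ln 2 * (card S * ln (card S))"
    using entropy[OF assms(1)] by (intro mult_left_mono) auto
  finally show ?thesis by simp
qed

text \<open>By the entropy inequality the left-hand side is at most the sum, over points and
  directions, of the logarithm of factor size over fibre size. Only the pairs in \<open>N\<close>,
  whose fibre is not full, contribute, at most \<open>ln C\<close> each. As the factor is connected,
  the line of such a pair contains a boundary edge, and one edge is charged by at most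
  \<open>C\<close> points.\<close>

lemma edge_isoperimetry:
  assumes "S \<subseteq> PV" "S \<noteq> {}"
  shows "card S * ln (card PV / card S) \<le> C * ln C * card (bd PE S)"
proof -
  interpret P: regular_host PV PE "\<Sum>j\<in>I. dg j" by (rule regular_PE)
  have fS: "finite S" using assms finite_PV finite_subset by blast
  have PV0: "card PV > 0" using assms finite_PV by (auto simp: card_gt_0_iff)
  have lnPV: "ln (card PV) = (\<Sum>j\<in>I. ln (card (verts (G j))))"
  proof -
    have "card PV = (\<Prod>j\<in>I. card (verts (G j)))" unfolding PV_def by (rule card_PiE[OF finI])
    moreover have "j \<in> I \<Longrightarrow> real (card (verts (G j))) > 0" for j using sizeG(1)[of j] by simp
    ultimately show ?thesis using finI by (simp add: ln_prod)
  qed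
  define N where "N = {(x,j). x \<in> S \<and> j \<in> I \<and> card (fib S j x) < card (verts (G j))}"
  have fN: "finite N" using fS finI by (auto intro: finite_subset[of _ "S \<times> I"] simp: N_def)
  have "card S * ln (card PV / card S) = card S * ln (card PV) - card S * ln (card S)"
    using PV0 assms fS by (simp add: ln_div card_gt_0_iff algebra_simps)
  also have "\<dots> \<le> card S * ln (card PV) - (\<Sum>x\<in>S. \<Sum>j\<in>I. ln (real (card (fib S j x))))"
    using entropy[OF assms(1)] by simp
  also have "\<dots> = (\<Sum>x\<in>S. \<Sum>j\<in>I. ln (card (verts (G j))) - ln (card (fib S j x)))"
    by (simp add: lnPV sum_subtractf)
  also have "\<dots> \<le> (\<Sum>x\<in>S. \<Sum>j\<in>I. ln C * of_bool ((x,j) \<in> N))"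
  proof (intro sum_mono)
    fix x j assume x: "x \<in> S" and j: "j \<in> I"
    note m = fib_card[OF assms(1) x j] and s = sizeG[OF j]
    show "ln (card (verts (G j))) - ln (card (fib S j x)) \<le> ln C * of_bool ((x,j) \<in> N)"
    proof (cases "(x,j) \<in> N")
      case True
      have "ln (card (verts (G j))) \<le> ln (real C)" using s by (subst ln_le_cancel_iff) auto
      moreover have "ln (real (card (fib S j x))) \<ge> 0" using m by simp
      ultimately show ?thesis using True by simp
    qed (use x j m in \<open>simp add: N_def\<close>)
  qed
  also have "\<dots> = ln C * card N"
  proof -
    have "(\<Sum>x\<in>S. \<Sum>j\<in>I. of_bool ((x,j) \<in> N)) = real (card (S \<times> I \<inter> N))"
      unfolding sum.cartesian_product using fS finI by (simp add: Int_def)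
    moreover have "S \<times> I \<inter> N = N" by (auto simp: N_def)
    ultimately show ?thesis by (simp add: sum_distrib_left[symmetric])
  qed
  finally have 1: "card S * ln (card PV / card S) \<le> ln C * card N" .
  have 2: "real (card N) \<le> C * card (bd PE S)"
  proof -
    have ex: "\<exists>y z. y \<in> S \<and> z \<in> PV \<and> z \<notin> S \<and> agree j y x \<and> agree j y z \<and> y j \<noteq> z j \<and> {y,z} \<in> PE"
      if N: "(x,j) \<in> N" for x j
    proof -
      have x: "x \<in> S" "x \<in> PV" "j \<in> I" "card (fib S j x) < card (verts (G j))" using N assms by (auto simp: N_def)
      let ?A = "(\<lambda>y. y j) ` fib S j x"
      have "card ?A \<le> card (fib S j x)" using fS by (intro card_image_le) (simp add: fib_def)
      then have "?A \<noteq> verts (G j)" using x by auto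
      moreover have A: "?A \<subseteq> verts (G j)" using PV_verts x assms by (auto simp: fib_def)
      ultimately obtain b where "b \<in> verts (G j) - ?A" by blast
      moreover have "x j \<in> ?A" using x by (auto simp: fib_def agree_def)
      ultimately obtain a b where ab: "a \<in> ?A" "b \<in> verts (G j) - ?A" "{a,b} \<in> edges (G j)"
        using conn_cut[OF conn_G[OF x(3)] A] by blast
      then obtain y where y: "y \<in> S" "agree j x y" "y j = a" by (auto simp: fib_def)
      define z where "z = x(j := b)"
      have z: "z \<in> PV" "agree j x z" "z j = b" using ab upd_PV[OF x(2,3)] by (auto simp: z_def agree_def)
      have "z \<notin> S" using z ab by (auto simp: fib_def)
      moreover have "agree j y x" "agree j y z" using y z by (auto simp: agree_def)
      moreover have "{y,z} \<in> PE" unfolding PE_iff using y z x ab assms calculation by auto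
      moreover have "y j \<noteq> z j" using y z ab by auto
      ultimately show ?thesis using y z by blast
    qed
    define \<phi> where "\<phi> xj = (SOME yz. fst yz \<in> S \<and> snd yz \<in> PV \<and> snd yz \<notin> S \<and> agree (snd xj) (fst yz) (fst xj) \<and>
      agree (snd xj) (fst yz) (snd yz) \<and> fst yz (snd xj) \<noteq> snd yz (snd xj) \<and> {fst yz, snd yz} \<in> PE)" for xj
    have \<phi>: "fst (\<phi> xj) \<in> S \<and> snd (\<phi> xj) \<in> PV \<and> snd (\<phi> xj) \<notin> S \<and> agree (snd xj) (fst (\<phi> xj)) (fst xj) \<and>
      agree (snd xj) (fst (\<phi> xj)) (snd (\<phi> xj)) \<and> fst (\<phi> xj) (snd xj) \<noteq> snd (\<phi> xj) (snd xj) \<and> {fst (\<phi> xj), snd (\<phi> xj)} \<in> PE"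
      if "xj \<in> N" for xj
      unfolding \<phi>_def by (rule someI_ex) (use ex[of "fst xj" "snd xj"] that in force)
    have "\<exists>h. inj_on h (verts (G j)) \<and> h ` verts (G j) \<subseteq> {..<C}" if "j \<in> I" for j
      using card_le_inj[OF finite_verts[OF that], of "{..<C}"] sizeG[OF that] by auto
    then obtain h where h: "\<And>j. j \<in> I \<Longrightarrow> inj_on (h j) (verts (G j)) \<and> h j ` verts (G j) \<subseteq> {..<C}"
      by metis
    \<comment> \<open>The two endpoints of the chosen edge reveal the direction and, apart from the
      coordinate in this direction, also the point; the missing coordinate is recorded as a number
      below \<open>C\<close>.\<close>
    let ?g = "\<lambda>xj. ({fst (\<phi> xj), snd (\<phi> xj)}, h (snd xj) (fst xj (snd xj)))"
    have "card N \<le> card (bd PE S \<times> {..<C})"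
    proof (rule card_inj_on_le[of ?g])
      show "inj_on ?g N"
      proof (rule inj_onI)
        fix p q assume p: "p \<in> N" and q: "q \<in> N" and eq: "?g p = ?g q"
        have f: "fst (\<phi> p) = fst (\<phi> q)" "snd (\<phi> p) = snd (\<phi> q)"
        proof -
          have "{fst (\<phi> p), snd (\<phi> p)} = {fst (\<phi> q), snd (\<phi> q)}" using eq by simp
          moreover have "fst (\<phi> p) \<noteq> snd (\<phi> q)" using \<phi>[OF p] \<phi>[OF q] by metis
          ultimately show "fst (\<phi> p) = fst (\<phi> q)" "snd (\<phi> p) = snd (\<phi> q)"
            unfolding doubleton_eq_iff by blast+
        qed
        have I: "snd p \<in> I" "snd q \<in> I" "fst p \<in> PV" "fst q \<in> PV" "fst (\<phi> p) \<in> PV"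
          using p q assms \<phi>[OF p] by (auto simp: N_def)
        have j: "snd p = snd q" 
        proof (rule ccontr)
          assume "snd p \<noteq> snd q"
          then have "snd p \<in> I - {snd q}" using I by blast
          moreover have "agree (snd q) (fst (\<phi> p)) (snd (\<phi> p))" using \<phi>[OF q] f by simp
          ultimately have "snd (\<phi> p) (snd p) = fst (\<phi> p) (snd p)" unfolding agree_def by blast
          then show False using \<phi>[OF p] by simp
        qed
        have "h (snd p) (fst p (snd p)) = h (snd p) (fst q (snd p))" using eq j by simp
        then have e: "fst p (snd p) = fst q (snd p)"
          using h[OF I(1)] PV_verts[OF I(3,1)] PV_verts[OF I(4,1)] by (meson inj_onD)
        have "agree (snd p) (fst (\<phi> p)) (fst p)" using \<phi>[OF p] by blast
        then have 1: "fst p = (fst (\<phi> p))(snd p := fst p (snd p))" using agree_upd[OF I(5,3,1)] by blast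
        have "agree (snd p) (fst (\<phi> p)) (fst q)" using \<phi>[OF q] f j by simp
        then have 2: "fst q = (fst (\<phi> p))(snd p := fst q (snd p))" using agree_upd[OF I(5,4,1)] by blast
        have "fst p = fst q" using 1 2 e by metis
        then show "p = q" using j by (simp add: prod_eq_iff)
      qed
      show "?g ` N \<subseteq> bd PE S \<times> {..<C}"
      proof (rule image_subsetI)
        fix p assume p: "p \<in> N"
        then have "snd p \<in> I" "fst p \<in> PV" using assms by (auto simp: N_def)
        then have "h (snd p) (fst p (snd p)) \<in> {..<C}" using h PV_verts by blast
        moreover have "{fst (\<phi> p), snd (\<phi> p)} \<in> bd PE S"
          using \<phi>[OF p] by (intro P.bd_edge[OF order_refl]) simp_all
        ultimately show "?g p \<in> bd PE S \<times> {..<C}" by simp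
      qed
      show "finite (bd PE S \<times> {..<C})" using P.fin_bd by auto
    qed
    then have "card N \<le> C * card (bd PE S)" by (simp add: card_cartesian_product mult.commute)
    then show ?thesis by (metis of_nat_le_iff of_nat_mult)
  qed
  have C0: "ln (real C) \<ge> 0" by (cases "C = 0") auto
  show ?thesis using order_trans[OF 1 mult_left_mono[OF 2 C0]] by (simp add: algebra_simps)
qed

end

section \<open>Escaping a set by paths of length five\<close>

definition step :: "'v set set \<Rightarrow> 'v set \<Rightarrow> 'v set" where
  "step F N = N \<union> {v. \<exists>u\<in>N. {u,v} \<in> F}"

lemma step_mono: "F \<subseteq> F' \<Longrightarrow> N \<subseteq> N' \<Longrightarrow> step F N \<subseteq> step F' N'"
  unfolding step_def by blast

lemma step_pow_mono: "F \<subseteq> F' \<Longrightarrow> N \<subseteq> N' \<Longrightarrow> (step F ^^ j) N \<subseteq> (step F' ^^ j) N'"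
  by (induction j) (auto intro: step_mono[THEN subsetD])

lemma exp_minus_le: fixes x :: real assumes "0 \<le> x" "x \<le> 1" shows "exp (-x) \<le> 1 - x/2"
proof -
  have "(1 + x) * (1 - x/2) \<ge> 1"
    using assms mult_left_mono[of x 1 x] by (simp add: algebra_simps)
  moreover have "exp x \<ge> 1 + x" by simp
  ultimately have "exp x * (1 - x/2) \<ge> 1"
    using assms by (smt (verit) mult_right_mono divide_le_eq_1_pos)
  then show ?thesis by (simp add: exp_minus field_simps)
qed

context regular_host
begin

lemma step_V: "F \<subseteq> E \<Longrightarrow> N \<subseteq> V \<Longrightarrow> step F N \<subseteq> V"
  using edge_V unfolding step_def by blast

lemma step_pow_V: "F \<subseteq> E \<Longrightarrow> N \<subseteq> V \<Longrightarrow> (step F ^^ j) N \<subseteq> V"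
  by (induction j) (auto dest: step_V[THEN subsetD])

definition nbD :: "'v set set \<Rightarrow> 'v \<Rightarrow> 'v set" where "nbD D v = {u. {v,u} \<in> E - D}"

lemma nbD_nb: "nbD D v \<subseteq> nb v" by (auto simp: nbD_def nb_def)
lemma nbD_sym: "u \<in> nbD D v \<longleftrightarrow> v \<in> nbD D u" by (simp add: nbD_def insert_commute)
lemma fin_nbD: "finite (nbD D v)" using nbD_nb fin_nb finite_subset by blast
lemma card_nbD: "card (nbD D v) \<le> d"
  using card_mono[OF fin_nb[of v] nbD_nb[of D v]] card_nb_le[of v] by linarith

text \<open>The summand \<^term>\<open>real d * f u\<close> accounts for a round in which the walk stays put: \<^const>\<open>step\<close> keeps the
  current set.\<close>

definition opD :: "'v set set \<Rightarrow> ('v \<Rightarrow> real) \<Rightarrow> 'v \<Rightarrow> real" where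
  "opD D f u = (\<Sum>v\<in>nbD D u. f v) + real d * f u"

lemma opD_bounds:
  fixes f :: "'v \<Rightarrow> real"
  assumes "\<And>v. 0 \<le> f v" "\<And>v. f v \<le> b"
  shows "0 \<le> opD D f u" "opD D f u \<le> 2 * real d * b"
proof -
  show "0 \<le> opD D f u" unfolding opD_def using assms by (intro add_nonneg_nonneg sum_nonneg) auto
  have b: "0 \<le> b" using assms order_trans by blast
  have "(\<Sum>v\<in>nbD D u. f v) \<le> card (nbD D u) * b" using sum_bounded_above[of "nbD D u" f b] assms by simp
  also have "\<dots> \<le> d * b" using card_nbD b by (intro mult_right_mono) auto
  finally show "opD D f u \<le> 2 * real d * b" unfolding opD_def
    using mult_left_mono[OF assms(2)[of u], of "real d"] by simp
qed

lemma sum_nbD_swap: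
  fixes w :: "'v \<Rightarrow> real"
  assumes "N \<subseteq> V"
  shows "(\<Sum>u\<in>N. \<Sum>v\<in>nbD D u. w v) = (\<Sum>v\<in>V. card (nbD D v \<inter> N) * w v)"
proof -
  have fN: "finite N" using assms finV finite_subset by blast
  have "(\<Sum>u\<in>N. \<Sum>v\<in>nbD D u. w v) = (\<Sum>u\<in>N. \<Sum>v\<in>V. of_bool (v \<in> nbD D u) * w v)"
  proof (rule sum.cong[OF refl])
    fix u
    have "V \<inter> nbD D u = nbD D u" using nbD_nb nb_V by blast
    then show "(\<Sum>v\<in>nbD D u. w v) = (\<Sum>v\<in>V. of_bool (v \<in> nbD D u) * w v)"
      using finV by (simp add: sum.inter_restrict[symmetric] of_bool_def if_distrib[of "\<lambda>x. x * _"] cong: if_cong)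
  qed
  also have "\<dots> = (\<Sum>v\<in>V. (\<Sum>u\<in>N. of_bool (v \<in> nbD D u)) * w v)"
    by (subst sum.swap) (simp add: sum_distrib_right)
  also have "\<dots> = (\<Sum>v\<in>V. card (nbD D v \<inter> N) * w v)"
    using fN by (intro sum.cong refl) (simp add: nbD_sym[of _ D] Int_def conj_commute)
  finally show ?thesis .
qed

text \<open>For vertices outside \<open>N\<close> the edges towards \<open>N\<close> form disjoint
  sets, so the exponential moment factorizes. Each factor uses
  \<open>1 - exp (-x) \<ge> x / 2\<close> twice, once for the probability of being reached and once
  for the weight, hence \<open>q / 4\<close>. The vertices of \<open>N\<close> contribute their full
  weight, which pays for all multiples of their weights in the sum of \<open>opD D w\<close> because
  \<open>q * d \<le> 1\<close>.\<close>

lemma step_exp: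
  fixes q :: real and w :: "'v \<Rightarrow> real"
  assumes q: "0 \<le> q" "q * d \<le> 1" and N: "N \<subseteq> V" and w: "\<And>v. 0 \<le> w v" "\<And>v. w v \<le> 1"
    and q1: "q \<le> 1"
  shows "pex q E (\<lambda>A. exp (- (\<Sum>v\<in>step (A - D) N. w v))) \<le> exp (- (\<Sum>u\<in>N. (q / 4) * opD D w u))"
proof -
  define B where "B v = {e\<in>E - D. v \<in> e \<and> e \<inter> N \<noteq> {}}" for v
  have fN: "finite N" using N finV finite_subset by blast
  have disj: "disjoint_family_on B (V - N)"
    unfolding disjoint_family_on_def
  proof (intro ballI impI, rule ccontr)
    fix v v' assume v: "v \<in> V - N" "v' \<in> V - N" "v \<noteq> v'" and "B v \<inter> B v' \<noteq> {}"
    then obtain e where e: "e \<in> E" "v \<in> e" "v' \<in> e" "e \<inter> N \<noteq> {}" by (auto simp: B_def)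
    obtain x y where "e = {x,y}" using edgeE[OF e(1)] by blast
    then have "e = {v,v'}" using e v(3) by auto
    then show False using e v by auto
  qed
  have cB: "card (B v) = card (nbD D v \<inter> N)" if v: "v \<in> V - N" for v
  proof -
    have "bij_betw (\<lambda>u. {v,u}) (nbD D v \<inter> N) (B v)"
    proof (rule bij_betwI')
      fix x y show "({v,x} = {v,y}) = (x = y)" by (auto simp: doubleton_eq_iff)
    next
      fix e assume e: "e \<in> B v"
      then have "e \<in> E" by (simp add: B_def)
      then obtain x y where xy: "e = {x,y}" using edgeE by blast
      then have "e = {v, x} \<or> e = {v, y}" using e by (auto simp: B_def)
      then obtain z where "e = {v,z}" by blast
      then show "\<exists>x\<in>nbD D v \<inter> N. e = {v,x}" using e v by (auto simp: B_def nbD_def)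
    qed (auto simp: B_def nbD_def)
    then show ?thesis by (simp add: bij_betw_same_card)
  qed
  have "pex q E (\<lambda>A. exp (- (\<Sum>v\<in>step (A - D) N. w v))) =
     pex q E (\<lambda>A. exp (- (\<Sum>v\<in>N. w v)) * (\<Prod>v\<in>V-N. if A \<inter> B v \<noteq> {} then exp (- w v) else 1))"
  proof (rule pex_cong)
    fix A assume A: "A \<subseteq> E"
    have hit: "A \<inter> B v \<noteq> {} \<longleftrightarrow> v \<in> step (A - D) N" if v: "v \<in> V - N" for v
    proof
      assume "A \<inter> B v \<noteq> {}"
      then obtain e u where e: "e \<in> A" "e \<in> E" "e \<notin> D" "v \<in> e" "u \<in> e" "u \<in> N" by (auto simp: B_def)
      obtain x y where "e = {x,y}" using edgeE[OF e(2)] by blast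
      then have "e = {u,v}" using e v by auto
      then show "v \<in> step (A - D) N" using e by (auto simp: step_def)
    next
      assume "v \<in> step (A - D) N"
      then obtain u where "u \<in> N" "{u,v} \<in> A - D" using v by (auto simp: step_def)
      then have "{u,v} \<in> A \<inter> B v" using A by (auto simp: B_def)
      then show "A \<inter> B v \<noteq> {}" by blast
    qed
    have sV: "step (A - D) N \<subseteq> V" using A N by (intro step_V) auto
    have "(\<Sum>v\<in>step (A - D) N. w v) = (\<Sum>v\<in>N. w v) + (\<Sum>v\<in>step (A - D) N - N. w v)"
      using finite_subset[OF sV finV] sum.subset_diff[of N "step (A - D) N" w] by (simp add: step_def add.commute)
    also have "(\<Sum>v\<in>step (A - D) N - N. w v) = (\<Sum>v\<in>V-N. if A \<inter> B v \<noteq> {} then w v else 0)"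
    proof -
      have "step (A - D) N - N = (V - N) \<inter> {v. A \<inter> B v \<noteq> {}}" using sV hit by blast
      then show ?thesis using finV sum.inter_restrict[of "V - N" w "{v. A \<inter> B v \<noteq> {}}"] by simp
    qed
    finally have "- (\<Sum>v\<in>step (A - D) N. w v) = - (\<Sum>v\<in>N. w v) + (\<Sum>v\<in>V-N. if A \<inter> B v \<noteq> {} then - w v else 0)"
      by (simp add: sum_negf[symmetric] if_distrib[of uminus] cong: if_cong)
    then show "exp (- (\<Sum>v\<in>step (A - D) N. w v)) =
       exp (- (\<Sum>v\<in>N. w v)) * (\<Prod>v\<in>V-N. if A \<inter> B v \<noteq> {} then exp (- w v) else 1)"
      using finV by (simp only: exp_add) (simp add: exp_sum if_distrib[of exp] cong: if_cong)
  qed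
  also have "\<dots> = exp (- (\<Sum>v\<in>N. w v)) * (\<Prod>v\<in>V-N. pex q E (\<lambda>A. if A \<inter> B v \<noteq> {} then exp (- w v) else 1))"
    unfolding pex_cmult using finV disj
    by (subst pex_prod[OF finE _ disj]) (auto simp: B_def Int_assoc Collect_conj_eq)
  also have "\<dots> \<le> exp (- (\<Sum>v\<in>N. w v)) * (\<Prod>v\<in>V-N. exp (- (q / 4 * card (nbD D v \<inter> N) * w v)))"
  proof (intro mult_left_mono prod_mono conjI)
    fix v assume v: "v \<in> V - N"
    show "0 \<le> pex q E (\<lambda>A. if A \<inter> B v \<noteq> {} then exp (- w v) else 1)"
      using q q1 by (intro pex_nonneg) auto
    let ?m = "card (nbD D v \<inter> N)"
    have "?m \<le> d" using card_mono[OF fin_nbD, of "nbD D v \<inter> N" D v] card_nbD[of D v] by simp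
    then have "q * ?m \<le> q * d" using q by (intro mult_left_mono) auto
    then have qm: "0 \<le> q * ?m" "q * ?m \<le> 1" using q by auto
    have "(1 - q) ^ ?m \<le> exp (-q) ^ ?m" using q1 exp_ge_add_one_self[of "-q"] by (intro power_mono) auto
    also have "\<dots> = exp (- (q * ?m))" by (simp add: exp_of_nat_mult[symmetric] mult.commute)
    also have "\<dots> \<le> 1 - q * ?m / 2" using exp_minus_le[OF qm] .
    finally have 1: "q * ?m / 2 \<le> 1 - (1 - q) ^ ?m" by simp
    have 2: "w v / 2 \<le> 1 - exp (- w v)" using exp_minus_le[of "w v"] w by simp
    have "pex q E (\<lambda>A. if A \<inter> B v \<noteq> {} then exp (- w v) else 1)
       = 1 - (1 - exp (- w v)) * (1 - (1 - q) ^ ?m)"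
    proof -
      have "B v \<subseteq> E" by (auto simp: B_def)
      then show ?thesis by (simp only: pex_hit[OF finE] cB[OF v]) (simp add: algebra_simps)
    qed
    also have "\<dots> \<le> 1 - (w v / 2) * (q * ?m / 2)"
      using 1 2 w qm by (intro diff_left_mono mult_mono) auto
    also have "\<dots> \<le> exp (- (q / 4 * ?m * w v))"
      using exp_ge_add_one_self[of "- (q / 4 * ?m * w v)"] by (simp add: algebra_simps)
    finally show "pex q E (\<lambda>A. if A \<inter> B v \<noteq> {} then exp (- w v) else 1) \<le> exp (- (q / 4 * ?m * w v))" .
  qed auto
  also have "\<dots> = exp (- ((\<Sum>v\<in>N. w v) + (\<Sum>v\<in>V-N. q / 4 * card (nbD D v \<inter> N) * w v)))"
    using finV by (simp add: exp_sum[symmetric] sum_negf exp_add[symmetric])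
  also have "\<dots> \<le> exp (- (\<Sum>u\<in>N. (q / 4) * opD D w u))"
  proof -
    have "(\<Sum>u\<in>N. (q / 4) * opD D w u) = (q/4) * (\<Sum>v\<in>V. card (nbD D v \<inter> N) * w v) + (\<Sum>u\<in>N. q / 4 * d * w u)"
      unfolding opD_def sum_nbD_swap[OF N, symmetric]
      by (simp add: distrib_left sum.distrib sum_distrib_left mult.assoc)
    also have "(q/4) * (\<Sum>v\<in>V. card (nbD D v \<inter> N) * w v) =
      (\<Sum>v\<in>V-N. q / 4 * card (nbD D v \<inter> N) * w v) + (\<Sum>v\<in>N. q / 4 * card (nbD D v \<inter> N) * w v)"
      unfolding sum_distrib_left mult.assoc[symmetric] by (rule sum.subset_diff[OF N finV])
    also have "\<dots> + (\<Sum>u\<in>N. q / 4 * d * w u) \<le> (\<Sum>v\<in>N. w v) + (\<Sum>v\<in>V-N. q / 4 * card (nbD D v \<inter> N) * w v)"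
    proof -
      have "(\<Sum>v\<in>N. q / 4 * card (nbD D v \<inter> N) * w v) + (\<Sum>u\<in>N. q / 4 * d * w u) \<le> (\<Sum>v\<in>N. w v)"
        unfolding sum.distrib[symmetric]
      proof (rule sum_mono)
        fix v
        have "card (nbD D v \<inter> N) \<le> d" using card_mono[OF fin_nbD, of "nbD D v \<inter> N" D v] card_nbD[of D v] by simp
        then have "q * card (nbD D v \<inter> N) \<le> q * d" using q by (intro mult_left_mono) auto
        then have "q / 4 * card (nbD D v \<inter> N) + q / 4 * d \<le> 1" using q by simp
        then have "(q / 4 * card (nbD D v \<inter> N) + q / 4 * d) * w v \<le> 1 * w v" using w by (intro mult_right_mono) auto
        then show "q / 4 * card (nbD D v \<inter> N) * w v + q / 4 * d * w v \<le> w v" by (simp add: algebra_simps)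
      qed
      then show ?thesis by simp
    qed
    finally show ?thesis by simp
  qed
  finally show ?thesis .
qed

text \<open>A fresh round of edges is used for every step, so the total density is
  \<open>1 - (1 - q) ^ j\<close>, and conditionally on the earlier rounds the last step is one
  application of \<open>step_exp\<close>. It replaces the weight \<open>w\<close> by
  \<open>q / 4 * opD D w\<close>, which is again at most \<open>1\<close>, and the induction goes on
  with the new weight.\<close>

lemma steps_exp:
  fixes q :: real and w :: "'v \<Rightarrow> real"
  assumes q: "0 \<le> q" "q * d \<le> 1" "q \<le> 1" and W: "W \<subseteq> V" and w: "\<And>v. 0 \<le> w v" "\<And>v. w v \<le> 1"
  shows "pex (1 - (1 - q) ^ j) E (\<lambda>F. exp (- (\<Sum>v\<in>(step (F - D) ^^ j) W. w v)))
    \<le> exp (- (\<Sum>u\<in>W. (q / 4) ^ j * (opD D ^^ j) w u))"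
  using w
proof (induction j arbitrary: w)
  case 0
  then show ?case using finE by (simp add: pex_const)
next
  case (Suc j)
  let ?p = "1 - (1 - q) ^ j"
  have p: "0 \<le> ?p" "?p \<le> 1" using q by (auto intro: power_le_one)
  define w' where "w' u = q / 4 * opD D w u" for u
  have w': "0 \<le> w' u" "w' u \<le> 1" for u
  proof -
    show "0 \<le> w' u" using opD_bounds[of w 1] Suc.prems q by (simp add: w'_def)
    have "w' u \<le> q / 4 * (2 * real d * 1)" unfolding w'_def using opD_bounds[of w 1] Suc.prems q by (intro mult_left_mono) auto
    then show "w' u \<le> 1" using q by simp
  qed
  have "pex (1 - (1 - q) ^ Suc j) E (\<lambda>F. exp (- (\<Sum>v\<in>(step (F - D) ^^ Suc j) W. w v)))
    = pex ?p E (\<lambda>F1. pex q E (\<lambda>F2. exp (- (\<Sum>v\<in>(step (F1 \<union> F2 - D) ^^ Suc j) W. w v))))"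
    by (rule pex_rounds[OF finE]) (simp add: algebra_simps)
  also have "\<dots> \<le> pex ?p E (\<lambda>F1. pex q E (\<lambda>F2. exp (- (\<Sum>v\<in>step (F2 - D) ((step (F1 - D) ^^ j) W). w v))))"
  proof (intro pex_mono p q)
    fix F1 F2 assume F: "F1 \<subseteq> E" "F2 \<subseteq> E"
    have "step (F2 - D) ((step (F1 - D) ^^ j) W) \<subseteq> (step (F1 \<union> F2 - D) ^^ Suc j) W"
      unfolding funpow.simps o_def by (intro step_mono step_pow_mono) auto
    moreover have "(step (F1 \<union> F2 - D) ^^ Suc j) W \<subseteq> V" using F W by (intro step_pow_V) auto
    ultimately have "(\<Sum>v\<in>step (F2 - D) ((step (F1 - D) ^^ j) W). w v) \<le> (\<Sum>v\<in>(step (F1 \<union> F2 - D) ^^ Suc j) W. w v)"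
      using Suc.prems finite_subset[OF _ finV] by (intro sum_mono2) auto
    then show "exp (- (\<Sum>v\<in>(step (F1 \<union> F2 - D) ^^ Suc j) W. w v)) \<le> exp (- (\<Sum>v\<in>step (F2 - D) ((step (F1 - D) ^^ j) W). w v))"
      by simp
  qed
  also have "\<dots> \<le> pex ?p E (\<lambda>F1. exp (- (\<Sum>u\<in>(step (F1 - D) ^^ j) W. w' u)))"
  proof (intro pex_mono p)
    fix F1 assume F: "F1 \<subseteq> E"
    have "(step (F1 - D) ^^ j) W \<subseteq> V" using F W by (intro step_pow_V) auto
    then show "pex q E (\<lambda>F2. exp (- (\<Sum>v\<in>step (F2 - D) ((step (F1 - D) ^^ j) W). w v)))
      \<le> exp (- (\<Sum>u\<in>(step (F1 - D) ^^ j) W. w' u))"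
      unfolding w'_def by (rule step_exp[OF q(1,2) _ Suc.prems q(3)])
  qed
  also have "\<dots> \<le> exp (- (\<Sum>u\<in>W. (q / 4) ^ j * (opD D ^^ j) w' u))" by (rule Suc.IH[OF w'])
  also have "(opD D ^^ j) w' = (\<lambda>u. q / 4 * (opD D ^^ Suc j) w u)"
  proof -
    have sc: "(opD D ^^ j) (\<lambda>u. a * f u) = (\<lambda>u. a * (opD D ^^ j) f u)" for a :: real and f j
      by (induction j) (auto simp: opD_def sum_distrib_left algebra_simps)
    show ?thesis unfolding w'_def sc by (simp add: funpow_swap1)
  qed
  finally show ?case by (simp add: algebra_simps)
qed

lemma no_path_prob:
  fixes q :: real
  assumes q: "0 \<le> q" "q * d \<le> 1" "q \<le> 1" and W: "W \<subseteq> V"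
  shows "pex (1 - (1 - q) ^ j) E (\<lambda>F. of_bool ((step (F - D) ^^ j) W \<inter> T = {}))
    \<le> exp (- ((q / 4) ^ j * (\<Sum>u\<in>W. (opD D ^^ j) (indicator T) u)))"
proof -
  have p: "0 \<le> 1 - (1 - q) ^ j" "1 - (1 - q) ^ j \<le> 1" using q by (auto intro: power_le_one)
  have "pex (1 - (1 - q) ^ j) E (\<lambda>F. of_bool ((step (F - D) ^^ j) W \<inter> T = {}))
    \<le> pex (1 - (1 - q) ^ j) E (\<lambda>F. exp (- (\<Sum>v\<in>(step (F - D) ^^ j) W. indicator T v)))"
  proof (intro pex_mono p)
    fix F assume "F \<subseteq> E"
    have "(\<Sum>v\<in>(step (F - D) ^^ j) W. indicator T v) = (0::real)" if "(step (F - D) ^^ j) W \<inter> T = {}"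
      using that by (intro sum.neutral) (auto simp: indicator_def)
    then show "of_bool ((step (F - D) ^^ j) W \<inter> T = {}) \<le> exp (- (\<Sum>v\<in>(step (F - D) ^^ j) W. indicator T v :: real))"
      by auto
  qed
  also have "\<dots> \<le> exp (- (\<Sum>u\<in>W. (q / 4) ^ j * (opD D ^^ j) (indicator T) u))"
    by (rule steps_exp[OF q W]) (auto simp: indicator_def)
  finally show ?thesis by (simp add: sum_distrib_left)
qed

section \<open>Host walks as a bilinear form, and the effect of deleting edges\<close>

definition ip :: "('v \<Rightarrow> real) \<Rightarrow> ('v \<Rightarrow> real) \<Rightarrow> real" where "ip f g = (\<Sum>u\<in>V. f u * g u)"

abbreviation "op0 \<equiv> opD {}"

definition adj :: "('v \<Rightarrow> real) \<Rightarrow> 'v \<Rightarrow> real" where "adj f u = (\<Sum>v\<in>nb u. f v)"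

lemma op0_adj: fixes f :: "'v \<Rightarrow> real" shows "op0 f u = adj f u + real d * f u"
  by (simp add: opD_def adj_def nbD_def nb_def)

lemma nb_sum_indicator:
  fixes g :: "'v \<Rightarrow> real"
  shows "(\<Sum>v\<in>nb u. g v) = (\<Sum>v\<in>V. of_bool (v \<in> nb u) * g v)"
proof -
  have "V \<inter> nb u = nb u" using nb_V by blast
  then show ?thesis
    using finV by (simp add: sum.inter_restrict[symmetric] of_bool_def if_distrib[of "\<lambda>x. x * _"] cong: if_cong)
qed

lemma ip_adj: "ip f (adj g) = ip (adj f) g"
proof -
  have "ip f (adj g) = (\<Sum>u\<in>V. \<Sum>v\<in>V. of_bool (v \<in> nb u) * (f u * g v))"
    unfolding ip_def adj_def nb_sum_indicator by (simp add: sum_distrib_left algebra_simps)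
  also have "\<dots> = (\<Sum>v\<in>V. \<Sum>u\<in>V. of_bool (v \<in> nb u) * (f u * g v))" by (rule sum.swap)
  also have "\<dots> = (\<Sum>v\<in>V. \<Sum>u\<in>V. of_bool (u \<in> nb v) * (f u * g v))"
    by (intro sum.cong refl arg_cong2[where f="(*)"] arg_cong[where f=of_bool]) (rule nb_sym)
  also have "\<dots> = ip (adj f) g"
    unfolding ip_def adj_def nb_sum_indicator by (simp add: sum_distrib_left algebra_simps)
  finally show ?thesis .
qed

lemma ip_op0: "ip f (op0 g) = ip (op0 f) g"
proof -
  have "ip f (op0 g) = ip f (adj g) + d * ip f g"
    by (simp add: ip_def op0_adj sum.distrib sum_distrib_left algebra_simps)
  also have "\<dots> = ip (op0 f) g"
    unfolding ip_adj by (simp add: ip_def op0_adj sum.distrib sum_distrib_left algebra_simps)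
  finally show ?thesis .
qed

text \<open>A deleted edge is missing in both directions, and each of them accounts for at most
  \<open>a * b\<close>; hence \<open>2 * card D\<close>.\<close>

lemma ip_opD:
  fixes f g :: "'v \<Rightarrow> real" and a b :: real
  assumes f: "\<And>v. 0 \<le> f v" "\<And>v. f v \<le> a" and g: "\<And>v. 0 \<le> g v" "\<And>v. g v \<le> b" and D: "D \<subseteq> E"
  shows "ip f (op0 g) - 2 * card D * a * b \<le> ip f (opD D g)"
proof -
  have ab: "0 \<le> a" "0 \<le> b" using f g order_trans by blast+
  have fD: "finite D" using D finE finite_subset by blast
  have "adj g u = (\<Sum>v\<in>nbD D u. g v) + (\<Sum>v\<in>{v. {u,v} \<in> D}. g v)" for u
  proof -
    have "nb u = nbD D u \<union> {v. {u,v} \<in> D}" "nbD D u \<inter> {v. {u,v} \<in> D} = {}"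
      using D by (auto simp: nb_def nbD_def)
    moreover have "finite {v. {u,v} \<in> D}" using fin_nb[of u] D by (rule_tac finite_subset) (auto simp: nb_def)
    ultimately show ?thesis unfolding adj_def using fin_nbD by (simp add: sum.union_disjoint)
  qed
  then have e: "op0 g u = opD D g u + (\<Sum>v\<in>{v. {u,v} \<in> D}. g v)" for u
    unfolding op0_adj by (simp add: opD_def)
  have "ip f (op0 g) - ip f (opD D g) = (\<Sum>u\<in>V. f u * (\<Sum>v\<in>{v. {u,v} \<in> D}. g v))"
    by (simp add: ip_def e sum_subtractf[symmetric] algebra_simps)
  also have "\<dots> \<le> (\<Sum>u\<in>V. a * (card {v. {u,v} \<in> D} * b))"
  proof (intro sum_mono mult_mono f ab)
    fix u show "(\<Sum>v\<in>{v. {u,v} \<in> D}. g v) \<le> card {v. {u,v} \<in> D} * b"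
      using sum_bounded_above[of "{v. {u,v} \<in> D}" g b] g by simp
    show "0 \<le> (\<Sum>v\<in>{v. {u,v} \<in> D}. g v)" using g by (intro sum_nonneg) auto
  qed
  also have "\<dots> = (\<Sum>u\<in>V. real (card {v. {u,v} \<in> D})) * (a * b)"
    by (simp add: sum_distrib_left algebra_simps)
  also have "(\<Sum>u\<in>V. real (card {v. {u,v} \<in> D})) = (\<Sum>u\<in>V. real (card {e\<in>D. u \<in> e}))"
  proof (intro sum.cong refl arg_cong[where f=real])
    fix u
    have "bij_betw (\<lambda>v. {u,v}) {v. {u,v} \<in> D} {e\<in>D. u \<in> e}"
    proof (rule bij_betwI')
      fix x y show "({u,x} = {u,y}) = (x = y)" by (auto simp: doubleton_eq_iff)
    next
      fix e assume e: "e \<in> {e\<in>D. u \<in> e}"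
      then obtain x y where "e = {x,y}" using edgeE D by blast
      then have "e = {u, x} \<or> e = {u, y}" using e by auto
      then show "\<exists>x\<in>{v. {u,v} \<in> D}. e = {u,x}" using e by auto
    qed auto
    then show "card {v. {u,v} \<in> D} = card {e\<in>D. u \<in> e}" by (rule bij_betw_same_card)
  qed
  also have "\<dots> = (\<Sum>u\<in>V. \<Sum>e\<in>D. of_bool (u \<in> e))" using fD by (simp add: Int_def)
  also have "\<dots> = (\<Sum>e\<in>D. \<Sum>u\<in>V. of_bool (u \<in> e))" by (rule sum.swap)
  also have "\<dots> = (\<Sum>e\<in>D. 2)"
  proof (rule sum.cong[OF refl])
    fix e assume "e \<in> D"
    then obtain x y where xy: "e = {x,y}" "x \<noteq> y" "x \<in> V" "y \<in> V" using edgeE D by blast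
    then have "V \<inter> {u. u \<in> e} = {x,y}" by auto
    moreover have "(\<Sum>u\<in>V. of_bool (u \<in> e)) = real (card (V \<inter> {u. u \<in> e}))"
      by (subst sum_of_bool_eq) (auto simp: finV)
    ultimately show "(\<Sum>u\<in>V. of_bool (u \<in> e)) = (2::real)" using xy by simp
  qed
  finally show ?thesis by (simp add: algebra_simps)
qed

lemma opD_pow_bounds:
  fixes g :: "'v \<Rightarrow> real" and b :: real
  assumes "\<And>v. 0 \<le> g v" "\<And>v. g v \<le> b"
  shows "0 \<le> (opD D ^^ j) g v \<and> (opD D ^^ j) g v \<le> (2 * real d) ^ j * b"
proof (induction j arbitrary: v)
  case (Suc j)
  then show ?case using opD_bounds[of "(opD D ^^ j) g" "(2 * real d) ^ j * b" D v] by (simp add: algebra_simps)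
qed (use assms in simp)

text \<open>The steps are replaced one at a time. Self-adjointness moves the remaining host steps to
  \<open>f\<close>, where each raises the bound \<open>a\<close> by a factor \<open>2 * d\<close>,
  while the steps already replaced raise \<open>b\<close> by the same factor; so every replacement
  loses the same amount.\<close>

lemma ip_opD_pow:
  fixes f g :: "'v \<Rightarrow> real" and a b :: real
  assumes f: "\<And>v. 0 \<le> f v" "\<And>v. f v \<le> a" and g: "\<And>v. 0 \<le> g v" "\<And>v. g v \<le> b" and D: "D \<subseteq> E"
  shows "ip f ((op0 ^^ Suc j) g) - Suc j * (2 * card D * (2 * real d) ^ j * a * b) \<le> ip f ((opD D ^^ Suc j) g)"
  using f
proof (induction j arbitrary: f a)
  case 0
  then show ?case using ip_opD[OF 0 g D] by simp
next
  case (Suc j)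
  let ?h = "(opD D ^^ Suc j) g"
  have h: "\<And>v. 0 \<le> ?h v" "\<And>v. ?h v \<le> (2 * real d) ^ Suc j * b" using opD_pow_bounds[where g=g and b=b and D=D and j="Suc j"] g by auto
  have f': "\<And>v. 0 \<le> op0 f v" "\<And>v. op0 f v \<le> 2 * real d * a" using opD_bounds[of f a "{}"] Suc.prems by auto
  have "ip f (op0 ?h) - 2 * card D * a * ((2 * real d) ^ Suc j * b) \<le> ip f (opD D ?h)"
    using ip_opD[OF Suc.prems h D] by simp
  moreover have "ip f (op0 ?h) = ip (op0 f) ?h" by (rule ip_op0)
  moreover have "ip (op0 f) ((op0 ^^ Suc j) g) - Suc j * (2 * card D * (2 * real d) ^ j * (2 * real d * a) * b) \<le> ip (op0 f) ?h"
    using Suc.IH[OF f'] .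
  moreover have "ip (op0 f) ((op0 ^^ Suc j) g) = ip f ((op0 ^^ Suc (Suc j)) g)" by (simp add: ip_op0)
  ultimately have "ip f ((op0 ^^ Suc (Suc j)) g) - Suc j * (2 * card D * (2 * real d) ^ j * (2 * real d * a) * b)
     - 2 * card D * a * ((2 * real d) ^ Suc j * b) \<le> ip f (opD D ?h)" by linarith
  then show ?case by (simp add: algebra_simps)
qed

lemma ip_mono: "(\<And>v. v \<in> V \<Longrightarrow> 0 \<le> g v) \<Longrightarrow> (\<And>v. v \<in> V \<Longrightarrow> f v \<le> f' v) \<Longrightarrow> ip f g \<le> ip f' g"
  unfolding ip_def by (intro sum_mono mult_right_mono) auto

lemma ip_comm: "ip f g = ip g f"
  unfolding ip_def by (simp add: mult.commute)

lemma adj_nonneg: "(\<And>v. 0 \<le> f v) \<Longrightarrow> 0 \<le> adj f u"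
  unfolding adj_def by (intro sum_nonneg) auto

lemma adj_mono: "(\<And>v. f v \<le> g v) \<Longrightarrow> adj f u \<le> adj g u"
  unfolding adj_def by (intro sum_mono) auto

lemma adj_le:
  fixes f :: "'v \<Rightarrow> real" and b :: real
  assumes "\<And>v. f v \<le> b" "0 \<le> b"
  shows "adj f u \<le> real d * b"
  unfolding adj_def using assms sum_bounded_above[of "nb u" f b] card_nb_le[of u]
    mult_right_mono[of "real (card (nb u))" "real d" b] by auto

lemma sum_adj: fixes f :: "'v \<Rightarrow> real" shows "(\<Sum>v\<in>V. adj f v) = d * (\<Sum>v\<in>V. f v)"
proof -
  have "(\<Sum>v\<in>V. adj f v) = ip (\<lambda>_. 1) (adj f)" by (simp add: ip_def)
  also have "\<dots> = ip (adj (\<lambda>_. 1)) f" by (rule ip_adj)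
  also have "\<dots> = (\<Sum>v\<in>V. d * f v)" unfolding ip_def adj_def by (intro sum.cong) (auto simp: card_nb)
  finally show ?thesis by (simp add: sum_distrib_left)
qed

section \<open>Walks of length two at both ends of a path\<close>

definition walk2 :: "'v set \<Rightarrow> 'v \<Rightarrow> real" where "walk2 X = adj (adj (indicator X))"

lemma walk2_nonneg: "0 \<le> walk2 X v"
  unfolding walk2_def by (intro adj_nonneg) (auto simp: indicator_def)

lemma walk2_le: "walk2 X v \<le> real d * real d"
proof -
  have "adj (indicator X) u \<le> real d * 1" for u by (rule adj_le) (auto simp: indicator_def)
  then show ?thesis unfolding walk2_def using adj_le[of "adj (indicator X)" "real d" v] by auto
qed

lemma walk2_Un: "W \<inter> T = {} \<Longrightarrow> walk2 (W \<union> T) v = walk2 W v + walk2 T v"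
proof -
  assume d: "W \<inter> T = {}"
  have "indicator (W \<union> T) u = indicator W u + (indicator T u :: real)" for u
    using d by (auto simp: indicator_def)
  then show ?thesis by (simp add: walk2_def adj_def sum.distrib)
qed

lemma sum_walk2: "X \<subseteq> V \<Longrightarrow> (\<Sum>v\<in>V. walk2 X v) = real d ^ 2 * card X"
proof -
  assume X: "X \<subseteq> V"
  have "(\<Sum>v\<in>V. indicator X v) = real (card (V \<inter> {v. v \<in> X}))"
    unfolding indicator_def using finV by (subst sum_of_bool_eq) auto
  moreover have "V \<inter> {v. v \<in> X} = X" using X by auto
  ultimately show ?thesis by (simp add: walk2_def sum_adj power2_eq_square)
qed

text \<open>Five steps are read as two from \<open>W\<close>, one that crosses an edge or pauses,
  and two towards \<open>T\<close>. Self-adjointness of \<open>op0\<close> shifts steps between the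
  two ends; pauses in the outer steps are dropped by
  \<open>walk2 X \<le> op0 (op0 (indicator X))\<close>.\<close>

lemma walks_ge:
  fixes W T defines "f \<equiv> walk2 W" and "g \<equiv> walk2 T"
  shows "ip f (adj g) + d * ip f g \<le> ip (indicator W) ((op0 ^^ 5) (indicator T))"
proof -
  let ?W = "indicator W :: 'v \<Rightarrow> real" and ?T = "indicator T :: 'v \<Rightarrow> real"
  have fn: "0 \<le> f v" "0 \<le> g v" for v using walk2_nonneg by (auto simp: f_def g_def)
  have le: "walk2 X v \<le> op0 (op0 (indicator X)) v" for X v
  proof -
    have 1: "adj (indicator X) u \<le> op0 (indicator X) u" for u by (simp add: op0_adj indicator_def)
    have 2: "0 \<le> op0 (indicator X) u" for u by (rule opD_bounds[where b=1]) (auto simp: indicator_def)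
    have "walk2 X v \<le> adj (op0 (indicator X)) v" unfolding walk2_def using 1 by (rule adj_mono)
    also have "\<dots> \<le> op0 (op0 (indicator X)) v" using 2 by (simp add: op0_adj[of "op0 (indicator X)"])
    finally show ?thesis .
  qed
  have on: "0 \<le> op0 h v" if "\<And>v. 0 \<le> h v" for h v
    unfolding op0_adj using that adj_nonneg[of h] by simp
  have "ip f (adj g) + d * ip f g = ip f (op0 g)"
    by (simp add: ip_def op0_adj sum.distrib sum_distrib_left algebra_simps)
  also have "\<dots> \<le> ip (op0 (op0 ?W)) (op0 g)"
    using le on fn by (intro ip_mono) (auto simp: f_def)
  also have "\<dots> = ip (op0 (op0 (op0 ?W))) g" by (rule ip_op0)
  also have "\<dots> = ip g (op0 (op0 (op0 ?W)))" by (rule ip_comm)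
  also have "\<dots> \<le> ip (op0 (op0 ?T)) (op0 (op0 (op0 ?W)))"
    using le on by (intro ip_mono) (auto simp: g_def indicator_def)
  also have "\<dots> = ip (op0 (op0 (op0 ?W))) (op0 (op0 ?T))" by (rule ip_comm)
  also have "\<dots> = ip ?W (op0 (op0 (op0 (op0 (op0 ?T)))))" by (simp only: ip_op0)
  also have "\<dots> = ip ?W ((op0 ^^ 5) ?T)" by (simp add: numeral_eq_Suc)
  finally show ?thesis .
qed

text \<open>With \<open>A = {v. h \<le> walk2 W v}\<close>, every vertex outside \<open>A\<close> has \<open>h \<le> walk2 T v\<close>. Unless \<open>A\<close> or its complement is small,
  the edges of \<^term>\<open>bd E A\<close> carry the walks.\<close>

lemma walks_cases:
  fixes h :: real
  assumes WT: "W \<subseteq> V" "T \<subseteq> V" "W \<inter> T = {}" and h: "0 \<le> h" "\<And>v. v \<in> V \<Longrightarrow> 2 * h \<le> walk2 (W \<union> T) v"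
  defines "\<Phi> \<equiv> ip (walk2 W) (adj (walk2 T)) + d * ip (walk2 W) (walk2 T)"
  shows "d * h * (real d ^ 2 * card W / 2) \<le> \<Phi> \<or> d * h * (real d ^ 2 * card T / 2) \<le> \<Phi> \<or>
    (\<exists>A\<subseteq>V. card W / 2 \<le> card A \<and> card A \<le> card V - card T / 2 \<and> h ^ 2 * card (bd E A) \<le> \<Phi>)"
proof -
  let ?f = "walk2 W" and ?g = "walk2 T"
  define A where "A = {v\<in>V. h \<le> ?f v}"
  have AV: "A \<subseteq> V" "finite A" using finV by (auto simp: A_def)
  have fg: "0 \<le> ?f v" "0 \<le> ?g v" "?f v \<le> real d ^ 2" "?g v \<le> real d ^ 2" for v
    using walk2_nonneg walk2_le by (auto simp: power2_eq_square)
  have gh: "h \<le> ?g v" if "v \<in> V - A" for v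
    using that h(2)[of v] walk2_Un[OF WT(3), of v] by (auto simp: A_def)
  have fh: "h \<le> ?f v" if "v \<in> A" for v using that by (auto simp: A_def)
  have ipn: "0 \<le> ip ?f (adj ?g)" "0 \<le> ip ?f ?g"
    unfolding ip_def using fg by (auto intro!: sum_nonneg mult_nonneg_nonneg adj_nonneg)
  consider "card A \<le> card W / 2" | "card (V - A) \<le> card T / 2" | "card W / 2 \<le> card A" "card T / 2 \<le> card (V - A)"
    by linarith
  then show ?thesis
  proof cases
    case 1
    \<comment> \<open>The total of \<open>walk2 W\<close> is \<open>d^2 * card W\<close> and a
      single value is at most \<open>d^2\<close>; so \<open>A\<close>, with at most half as many
      vertices as \<open>W\<close>, carries at most half of it, and every walk that ends outside
      \<open>A\<close> continues in at least \<open>h\<close> ways to \<open>T\<close>.\<close>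
    have "(\<Sum>v\<in>V. ?f v) = (\<Sum>v\<in>V-A. ?f v) + (\<Sum>v\<in>A. ?f v)" by (rule sum.subset_diff[OF AV(1) finV])
    moreover have "(\<Sum>v\<in>A. ?f v) \<le> card A * real d ^ 2" using sum_bounded_above[of A ?f] fg by simp
    moreover have "card A * real d ^ 2 \<le> card W / 2 * real d ^ 2" using 1 by (intro mult_right_mono) auto
    ultimately have "real d ^ 2 * card W / 2 \<le> (\<Sum>v\<in>V-A. ?f v)" using sum_walk2[OF WT(1)] by (simp add: algebra_simps)
    then have "h * (real d ^ 2 * card W / 2) \<le> h * (\<Sum>v\<in>V-A. ?f v)" using h by (intro mult_left_mono)
    also have "\<dots> = (\<Sum>v\<in>V-A. ?f v * h)" by (simp add: sum_distrib_left mult.commute)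
    also have "\<dots> \<le> (\<Sum>v\<in>V-A. ?f v * ?g v)" using gh fg by (intro sum_mono mult_left_mono) auto
    also have "\<dots> \<le> ip ?f ?g" unfolding ip_def using finV fg by (intro sum_mono2) auto
    finally have "d * (h * (real d ^ 2 * card W / 2)) \<le> d * ip ?f ?g" by (intro mult_left_mono) auto
    then show ?thesis unfolding \<Phi>_def using ipn by (intro disjI1) (simp add: mult.assoc)
  next
    case 2
    have "(\<Sum>v\<in>V. ?g v) = (\<Sum>v\<in>V-A. ?g v) + (\<Sum>v\<in>A. ?g v)" by (rule sum.subset_diff[OF AV(1) finV])
    moreover have "(\<Sum>v\<in>V-A. ?g v) \<le> card (V-A) * real d ^ 2" using sum_bounded_above[of "V-A" ?g] fg by simp
    moreover have "card (V-A) * real d ^ 2 \<le> card T / 2 * real d ^ 2" using 2 by (intro mult_right_mono) auto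
    ultimately have "real d ^ 2 * card T / 2 \<le> (\<Sum>v\<in>A. ?g v)" using sum_walk2[OF WT(2)] by (simp add: algebra_simps)
    then have "h * (real d ^ 2 * card T / 2) \<le> h * (\<Sum>v\<in>A. ?g v)" using h by (intro mult_left_mono)
    also have "\<dots> = (\<Sum>v\<in>A. h * ?g v)" by (simp add: sum_distrib_left)
    also have "\<dots> \<le> (\<Sum>v\<in>A. ?f v * ?g v)" using fh fg by (intro sum_mono mult_right_mono) auto
    also have "\<dots> \<le> ip ?f ?g" unfolding ip_def using finV fg AV by (intro sum_mono2) auto
    finally have "d * (h * (real d ^ 2 * card T / 2)) \<le> d * ip ?f ?g" by (intro mult_left_mono) auto
    then show ?thesis unfolding \<Phi>_def using ipn by (intro disjI2 disjI1) (simp add: mult.assoc)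
  next
    case 3
    \<comment> \<open>Every edge that leaves \<open>A\<close> joins a vertex with at least
      \<open>h\<close> walks to \<open>W\<close> to one with at least \<open>h\<close> walks to
      \<open>T\<close>.\<close>
    have "h ^ 2 * card (bd E A) = (\<Sum>v\<in>A. h * (card (nb v - A) * h))"
      unfolding card_bd[OF AV(2)] by (simp add: sum_distrib_left power2_eq_square algebra_simps)
    also have "\<dots> \<le> (\<Sum>v\<in>A. ?f v * adj ?g v)"
    proof (intro sum_mono mult_mono)
      fix v assume v: "v \<in> A"
      have "card (nb v - A) * h \<le> (\<Sum>u\<in>nb v - A. ?g u)"
        using sum_bounded_below[of "nb v - A" h ?g] gh nb_V by auto
      also have "\<dots> \<le> adj ?g v" unfolding adj_def using fin_nb fg by (intro sum_mono2) auto
      finally show "card (nb v - A) * h \<le> adj ?g v" .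
    qed (use fh fg h in auto)
    also have "\<dots> \<le> ip ?f (adj ?g)" unfolding ip_def
      using finV fg AV by (intro sum_mono2) (auto intro!: mult_nonneg_nonneg adj_nonneg)
    finally have "h ^ 2 * card (bd E A) \<le> \<Phi>" unfolding \<Phi>_def using ipn by (simp add: add_increasing2)
    moreover have "card (V - A) = card V - card A" "card A \<le> card V" using AV finV by (auto simp: card_Diff_subset card_mono)
    ultimately show ?thesis using 3 AV by (intro disjI2 exI[of _ A]) auto
  qed
qed

end

section \<open>Encoding unions of clusters\<close>

text \<open>The decoder: it starts from the roots \<open>R\<close>, follows the edges of
  \<open>F\<close> that are not declared closed by \<open>X\<close>, and may jump within distance
  five in the host onto a marked vertex. As the result is a function of the data, different results
  are disjoint events when the data are random.\<close>

inductive_set reach :: "'v set set \<Rightarrow> 'v set set \<Rightarrow> 'v set \<Rightarrow> 'v set set \<Rightarrow> 'v set \<Rightarrow> 'v set"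
  for E F R X M where
  root: "r \<in> R \<Longrightarrow> r \<in> reach E F R X M"
| edge: "u \<in> reach E F R X M \<Longrightarrow> {u,v} \<in> F - X \<Longrightarrow> v \<in> reach E F R X M"
| jump: "u \<in> reach E F R X M \<Longrightarrow> v \<in> M \<Longrightarrow> v \<in> (step E ^^ 5) {u} \<Longrightarrow> v \<in> reach E F R X M"

lemma step_pow_iff: "v \<in> (step E ^^ j) X \<longleftrightarrow> (\<exists>u\<in>X. v \<in> (step E ^^ j) {u})"
  by (induction j arbitrary: v) (auto simp: step_def, blast+)

lemma step_pow_inc: "i \<le> j \<Longrightarrow> (step E ^^ i) X \<subseteq> (step E ^^ j) X"
  by (rule lift_Suc_mono_le[of "\<lambda>i. (step E ^^ i) X"]) (auto simp: step_def)

lemma Least_level: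
  fixes L :: "nat \<Rightarrow> 'v set"
  assumes "v \<in> (\<Union>i. L i)"
  shows "v \<in> L (LEAST i. v \<in> L i)" "v \<in> L i \<Longrightarrow> (LEAST i. v \<in> L i) \<le> i"
  using assms by (auto intro: LeastI Least_le)

lemma pex_multr: "pex p E (\<lambda>F. g F * c) = pex p E g * c"
  using pex_cmult[of p E c g] by (simp add: mult.commute)

context regular_host
begin

definition big :: "nat \<Rightarrow> 'v set set \<Rightarrow> 'v set" where "big m F = {v\<in>V. m \<le> card (cluster F V v)}"

definition near :: "'v set \<Rightarrow> 'v set" where "near X = (step E ^^ 5) X"

definition touch :: "'v set set \<Rightarrow> 'v set \<Rightarrow> 'v set set" where "touch F X = {e\<in>F. e \<inter> X \<noteq> {}}"

lemma card_step: assumes "X \<subseteq> V" shows "card (step E X) \<le> card X * Suc d"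
proof -
  have fX: "finite X" using assms finV finite_subset by blast
  have "step E X = X \<union> (\<Union>x\<in>X. nb x)" by (auto simp: step_def nb_def)
  then have "card (step E X) \<le> card X + card (\<Union>x\<in>X. nb x)" by (simp add: card_Un_le)
  also have "card (\<Union>x\<in>X. nb x) \<le> (\<Sum>x\<in>X. card (nb x))" using fX by (rule card_UN_le)
  also have "\<dots> \<le> card X * d" using sum_bounded_above[of X "\<lambda>x. card (nb x)" d] card_nb_le by simp
  finally show ?thesis by simp
qed

lemma card_step_pow: assumes "X \<subseteq> V" shows "card ((step E ^^ j) X) \<le> card X * Suc d ^ j"
proof (induction j)
  case (Suc j)
  have "card ((step E ^^ Suc j) X) \<le> card ((step E ^^ j) X) * Suc d"
    using card_step[OF step_pow_V[OF order_refl assms]] by simp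
  also have "\<dots> \<le> card X * Suc d ^ j * Suc d" using Suc by (rule mult_le_mono1)
  finally show ?case by (simp add: algebra_simps)
qed simp

lemma card_touch: assumes "F \<subseteq> E" "X \<subseteq> V" shows "card (touch F X) \<le> card X * d" "finite (touch F X)"
proof -
  have fX: "finite X" using assms finV finite_subset by blast
  have fe: "finite {e\<in>E. x \<in> e}" for x using finE by simp
  have sub: "touch F X \<subseteq> (\<Union>x\<in>X. {e\<in>E. x \<in> e})" using assms by (auto simp: touch_def)
  have "card (touch F X) \<le> card (\<Union>x\<in>X. {e\<in>E. x \<in> e})" using fX finE by (intro card_mono[OF _ sub]) auto
  also have "\<dots> \<le> (\<Sum>x\<in>X. card {e\<in>E. x \<in> e})" using fX by (rule card_UN_le)
  also have "\<dots> = card X * d" using degE assms by (simp add: subset_iff)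
  finally show "card (touch F X) \<le> card X * d" .
  show "finite (touch F X)" using finite_subset[OF assms(1) finE] by (simp add: touch_def)
qed

text \<open>\<open>W\<close> can be read off from few data: roots \<open>R\<close>, the edges of \<open>F\<close> leaving \<open>W\<close>, and a set \<open>M\<close> of marked vertices
  that admit jumps of length at most five. The sets \<open>X\<close> and \<open>M'\<close> only have to be right in the vicinity of \<open>W\<close>.\<close>

definition code :: "nat \<Rightarrow> 'v set set \<Rightarrow> 'v set \<Rightarrow> 'v set \<Rightarrow> bool" where
  "code b F R W \<longleftrightarrow> card (bd F W) \<le> b \<and> (\<exists>M\<subseteq>near W. card M \<le> b \<and>
     (\<forall>X M'. X \<inter> touch F W = bd F W \<longrightarrow> M' \<inter> near W = M \<longrightarrow> reach E F R X M' = W))"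

text \<open>\<open>W\<close> is the closure of \<open>W2\<close> under passing to vertices of
  \<open>S\<close> in big \<open>F1\<close>-clusters within distance five. So a path of length five
  from \<open>W\<close> meets a vertex of a big cluster outside \<open>W\<close> only after using a
  boundary edge of \<open>S\<close> near \<open>W\<close>. The closure splits into
  \<open>F1\<close>-clusters inside \<open>S\<close>. Those in \<open>W2\<close> get one root each,
  at most \<open>card S / m\<close> in all. Each other one has fewer than \<open>m\<close> vertices
  but is part of a big cluster, hence emits a boundary edge of \<open>S\<close> of its own, which
  pays for its mark.\<close>

lemma cluster_closure:
  fixes m :: nat
  assumes F1: "F1 \<subseteq> F" and FE: "F \<subseteq> E" and S: "S \<subseteq> V"
  defines "W2 \<equiv> {v\<in>S. m \<le> card (cluster F1 S v)}"
  shows "\<exists>R W. R \<subseteq> V \<and> card R * m \<le> card S \<and> W2 \<subseteq> W \<and> W \<subseteq> S \<inter> big m F1 \<and> code (card (bd F S)) F1 R W \<and>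
    (\<forall>F2\<subseteq>F. (step (F2 - bd F S \<inter> touch E (near W)) ^^ 5) W \<inter> (big m F1 - W) = {})"
proof -
  let ?B = "big m F1" and ?K = "cluster F1 S"
  have F1E: "F1 \<subseteq> E" using F1 FE by blast
  have fS: "finite S" using S finV finite_subset by blast
  have KS: "?K v \<subseteq> S" if "v \<in> S" for v using cluster_subset[OF that] .
  have fK: "finite (?K v)" if "v \<in> S" for v using KS[OF that] fS finite_subset by blast
  have KV: "?K v \<subseteq> cluster F1 V v" if "v \<in> S" for v using cluster_mono[OF order_refl S that] .
  have fKV: "finite (cluster F1 V v)" if "v \<in> V" for v using cluster_subset[OF that, of F1] finV finite_subset by blast
  have Keq: "?K u = ?K v" if "v \<in> S" "u \<in> ?K v" for u v using cluster_eq[OF that] .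
  have W2B: "W2 \<subseteq> S \<inter> ?B"
  proof
    fix v assume v: "v \<in> W2"
    then have vS: "v \<in> S" "m \<le> card (?K v)" by (auto simp: W2_def)
    then show "v \<in> S \<inter> ?B" using card_mono[OF fKV KV[OF vS(1)]] S by (force simp: big_def)
  qed
  have bigK: "y \<in> ?B" if "x \<in> ?B" "{x,y} \<in> F1" for x y
  proof -
    have xy: "x \<in> V" "y \<in> V" using edge_V that(2) F1E by blast+
    have "y \<in> cluster F1 V x" using cluster_step[of x F1 V x y] that xy by simp
    then show ?thesis using cluster_eq[OF xy(1), of y F1] that xy by (simp add: big_def)
  qed
  \<comment> \<open>\<open>lev\<close> records the round of the closure in which a vertex appears;
    it orders the clusters for decoding.\<close>
  define L where "L = rec_nat W2 (\<lambda>_ X. X \<union> (near X \<inter> S \<inter> ?B))"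
  have L0: "L 0 = W2" and LS: "L (Suc i) = L i \<union> (near (L i) \<inter> S \<inter> ?B)" for i by (auto simp: L_def)
  define W where "W = (\<Union>i. L i)"
  define lev where "lev v = (LEAST i. v \<in> L i)" for v
  have L_sub: "L i \<subseteq> S \<inter> ?B" for i by (induction i) (use W2B L0 LS in auto)
  have WS: "W \<subseteq> S \<inter> ?B" using L_sub by (auto simp: W_def)
  have W2W: "W2 \<subseteq> W" unfolding W_def using L0 by blast
  have clos: "v \<in> W" if uv: "u \<in> W" "v \<in> near {u}" "v \<in> S \<inter> ?B" for u v
  proof -
    obtain i where "u \<in> L i" using uv(1) by (auto simp: W_def)
    then have "v \<in> near (L i)" using uv(2) step_pow_iff[of v 5 E "L i"] by (auto simp: near_def)
    then have "v \<in> L (Suc i)" using uv(3) LS by auto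
    then show ?thesis by (auto simp: W_def)
  qed
  have pred: "\<exists>u\<in>W. lev u < lev v \<and> v \<in> near {u}" if v: "v \<in> W" "v \<notin> W2" for v
  proof -
    have vL: "v \<in> L (lev v)" using Least_level(1)[of v L] v by (simp add: lev_def W_def)
    then have "lev v \<noteq> 0" using L0 v by metis
    then obtain i where i: "lev v = Suc i" by (cases "lev v") auto
    have "v \<notin> L i" using Least_level(2)[of v L i] v i by (force simp: lev_def W_def)
    then have "v \<in> near (L i)" using vL i LS by auto
    then obtain u where u: "u \<in> L i" "v \<in> near {u}" using step_pow_iff[of v 5 E "L i"] by (auto simp: near_def)
    then have "u \<in> W" by (auto simp: W_def)
    moreover have "lev u \<le> i" using Least_level(2)[of u L i] u calculation by (simp add: lev_def W_def)
    ultimately show ?thesis using u i by (intro bexI[of _ u]) auto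
  qed
  have edgeW: "y \<in> W" if "x \<in> W" "y \<in> S" "{x,y} \<in> F1" for x y
  proof (rule clos[OF that(1)])
    have "y \<in> (step E ^^ 1) {x}" using that F1E by (auto simp: step_def)
    then show "y \<in> near {x}" unfolding near_def using step_pow_inc[of 1 5 E "{x}"] by auto
    show "y \<in> S \<inter> ?B" using that WS bigK by blast
  qed
  have KW: "?K v \<subseteq> W" if "v \<in> W" for v
    by (rule cluster_sub_closed[OF that]) (use edgeW in blast)
  have bdW: "bd F1 W \<subseteq> bd F S"
  proof
    fix e assume "e \<in> bd F1 W"
    then obtain x y where e: "e = {x,y}" "x \<in> W" "y \<notin> W" "e \<in> F1" using bd_iff[OF F1E] by blast
    then have "y \<notin> S" using edgeW by blast
    then show "e \<in> bd F S" using bd_edge[OF FE, of x y S] e F1 WS by blast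
  qed
  define Tn where "Tn = ?K ` {v\<in>W. v \<notin> W2}"
  \<comment> \<open>A vertex of least level in a small cluster is the one marked: it is within a
    jump of a vertex of lower level, and the rest of the cluster follows along edges.\<close>
  define z where "z K = (SOME u. u \<in> K \<and> (\<forall>u'\<in>K. lev u \<le> lev u'))" for K
  have z: "z K \<in> K \<and> (\<forall>u'\<in>K. lev (z K) \<le> lev u')" if "v \<in> W" "K = ?K v" for K v
  proof -
    have "\<exists>u. u \<in> K \<and> (\<forall>u'\<in>K. lev u \<le> lev u')"
      using ex_has_least_nat[of "\<lambda>u. u \<in> K" v lev] that by (metis cluster_refl)
    then show ?thesis unfolding z_def by (rule someI_ex)
  qed
  define M where "M = z ` Tn"
  have TnW: "K \<subseteq> W" if "K \<in> Tn" for K using that KW by (auto simp: Tn_def)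
  have fTn: "finite Tn" using finite_subset[OF WS] fS by (auto simp: Tn_def)
  have MW: "M \<subseteq> W"
  proof
    fix u assume "u \<in> M"
    then obtain v where "v \<in> W" "u = z (?K v)" by (auto simp: M_def Tn_def)
    then show "u \<in> W" using z[of v "?K v"] KW by blast
  qed
  have Wnear: "W \<subseteq> near W" using step_pow_inc[of 0 5 E W] by (simp add: near_def)
  have cM: "card M \<le> card (bd F S)"
  proof -
    have ex: "\<exists>e\<in>bd F S. e \<inter> S \<noteq> {} \<and> e \<inter> S \<subseteq> K" if KT: "K \<in> Tn" for K
    proof -
      obtain v where v: "v \<in> W" "v \<notin> W2" "K = ?K v" using KT by (auto simp: Tn_def)
      have vS: "v \<in> S" "v \<in> V" "m \<le> card (cluster F1 V v)" using v WS by (auto simp: big_def)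
      have "card K < m" using v vS by (auto simp: W2_def)
      then have "K \<noteq> cluster F1 V v" using vS by auto
      then obtain y' where "y' \<in> cluster F1 V v - K" using KV[OF vS(1)] v by blast
      then obtain x y where xy: "x \<in> K" "y \<in> cluster F1 V v - K" "{x,y} \<in> F1"
        using conn_cut[OF conn_cluster[OF vS(2)] _ _ \<open>y' \<in> cluster F1 V v - K\<close>, of v] KV[OF vS(1)] v by auto
      have xS: "x \<in> S" using xy KS[OF vS(1)] v by blast
      have "y \<notin> S" using cluster_step[of x F1 S v y] xy v xS by blast
      then show ?thesis using bd_edge[OF FE, of x y S] xy xS F1
        by (intro bexI[of _ "{x,y}"]) auto
    qed
    then obtain e where e: "\<And>K. K \<in> Tn \<Longrightarrow> e K \<in> bd F S \<and> e K \<inter> S \<noteq> {} \<and> e K \<inter> S \<subseteq> K" by metis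
    have "inj_on e Tn"
    proof (rule inj_onI)
      fix K K' assume K: "K \<in> Tn" "K' \<in> Tn" "e K = e K'"
      obtain v v' where v: "v \<in> W" "K = ?K v" "v' \<in> W" "K' = ?K v'" using K by (auto simp: Tn_def)
      obtain x where "x \<in> K" "x \<in> K'" using e[OF K(1)] e[OF K(2)] K(3) by blast
      then show "K = K'" using Keq[of v x] Keq[of v' x] v WS by auto
    qed
    then have "card Tn \<le> card (bd F S)" using e fin_bd[OF FE] by (intro card_inj_on_le[of e]) auto
    moreover have "card M \<le> card Tn" unfolding M_def using fTn by (rule card_image_le)
    ultimately show ?thesis by simp
  qed
  define R where "R = (\<lambda>K. SOME v. v \<in> K) ` (?K ` W2)"
  have W2S: "W2 \<subseteq> S" by (auto simp: W2_def)
  have KW2: "?K v \<subseteq> W2" if "v \<in> W2" for v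
  proof
    fix u assume u: "u \<in> ?K v"
    have "v \<in> S" using that W2S by blast
    then show "u \<in> W2" using Keq[OF _ u] KS u that by (auto simp: W2_def)
  qed
  have some: "(SOME u. u \<in> ?K v) \<in> ?K v" for v by (rule someI[of _ v]) simp
  have RW2: "R \<subseteq> W2" using some KW2 by (auto simp: R_def)
  have cR: "card R * m \<le> card S"
  proof -
    have fin: "finite (?K ` W2)" using fS W2S finite_subset by blast
    have "card R * m \<le> card (?K ` W2) * m" unfolding R_def using card_image_le[OF fin] by (rule mult_le_mono1)
    also have "\<dots> \<le> (\<Sum>K\<in>?K ` W2. card K)"
    proof (subst sum_constant[symmetric, where 'a=nat, unfolded of_nat_id], rule sum_mono)
      fix K assume "K \<in> ?K ` W2"
      then show "m \<le> card K" unfolding W2_def by blast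
    qed
    also have "\<dots> = card (\<Union>(?K ` W2))"
    proof (rule card_Union_disjoint[symmetric])
      show "pairwise disjnt (?K ` W2)"
      proof (rule pairwiseI)
        fix K K' assume K: "K \<in> ?K ` W2" "K' \<in> ?K ` W2" "K \<noteq> K'"
        obtain v v' where v: "v \<in> S" "K = ?K v" "v' \<in> S" "K' = ?K v'" using K W2S by blast
        show "disjnt K K'"
        proof (rule ccontr)
          assume "\<not> disjnt K K'"
          then obtain x where "x \<in> K" "x \<in> K'" by (auto simp: disjnt_def)
          then show False using Keq[of v x] Keq[of v' x] v K(3) by simp
        qed
      qed
    qed (use fK W2S in auto)
    also have "\<dots> \<le> card S" using KS W2S fS by (intro card_mono) auto
    finally show ?thesis .
  qed
  have reachW: "reach E F1 R X M' = W" if X: "X \<inter> touch F1 W = bd F1 W" and M': "M' \<inter> near W = M" for X M'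
  proof
    show "reach E F1 R X M' \<subseteq> W"
    proof
      fix u assume "u \<in> reach E F1 R X M'"
      then show "u \<in> W"
      proof induction
        case (root r) then show ?case using RW2 W2W by blast
      next
        case (edge u v)
        show ?case
        proof (rule ccontr)
          assume "v \<notin> W"
          then have "{u,v} \<in> bd F1 W" using bd_edge[OF F1E] edge by blast
          then show False using X edge by blast
        qed
      next
        case (jump u v)
        have "v \<in> near W" using jump step_pow_iff[of v 5 E W] by (auto simp: near_def)
        then show ?case using jump M' MW by blast
      qed
    qed
    have Kreach: "?K v \<subseteq> reach E F1 R X M'" if v: "v \<in> W" and w: "w \<in> ?K v" "w \<in> reach E F1 R X M'" for v w
    proof (rule conn_subset_closed[of F1 "?K v" w])
      show "conn F1 (?K v)" using conn_cluster[of v S F1] v WS by blast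
      fix x y assume xy: "x \<in> reach E F1 R X M'" "x \<in> ?K v" "y \<in> ?K v" "{x,y} \<in> F1"
      have xyW: "x \<in> W" "y \<in> W" using xy KW[OF v] by auto
      have "{x,y} \<notin> bd F1 W" using xyW bd_iff[OF F1E] by (auto simp: doubleton_eq_iff)
      moreover have "{x,y} \<in> touch F1 W" using xyW xy by (auto simp: touch_def)
      ultimately have "{x,y} \<in> F1 - X" using X xy by blast
      then show "y \<in> reach E F1 R X M'" by (rule reach.edge[OF xy(1)])
    qed (use w in auto)
    \<comment> \<open>Induction on the level: the jump into the cluster of \<open>v\<close> starts
      at a vertex of level below \<open>n\<close>, which the decoder has already reached.\<close>
    have "\<forall>v\<in>W. lev v = n \<longrightarrow> v \<in> reach E F1 R X M'" for n
    proof (induction n rule: less_induct)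
      case (less n)
      show ?case
      proof (intro ballI impI)
        fix v assume v: "v \<in> W" "lev v = n"
        show "v \<in> reach E F1 R X M'"
        proof (cases "v \<in> W2")
          case True
          then have "(SOME u. u \<in> ?K v) \<in> R" by (auto simp: R_def)
          then have "?K v \<subseteq> reach E F1 R X M'" using Kreach[OF v(1) some reach.root] by simp
          then show ?thesis by auto
        next
          case False
          let ?z = "z (?K v)"
          have zz: "?z \<in> ?K v" "lev ?z \<le> n" using z[OF v(1) refl] v(2) cluster_refl[of v F1 S] by blast+
          have vS: "v \<in> S" using v WS by blast
          have "?z \<notin> W2" using Keq[OF vS zz(1)] False vS by (auto simp: W2_def)
          then obtain u where u: "u \<in> W" "lev u < lev ?z" "?z \<in> near {u}" using pred[of ?z] zz KW[OF v(1)] by blast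
          have "lev u < n" using u(2) zz(2) by simp
          from less[OF this] have "u \<in> reach E F1 R X M'" using u(1) by blast
          moreover have "?z \<in> M'" using M' v False by (auto simp: M_def Tn_def)
          ultimately have "?z \<in> reach E F1 R X M'" by (rule reach.jump) (use u(3) in \<open>simp add: near_def\<close>)
          then show ?thesis using Kreach[OF v(1) zz(1)] by auto
        qed
      qed
    qed
    then show "W \<subseteq> reach E F1 R X M'" by blast
  qed
  have code: "code (card (bd F S)) F1 R W"
    unfolding code_def using reachW MW Wnear cM card_mono[OF fin_bd[OF FE] bdW] by blast
  have esc: "(step (F2 - bd F S \<inter> touch E (near W)) ^^ 5) W \<inter> (big m F1 - W) = {}" if F2: "F2 \<subseteq> F" for F2
  proof -
    let ?F = "F2 - bd F S \<inter> touch E (near W)"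
    have FE2: "?F \<subseteq> E" using F2 FE by blast
    have sub: "(step ?F ^^ i) W \<subseteq> near W" if "i \<le> 5" for i
      using step_pow_mono[OF FE2 order_refl, of i W] step_pow_inc[OF that, of E W] by (auto simp: near_def)
    have "i \<le> 5 \<Longrightarrow> (step ?F ^^ i) W \<subseteq> S" for i
    proof (induction i)
      case 0 then show ?case using WS by auto
    next
      case (Suc i)
      have cl: "v \<in> S" if u: "u \<in> (step ?F ^^ i) W" "{u,v} \<in> ?F" for u v
      proof (rule ccontr)
        assume "v \<notin> S"
        moreover have "u \<in> S" using u(1) Suc by auto
        moreover have "{u,v} \<in> F" using u(2) F2 by blast
        ultimately have "{u,v} \<in> bd F S" using bd_edge[OF FE] by metis
        moreover have "u \<in> near W" using sub[of i] u(1) Suc.prems by auto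
        then have "{u,v} \<in> touch E (near W)" using u(2) FE2 unfolding touch_def by blast
        ultimately show False using u by blast
      qed
      have "(step ?F ^^ i) W \<subseteq> S" using Suc by simp
      then show ?case using cl unfolding funpow.simps o_def step_def[of ?F "(step ?F ^^ i) W"] by blast
    qed
    from this[of 5] have "x \<in> W" if "x \<in> (step ?F ^^ 5) W" "x \<in> ?B" for x
      using that sub[of 5] step_pow_iff[of x 5 E W] clos by (auto simp: near_def)
    then show ?thesis by blast
  qed
  have "R \<subseteq> V" using RW2 W2S S by blast
  then show ?thesis using cR W2W WS code esc by blast
qed

text \<open>Choose \<open>X\<close>, \<open>M'\<close> and the edges of \<open>D\<close> at random with density \<open>\<theta>\<close>: every pair in \<open>P\<close> is decoded with at least the
  probability that is the inverse of the bound, and these events are disjoint.\<close>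

lemma card_codes:
  assumes F: "F \<subseteq> E" and th: "0 < \<theta>" "\<theta> < 1"
    and P: "\<And>W D. (W, D) \<in> P \<Longrightarrow> W \<subseteq> V \<and> card W \<le> k \<and> D \<subseteq> touch E (near W) \<and> card D \<le> b \<and> code b F R W"
  shows "real (card P) \<le> (1 / \<theta>) ^ (3 * b) * (1 / (1 - \<theta>)) ^ (3 * k * Suc d ^ 6)"
proof -
  have fP: "finite P"
  proof (rule finite_subset)
    show "P \<subseteq> Pow V \<times> Pow E" using P by (fastforce simp: touch_def)
    show "finite (Pow V \<times> Pow E)" using finV finE by simp
  qed
  let ?K = "3 * k * Suc d ^ 6"
  let ?ev = "\<lambda>X M D' WD. of_bool (reach E F R X M = fst WD \<and> D' \<inter> touch E (near (fst WD)) = snd WD) :: real"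
  let ?ex = "\<lambda>g. pex \<theta> E (\<lambda>X. pex \<theta> V (\<lambda>M. pex \<theta> E (\<lambda>D'. g X M D')))"
  have lower: "\<theta> ^ (3 * b) * (1 - \<theta>) ^ ?K \<le> ?ex (\<lambda>X M D'. ?ev X M D' WD)" if WD: "WD \<in> P" for WD
  proof -
    obtain W D where eq: "WD = (W, D)" by (cases WD)
    have W: "W \<subseteq> V" "card W \<le> k" "D \<subseteq> touch E (near W)" "card D \<le> b" "code b F R W" using P WD eq by auto
    obtain M0 where M0: "M0 \<subseteq> near W" "card M0 \<le> b"
      "\<And>X M'. X \<inter> touch F W = bd F W \<Longrightarrow> M' \<inter> near W = M0 \<Longrightarrow> reach E F R X M' = W" and b: "card (bd F W) \<le> b"
      using W(5) unfolding code_def by blast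
    let ?A1 = "touch F W" and ?A2 = "near W" and ?A3 = "touch E (near W)"
    have nV: "near W \<subseteq> V" unfolding near_def by (rule step_pow_V[OF order_refl W(1)])
    have bdt: "bd F W \<subseteq> ?A1" using bd_iff[OF F] by (auto simp: touch_def)
    have A: "?A1 \<subseteq> E" "?A3 \<subseteq> E" using F by (auto simp: touch_def)
    have fin: "finite ?A1" "finite ?A2" "finite ?A3" using A nV finE finV finite_subset by blast+
    \<comment> \<open>These are the windows in which the random data must be right: edges at
      \<open>W\<close>, vertices near \<open>W\<close>, edges near \<open>W\<close>. Five steps
      enlarge a set by at most \<open>Suc d ^ 5\<close>, and passing to incident edges costs one
      more factor.\<close>
    have c: "card ?A1 + card ?A2 + card ?A3 \<le> ?K"
    proof -
      have n: "card (near W) \<le> k * Suc d ^ 5"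
        unfolding near_def using order_trans[OF card_step_pow[OF W(1)] mult_le_mono1[OF W(2)]] .
      have "Suc d ^ 1 \<le> Suc d ^ 6" by (rule power_increasing) auto
      then have dd: "d \<le> Suc d ^ 6" by simp
      have "card ?A1 \<le> k * d" using card_touch(1)[OF F W(1)] mult_le_mono1[OF W(2), of d] by linarith
      also have "\<dots> \<le> k * Suc d ^ 6" using dd by (rule mult_le_mono2)
      finally have 1: "card ?A1 \<le> k * Suc d ^ 6" .
      have "k * Suc d ^ 5 \<le> k * Suc d ^ 6" by (intro mult_le_mono2 power_increasing) auto
      then have 2: "card ?A2 \<le> k * Suc d ^ 6" using n by linarith
      have "card ?A3 \<le> card (near W) * d" by (rule card_touch(1)[OF order_refl nV])
      also have "\<dots> \<le> (k * Suc d ^ 5) * Suc d" using n by (intro mult_le_mono) auto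
      also have "\<dots> = k * Suc d ^ 6" by (simp add: numeral_eq_Suc algebra_simps)
      finally show ?thesis using 1 2 by simp
    qed
    have "\<theta> ^ (3 * b) * (1 - \<theta>) ^ ?K \<le>
      (\<theta> ^ card (bd F W) * (1 - \<theta>) ^ card (?A1 - bd F W)) * ((\<theta> ^ card M0 * (1 - \<theta>) ^ card (?A2 - M0)) * (\<theta> ^ card D * (1 - \<theta>) ^ card (?A3 - D)))"
    proof -
      have "card (?A1 - bd F W) \<le> card ?A1" "card (?A2 - M0) \<le> card ?A2" "card (?A3 - D) \<le> card ?A3"
        using fin by (auto intro!: card_mono)
      then have "\<theta> ^ (3 * b) * (1 - \<theta>) ^ ?K \<le> \<theta> ^ (card (bd F W) + card M0 + card D) * (1 - \<theta>) ^ (card (?A1 - bd F W) + card (?A2 - M0) + card (?A3 - D))"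
        using th b M0(2) W(4) c by (intro mult_mono power_decreasing) auto
      then show ?thesis by (simp add: power_add algebra_simps)
    qed
    also have "\<dots> = pex \<theta> E (\<lambda>X. of_bool (X \<inter> ?A1 = bd F W)) *
       (pex \<theta> V (\<lambda>M. of_bool (M \<inter> ?A2 = M0)) * pex \<theta> E (\<lambda>D'. of_bool (D' \<inter> ?A3 = D)))"
      by (simp add: pex_pattern[OF finE A(1) bdt] pex_pattern[OF finV nV M0(1)] pex_pattern[OF finE A(2) W(3)])
    also have "\<dots> = ?ex (\<lambda>X M D'. of_bool (X \<inter> ?A1 = bd F W) * (of_bool (M \<inter> ?A2 = M0) * of_bool (D' \<inter> ?A3 = D)))"
      by (simp only: pex_cmult pex_multr)
    also have "\<dots> \<le> ?ex (\<lambda>X M D'. ?ev X M D' WD)"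
      using th M0(3) eq by (intro pex_mono) (auto simp: of_bool_def)
    finally show ?thesis .
  qed
  have "card P * (\<theta> ^ (3 * b) * (1 - \<theta>) ^ ?K) \<le> (\<Sum>WD\<in>P. ?ex (\<lambda>X M D'. ?ev X M D' WD))"
    using sum_bounded_below[of P "\<theta> ^ (3 * b) * (1 - \<theta>) ^ ?K" "\<lambda>WD. ?ex (\<lambda>X M D'. ?ev X M D' WD)"] lower by simp
  also have "\<dots> = ?ex (\<lambda>X M D'. \<Sum>WD\<in>P. ?ev X M D' WD)" by (simp only: pex_sum)
  also have "\<dots> \<le> ?ex (\<lambda>X M D'. 1)"
  proof (intro pex_mono)
    fix X M D'
    let ?T = "{WD\<in>P. reach E F R X M = fst WD \<and> D' \<inter> touch E (near (fst WD)) = snd WD}"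
    have "?T \<subseteq> {(reach E F R X M, D' \<inter> touch E (near (reach E F R X M)))}" by auto
    then have "card ?T \<le> 1" using card_mono[of "{(reach E F R X M, D' \<inter> touch E (near (reach E F R X M)))}" ?T] by simp
    then show "(\<Sum>WD\<in>P. ?ev X M D' WD) \<le> 1" using fP by (simp add: Int_def)
  qed (use th in auto)
  also have "\<dots> = 1" using finE finV by (simp add: pex_const)
  finally show ?thesis using th by (simp add: field_simps power_divide)
qed

end

section \<open>Expansion and cluster sizes by weighted union bounds\<close>

text \<open>In the union bounds the exponents cancel to first order and what remains is of order
  \<open>\<epsilon>^2\<close>, so logarithms are needed up to an error of order
  \<open>\<epsilon>^3\<close>. The proof compares \<open>1 + e\<close> with the quadratic Taylor
  polynomial of \<open>exp\<close> at the claimed bound.\<close>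

lemma ln_one_plus_le: fixes e :: real assumes "0 \<le> e" "e \<le> 1/10" shows "ln (1 + e) \<le> e - e^2/2 + e^3/2"
proof -
  let ?y = "e - e^2/2 + e^3/2"
  have e2: "e^2 \<le> e" using assms mult_left_mono[of e 1 e] by (simp add: power2_eq_square)
  have y0: "0 \<le> ?y" using e2 assms by (simp add: zero_le_power)
  have "1 + e \<le> 1 + ?y + ?y^2/2"
  proof -
    have "?y + ?y^2/2 - e = e^4 * (5/8 - e/4 + e^2/8)" by (simp add: power2_eq_square numeral_eq_Suc field_simps)
    also have "\<dots> \<ge> 0" using assms by (intro mult_nonneg_nonneg) (auto simp: add_nonneg_nonneg)
    finally show ?thesis by simp
  qed
  also have "\<dots> \<le> exp ?y" using exp_lower_Taylor_quadratic[OF y0] by simp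
  finally have "ln (1 + e) \<le> ln (exp ?y)" using assms by (subst ln_le_cancel_iff) auto
  then show ?thesis by simp
qed

lemma exp_minus_quadratic: fixes z :: real assumes "0 \<le> z" shows "exp (-z) \<le> 1 - z + z^2/2"
proof -
  have pos: "0 < 1 - z + z^2/2"
  proof -
    have eq: "1 - z + z^2/2 = ((z - 1)^2 + 1) / 2" by (simp add: power2_eq_square field_simps)
    show ?thesis unfolding eq by (intro divide_pos_pos add_nonneg_pos) auto
  qed
  have "1 \<le> 1 + z^4/4" by simp
  also have "\<dots> = (1 + z + z^2/2) * (1 - z + z^2/2)" by (simp add: power2_eq_square numeral_eq_Suc field_simps)
  also have "\<dots> \<le> exp z * (1 - z + z^2/2)"
    using exp_lower_Taylor_quadratic[OF assms] pos by (intro mult_right_mono) auto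
  finally show ?thesis by (simp add: exp_minus field_simps)
qed

lemma ln_one_minus_ge: fixes f :: real assumes "0 \<le> f" "f \<le> 1/10" shows "- (f + f^2/2 + f^3) \<le> ln (1 - f)"
proof -
  let ?z = "f + f^2/2 + f^3"
  have "exp (- ?z) \<le> 1 - ?z + ?z^2/2" using assms by (intro exp_minus_quadratic) auto
  also have "\<dots> = 1 - f + f^3 * (-1/2 + 9/8 * f + f^2/2 + f^3/2)" by (simp add: power2_eq_square numeral_eq_Suc field_simps)
  also have "\<dots> \<le> 1 - f"
  proof -
    have "f^2 \<le> (1/10)^2" "f^3 \<le> (1/10)^3" using assms by (auto intro!: power_mono)
    then have "-1/2 + 9/8 * f + f^2/2 + f^3/2 \<le> 0" using assms by (simp add: power2_eq_square numeral_eq_Suc)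
    then have "f^3 * (-1/2 + 9/8 * f + f^2/2 + f^3/2) \<le> 0" using assms by (intro mult_nonneg_nonpos) auto
    then show ?thesis by simp
  qed
  finally show ?thesis using assms by (subst ln_ge_iff) auto
qed

text \<open>With the exponential parameter equal to the deviation \<open>\<tau>\<close>, the
  inequality \<open>exp (-z) \<le> 1 - z + z^2 / 2\<close> already gives a sub-Gaussian rate for
  independent variables with values between \<open>0\<close> and \<open>1\<close>.\<close>

lemma pex_lower_tail:
  fixes \<mu> \<tau> :: real and Y :: "'b \<Rightarrow> 'e set \<Rightarrow> real"
  assumes E: "finite E" "0 \<le> p" "p \<le> 1" and J: "finite J" "disjoint_family_on B J"
    and Y: "\<And>i F. i \<in> J \<Longrightarrow> F \<subseteq> E \<Longrightarrow> Y i F = Y i (F \<inter> B i)"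
      "\<And>i F. i \<in> J \<Longrightarrow> 0 \<le> Y i F" "\<And>i F. i \<in> J \<Longrightarrow> Y i F \<le> 1"
    and mean: "\<And>i. i \<in> J \<Longrightarrow> \<mu> \<le> pex p E (Y i)" and \<tau>: "0 \<le> \<tau>"
  shows "pex p E (\<lambda>F. of_bool ((\<Sum>i\<in>J. Y i F) < card J * (\<mu> - \<tau>))) \<le> exp (- (card J * \<tau>^2 / 2))"
proof -
  have "pex p E (\<lambda>F. of_bool ((\<Sum>i\<in>J. Y i F) < card J * (\<mu> - \<tau>)))
    \<le> pex p E (\<lambda>F. exp (\<tau> * (card J * (\<mu> - \<tau>))) * (\<Prod>i\<in>J. exp (- \<tau> * Y i F)))"
  proof (rule pex_mono[OF E(2,3)])
    fix F
    have "exp (\<tau> * (card J * (\<mu> - \<tau>))) * (\<Prod>i\<in>J. exp (- \<tau> * Y i F)) = exp (\<tau> * (card J * (\<mu> - \<tau>) - (\<Sum>i\<in>J. Y i F)))"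
      using J(1) by (simp add: exp_sum[symmetric] exp_add[symmetric] sum_distrib_left sum_negf algebra_simps)
    then show "of_bool ((\<Sum>i\<in>J. Y i F) < card J * (\<mu> - \<tau>)) \<le> exp (\<tau> * (card J * (\<mu> - \<tau>))) * (\<Prod>i\<in>J. exp (- \<tau> * Y i F))"
      using \<tau> by auto
  qed
  also have "\<dots> = exp (\<tau> * (card J * (\<mu> - \<tau>))) * (\<Prod>i\<in>J. pex p E (\<lambda>F. exp (- \<tau> * Y i F)))"
    unfolding pex_cmult using Y(1) by (subst pex_prod[OF E(1) J]) auto
  also have "\<dots> \<le> exp (\<tau> * (card J * (\<mu> - \<tau>))) * (\<Prod>i\<in>J. exp (- \<tau> * \<mu> + \<tau>^2/2))"
  proof (intro mult_left_mono prod_mono conjI)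
    fix i assume i: "i \<in> J"
    show "0 \<le> pex p E (\<lambda>F. exp (- \<tau> * Y i F))" using E by (intro pex_nonneg) auto
    have "pex p E (\<lambda>F. exp (- \<tau> * Y i F)) \<le> pex p E (\<lambda>F. (1 + \<tau>^2/2) + (- \<tau>) * Y i F)"
    proof (rule pex_mono[OF E(2,3)])
      fix F
      have y: "0 \<le> Y i F" "Y i F \<le> 1" using Y(2,3) i by auto
      have "exp (- (\<tau> * Y i F)) \<le> 1 - \<tau> * Y i F + (\<tau> * Y i F)^2/2" using \<tau> y by (intro exp_minus_quadratic) auto
      also have "(\<tau> * Y i F)^2 \<le> \<tau>^2" using y \<tau> by (intro power_mono mult_left_le) auto
      finally show "exp (- \<tau> * Y i F) \<le> (1 + \<tau>^2/2) + (- \<tau>) * Y i F" by simp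
    qed
    also have "\<dots> = 1 + \<tau>^2/2 - \<tau> * pex p E (Y i)"
      by (simp only: pex_add pex_cmult pex_const[OF E(1)])
    also have "\<dots> \<le> 1 + (- \<tau> * \<mu> + \<tau>^2/2)" using mean[OF i] \<tau> mult_left_mono[of \<mu> "pex p E (Y i)" \<tau>] by simp
    also have "\<dots> \<le> exp (- \<tau> * \<mu> + \<tau>^2/2)" by (rule exp_ge_add_one_self)
    finally show "pex p E (\<lambda>F. exp (- \<tau> * Y i F)) \<le> exp (- \<tau> * \<mu> + \<tau>^2/2)" .
  qed auto
  also have "\<dots> = exp (\<tau> * (card J * (\<mu> - \<tau>)) + card J * (- \<tau> * \<mu> + \<tau>^2/2))"
    by (simp add: exp_add[symmetric] exp_of_nat_mult[symmetric])
  also have "\<tau> * (card J * (\<mu> - \<tau>)) + card J * (- \<tau> * \<mu> + \<tau>^2/2) = - (card J * \<tau>^2 / 2)"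
    by (simp add: power2_eq_square field_simps)
  finally show ?thesis .
qed

lemma pex_union_bound:
  assumes "0 \<le> p" "p \<le> 1" "finite I" "\<And>F. F \<subseteq> E \<Longrightarrow> Q F \<Longrightarrow> \<exists>i\<in>I. R i F"
  shows "pex p E (\<lambda>F. of_bool (Q F)) \<le> (\<Sum>i\<in>I. pex p E (\<lambda>F. of_bool (R i F)))"
proof -
  have "pex p E (\<lambda>F. of_bool (Q F)) \<le> pex p E (\<lambda>F. \<Sum>i\<in>I. of_bool (R i F))"
  proof (rule pex_mono[OF assms(1,2)])
    fix F assume F: "F \<subseteq> E"
    show "of_bool (Q F) \<le> (\<Sum>i\<in>I. of_bool (R i F) :: real)"
    proof (cases "Q F")
      case True
      then obtain i where "i \<in> I" "R i F" using assms(4) F by blast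
      then show ?thesis using member_le_sum[of i I "\<lambda>i. of_bool (R i F) :: real"] assms(3) True by simp
    qed (simp add: sum_nonneg)
  qed
  then show ?thesis by (simp add: pex_sum)
qed

context regular_host
begin

definition edges_at :: "'v set \<Rightarrow> 'v \<Rightarrow> 'v set set" where "edges_at S v = {e\<in>bd E S. v \<in> e}"

text \<open>A boundary edge has one endpoint on either side, so it can be filed under its inner or
  its outer endpoint. The choice \<open>N = V - S\<close> counts the vertex boundary for (a);
  \<open>N = S\<close> counts the inner vertices with a leaving edge, as the pieces of a set in (b)
  require.\<close>

lemma edges_at_partition:
  assumes "S \<subseteq> V" "N = S \<or> N = V - S"
  shows "finite N" "disjoint_family_on (edges_at S) N" "(\<Union>v\<in>N. edges_at S v) = bd E S" "\<And>v. v \<in> N \<Longrightarrow> card (edges_at S v) \<le> d"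
proof -
  have fS: "finite S" using assms finV finite_subset by blast
  show "finite N" using assms fS finV by auto
  have one: "\<exists>x\<in>N. x \<in> e \<and> (\<forall>y\<in>N. y \<in> e \<longrightarrow> y = x)" if e: "e \<in> bd E S" for e
  proof -
    obtain x y where "x \<in> S" "y \<notin> S" "e = {x,y}" "e \<in> E" using e bd_iff[OF order_refl] by blast
    then show ?thesis using assms edge_V[of x y] by auto
  qed
  show "disjoint_family_on (edges_at S) N" unfolding disjoint_family_on_def edges_at_def using one by blast
  show "(\<Union>v\<in>N. edges_at S v) = bd E S" using one by (auto simp: edges_at_def)
  fix v assume "v \<in> N"
  then have v: "v \<in> V" using assms by auto
  have "card (edges_at S v) \<le> card {e\<in>E. v \<in> e}" using finE bd_sub by (intro card_mono) (auto simp: edges_at_def bd_def)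
  then show "card (edges_at S v) \<le> d" using degE[OF v] by simp
qed

text \<open>Comparison with density \<open>1 / d\<close>. Passing to it costs
  \<open>(1 + \<epsilon>) ^ card S\<close>, about
  \<open>exp ((\<epsilon> - \<epsilon>^2 / 2) * card S)\<close>, while the boundary of about
  \<open>d * card S\<close> edges is required closed at a density larger by about
  \<open>\<epsilon> / d\<close>, which gains \<open>exp (- \<epsilon> * card S)\<close>. The
  second-order term is the profit; the allowance for hit vertices and the losses of order
  \<open>\<epsilon>^3\<close> leave \<open>\<epsilon>^2 / 4\<close> of it.\<close>

lemma expansion_weight:
  fixes p p1 \<epsilon> c \<kappa> :: real
  assumes eps: "0 < \<epsilon>" "\<epsilon> \<le> 1/100" and d: "1 / d \<le> \<epsilon>^3" "2 \<le> d"
    and p: "p = (1 + \<epsilon>) / d" and p1: "(1 + \<epsilon> - \<epsilon>^3) / d \<le> p1"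
    and c: "c * (- ln (\<epsilon>^3)) \<le> \<epsilon>^2 / 20" "0 \<le> c"
    and \<kappa>: "0 \<le> \<kappa>" "\<kappa> \<le> \<epsilon>^3" and S: "finite S" "S \<noteq> {}" "(1 - \<kappa>) * d * card S \<le> card (bd E S)"
  shows "pconn p S * ((\<epsilon>^3) powr (- (c * card S)) * exp (- p1 * (1 - 8 * \<epsilon>^3) * card (bd E S)))
    \<le> exp (- (\<epsilon>^2 / 4 * card S)) * (pconn (1/d) S * (1 - 1/d) ^ card (bd E S))"
proof -
  let ?x = "\<epsilon>^3" and ?k = "card S" and ?b = "card (bd E S)" and ?d = "real d"
  have d0: "?d > 0" using d by simp
  have e3: "\<epsilon>^3 \<le> \<epsilon> / 10000" "0 < \<epsilon>^3"
  proof -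
    have "\<epsilon>^2 \<le> (1/100)^2" using eps by (intro power_mono) auto
    then have "\<epsilon> * \<epsilon>^2 \<le> \<epsilon> * (1/10000)" using eps by (intro mult_left_mono) (auto simp: power2_eq_square)
    then show "\<epsilon>^3 \<le> \<epsilon> / 10000" by (simp add: numeral_eq_Suc)
  qed (use eps in simp)
  have pb: "1/?d \<le> p" "p \<le> 1"
  proof -
    show "1/?d \<le> p" unfolding p using eps d0 by (intro divide_right_mono) auto
    have "(1 + \<epsilon>) \<le> ?d" using eps d by simp
    then show "p \<le> 1" unfolding p using d0 by simp
  qed
  have "pconn p S \<le> (p / (1/?d)) ^ (?k - 1) * pconn (1/?d) S" using pb d0 S by (intro pconn_le) auto
  also have "p / (1/?d) = 1 + \<epsilon>" using d0 by (simp add: p)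
  finally have 1: "pconn p S \<le> (1 + \<epsilon>) ^ ?k * pconn (1/?d) S"
  proof -
    assume a: "pconn p S \<le> (1 + \<epsilon>) ^ (?k - 1) * pconn (1/?d) S"
    have "(1 + \<epsilon>) ^ (?k - 1) \<le> (1 + \<epsilon>) ^ ?k" using eps by (intro power_increasing) auto
    then have "(1 + \<epsilon>) ^ (?k - 1) * pconn (1/?d) S \<le> (1 + \<epsilon>) ^ ?k * pconn (1/?d) S"
      using pconn_nonneg[of "1/?d" S] d0 d by (intro mult_right_mono) auto
    then show ?thesis using a by linarith
  qed
  have 2: "exp (- (1/?d + 2 * (1/?d)^2) * ?b) \<le> (1 - 1/?d) ^ ?b"
  proof -
    have "- (1/?d) - 2 * (1/?d)^2 \<le> ln (1 - 1/?d)" using d0 d by (intro ln_one_minus_pos_lower_bound) (auto simp: field_simps)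
    then have "exp (- (1/?d) - 2 * (1/?d)^2) \<le> 1 - 1/?d" using d by (subst ln_ge_iff[symmetric]) auto
    then have "exp (- (1/?d) - 2 * (1/?d)^2) ^ ?b \<le> (1 - 1/?d) ^ ?b" by (intro power_mono) auto
    then show ?thesis by (simp add: exp_of_nat_mult[symmetric] algebra_simps)
  qed
  \<comment> \<open>\<open>y\<close> is the excess in the exponent per boundary edge over density
    \<open>1 / d\<close>. In units of \<open>\<epsilon>^3\<close>, the \<open>11.1\<close> collects
    \<open>1\<close> from the density given to the second round, \<open>8 * (1 + \<epsilon>)\<close>
    from the weight \<open>x\<close>, and \<open>2\<close> from \<open>ln (1 - 1/d)\<close>;
    \<open>\<kappa>\<close> raises it to \<open>11.2\<close>.\<close>
  define y where "y = p1 * (1 - 8 * ?x) - (1/?d + 2 * (1/?d)^2)"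
  have yd: "\<epsilon> - 11.1 * ?x \<le> y * ?d"
  proof -
    have "1 + \<epsilon> - ?x \<le> p1 * ?d" using p1 d0 by (simp add: field_simps)
    then have "(1 + \<epsilon> - ?x) * (1 - 8 * ?x) \<le> p1 * ?d * (1 - 8 * ?x)" using e3 eps by (intro mult_right_mono) auto
    moreover have "(1 + \<epsilon> - ?x) * (1 - 8 * ?x) \<ge> 1 + \<epsilon> - ?x - 8 * (1 + \<epsilon>) * ?x"
      using e3 by (simp add: algebra_simps)
    moreover have "8 * (1 + \<epsilon>) * ?x \<le> (202/25) * ?x" using eps e3 by (intro mult_right_mono) auto
    moreover have "(1/?d + 2 * (1/?d)^2) * ?d = 1 + 2/?d" using d0 by (simp add: power2_eq_square field_simps)
    moreover have "y * ?d = p1 * ?d * (1 - 8 * ?x) - (1/?d + 2 * (1/?d)^2) * ?d"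
      unfolding y_def left_diff_distrib by (simp add: mult.commute mult.left_commute)
    moreover have "2 / ?d = 2 * (1 / ?d)" by simp
    ultimately show ?thesis using d(1) e3(2) by linarith
  qed
  have y0: "0 \<le> y"
  proof -
    have "0 \<le> y * ?d" using yd e3 eps by linarith
    then show ?thesis using d0 by (simp add: zero_le_mult_iff)
  qed
  have "(\<epsilon> - 11.2 * ?x) * ?k \<le> y * ?b"
  proof -
    have yk: "y * ((1 - \<kappa>) * ?d * ?k) \<le> y * ?b" using S(3) y0 by (intro mult_left_mono)
    have "(\<epsilon> - 11.1 * ?x) * (1 - \<kappa>) \<le> y * ?d * (1 - \<kappa>)" using yd \<kappa> e3 eps by (intro mult_right_mono) auto
    moreover have "(\<epsilon> - 11.1 * ?x) * (1 - \<kappa>) \<ge> \<epsilon> - 11.1 * ?x - \<epsilon> * \<kappa>"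
      using \<kappa> e3 by (simp add: algebra_simps)
    moreover have "\<epsilon> * \<kappa> \<le> 0.1 * ?x" using \<kappa> eps e3 mult_mono[of \<epsilon> "0.1" \<kappa> ?x] by auto
    ultimately have "\<epsilon> - 11.2 * ?x \<le> y * ?d * (1 - \<kappa>)" by linarith
    then have "(\<epsilon> - 11.2 * ?x) * ?k \<le> y * ?d * (1 - \<kappa>) * ?k" by (intro mult_right_mono) auto
    then show ?thesis using yk by (simp add: algebra_simps)
  qed
  then have 3: "exp (- y * ?b) \<le> exp (- (\<epsilon> - 11.2 * ?x) * ?k)"
    unfolding exp_le_cancel_iff mult_minus_left by (rule le_imp_neg_le)
  have 4: "?x powr (- (c * ?k)) \<le> exp (\<epsilon>^2 / 20 * ?k)"
  proof -
    have "?x powr (- (c * ?k)) = exp (c * (- ln ?x) * ?k)" using eps by (simp add: powr_def algebra_simps)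
    then show ?thesis using mult_right_mono[OF c(1), of "real ?k"] by simp
  qed
  have 5: "(1 + \<epsilon>) ^ ?k \<le> exp ((\<epsilon> - \<epsilon>^2/2 + ?x/2) * ?k)"
  proof -
    have "exp (ln (1 + \<epsilon>)) \<le> exp (\<epsilon> - \<epsilon>^2/2 + ?x/2)"
      unfolding exp_le_cancel_iff by (rule ln_one_plus_le) (use eps in auto)
    then have "1 + \<epsilon> \<le> exp (\<epsilon> - \<epsilon>^2/2 + ?x/2)" using eps by simp
    then have "(1 + \<epsilon>) ^ ?k \<le> exp (\<epsilon> - \<epsilon>^2/2 + ?x/2) ^ ?k" using eps by (intro power_mono) auto
    then show ?thesis by (simp add: exp_of_nat_mult[symmetric] mult.commute)
  qed
  have pc0: "0 \<le> pconn (1/?d) S" using d d0 by (intro pconn_nonneg) auto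
  have split: "exp (- p1 * (1 - 8 * ?x) * ?b) = exp (- y * ?b) * exp (- (1/?d + 2 * (1/?d)^2) * ?b)"
    unfolding y_def by (simp add: exp_add[symmetric] algebra_simps)
  have "pconn p S * (?x powr (- (c * ?k)) * exp (- p1 * (1 - 8 * ?x) * ?b))
    \<le> (exp ((\<epsilon> - \<epsilon>^2/2 + ?x/2) * ?k) * pconn (1/?d) S) *
      (exp (\<epsilon>^2 / 20 * ?k) * (exp (- (\<epsilon> - 11.2 * ?x) * ?k) * (1 - 1/?d) ^ ?b))"
    unfolding split
  proof (intro mult_mono)
    show "pconn p S \<le> exp ((\<epsilon> - \<epsilon>^2/2 + ?x/2) * ?k) * pconn (1/?d) S"
      using 1 mult_right_mono[OF 5 pc0] by linarith
  qed (use 2 3 4 pc0 d in auto)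
  also have "\<dots> = exp (((\<epsilon> - \<epsilon>^2/2 + ?x/2) + \<epsilon>^2 / 20 - (\<epsilon> - 11.2 * ?x)) * ?k) * (pconn (1/?d) S * (1 - 1/?d) ^ ?b)"
    by (simp add: exp_add[symmetric] algebra_simps)
  also have "\<dots> \<le> exp (- (\<epsilon>^2 / 4 * ?k)) * (pconn (1/?d) S * (1 - 1/?d) ^ ?b)"
  proof (rule mult_right_mono)
    have "?x \<le> \<epsilon>^2 / 100" using eps mult_right_mono[of \<epsilon> "1/100" "\<epsilon>^2"] by (simp add: numeral_eq_Suc)
    then have "(\<epsilon> - \<epsilon>^2/2 + ?x/2) + \<epsilon>^2 / 20 - (\<epsilon> - 11.2 * ?x) \<le> - (\<epsilon>^2 / 4)" using zero_le_power2[of \<epsilon>] by linarith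
    then have "((\<epsilon> - \<epsilon>^2/2 + ?x/2) + \<epsilon>^2 / 20 - (\<epsilon> - 11.2 * ?x)) * ?k \<le> - (\<epsilon>^2 / 4) * ?k"
      by (intro mult_right_mono) auto
    then show "exp (((\<epsilon> - \<epsilon>^2/2 + ?x/2) + \<epsilon>^2 / 20 - (\<epsilon> - 11.2 * ?x)) * ?k) \<le> exp (- (\<epsilon>^2 / 4 * ?k))" by simp
  qed (use pc0 d in auto)
  finally show ?thesis .
qed

lemma expansion_prob:
  fixes p p1 p2 \<epsilon> c \<kappa> k0 K :: real
  assumes eps: "0 < \<epsilon>" "\<epsilon> \<le> 1/100" and d: "1 / d \<le> \<epsilon>^3" "2 \<le> d"
    and p: "p = (1 + \<epsilon>) / d" and p1: "(1 + \<epsilon> - \<epsilon>^3) / d \<le> p1" "p1 \<le> p"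
    and rounds: "1 - p = (1 - p1) * (1 - p2)" "0 \<le> p2" "p2 \<le> 1"
    and c: "c * (- ln (\<epsilon>^3)) \<le> \<epsilon>^2 / 20" "0 \<le> c"
    and \<kappa>: "0 \<le> \<kappa>" "\<kappa> \<le> \<epsilon>^3"
    and iso: "\<And>S. S \<subseteq> V \<Longrightarrow> S \<noteq> {} \<Longrightarrow> card S \<le> K \<Longrightarrow> (1 - \<kappa>) * d * card S \<le> card (bd E S)"
    and N: "\<And>S. N S = S \<or> N S = V - S"
  shows "pex p1 E (\<lambda>F1. pex p2 E (\<lambda>F2. of_bool (\<exists>S\<subseteq>V. conn (F1 \<union> F2) S \<and> k0 \<le> card S \<and> card S \<le> K \<and>
      card {v\<in>N S. F1 \<inter> edges_at S v \<noteq> {}} < c * card S)))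
     \<le> card V * exp (- (\<epsilon>^2 / 4 * k0))"
proof -
  have d0: "real d > 0" using d by simp
  have pb: "0 \<le> p1" "p1 \<le> 1" "p1 * d \<le> 2" "0 \<le> p" "p \<le> 1"
  proof -
    have "\<epsilon>^3 \<le> 1" using eps by (intro power_le_one) auto
    then have "0 \<le> (1 + \<epsilon> - \<epsilon>^3) / d" using eps by simp
    then show "0 \<le> p1" using p1 by linarith
    then show "0 \<le> p" using p1 by linarith
    have "p * d \<le> 2" using eps d0 by (simp add: p)
    then show "p1 * d \<le> 2" using p1 d0 mult_right_mono[of p1 p "real d"] by linarith
    have "(1 + \<epsilon>) \<le> real d" using eps d by simp
    then show "p \<le> 1" unfolding p using d0 by simp
    then show "p1 \<le> 1" using p1 by linarith
  qed
  have x: "0 < \<epsilon>^3" "\<epsilon>^3 \<le> 1" using eps by (auto intro: power_le_one)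
  define fam where "fam v = {S. S \<subseteq> V \<and> v \<in> S \<and> k0 \<le> card S \<and> card S \<le> K}" for v
  have ff: "finite (fam v)" for v using finV by (auto simp: fam_def)
  let ?ev = "\<lambda>S F1 F2. conn (F1 \<union> F2) S \<and> real (card {v\<in>N S. F1 \<inter> edges_at S v \<noteq> {}}) < c * card S"
  have "pex p1 E (\<lambda>F1. pex p2 E (\<lambda>F2. of_bool (\<exists>S\<subseteq>V. conn (F1 \<union> F2) S \<and> k0 \<le> card S \<and> card S \<le> K \<and>
      card {v\<in>N S. F1 \<inter> edges_at S v \<noteq> {}} < c * card S)))
    \<le> pex p1 E (\<lambda>F1. \<Sum>vS\<in>Sigma V fam. pex p2 E (\<lambda>F2. of_bool (?ev (snd vS) F1 F2)))"
  proof (intro pex_mono[OF pb(1,2)] pex_union_bound[OF rounds(2,3)])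
    fix F1 F2 assume "\<exists>S\<subseteq>V. conn (F1 \<union> F2) S \<and> k0 \<le> card S \<and> card S \<le> K \<and>
      card {v\<in>N S. F1 \<inter> edges_at S v \<noteq> {}} < c * card S"
    then obtain S where S: "S \<subseteq> V" "k0 \<le> card S" "card S \<le> K" "?ev S F1 F2" by blast
    then obtain v where "v \<in> S" by (auto simp: conn_def)
    then show "\<exists>vS\<in>Sigma V fam. ?ev (snd vS) F1 F2" using S by (intro bexI[of _ "(v,S)"]) (auto simp: fam_def)
  qed (use finV ff in auto)
  also have "\<dots> = (\<Sum>v\<in>V. \<Sum>S\<in>fam v. pex p1 E (\<lambda>F1. pex p2 E (\<lambda>F2. of_bool (?ev S F1 F2))))"
    using finV ff by (subst pex_sum, subst sum.Sigma) (auto simp: split_def)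
  also have "\<dots> \<le> (\<Sum>v\<in>V. \<Sum>S\<in>fam v. exp (- (\<epsilon>^2 / 4 * k0)) * (pconn (1/d) S * (1 - 1/d) ^ card (bd E S)))"
  proof (intro sum_mono)
    fix v S assume S: "S \<in> fam v"
    then have SV: "S \<subseteq> V" "S \<noteq> {}" "k0 \<le> card S" "card S \<le> K" by (auto simp: fam_def)
    have fS: "finite S" using SV finV finite_subset by blast
    note bp = edges_at_partition[OF SV(1) N]
    have "pex p1 E (\<lambda>F1. pex p2 E (\<lambda>F2. of_bool (?ev S F1 F2)))
      \<le> pconn p S * ((\<epsilon>^3) powr (- (c * card S)) * exp (- p1 * (1 - 8 * \<epsilon>^3) * card (bd E S)))"
      by (rule conn_hit_prob[OF pb(1-3) x rounds(1) bp pb(4,5)])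
    also have "\<dots> \<le> exp (- (\<epsilon>^2 / 4 * card S)) * (pconn (1/d) S * (1 - 1/d) ^ card (bd E S))"
      by (rule expansion_weight[OF eps d p p1(1) c \<kappa> fS SV(2) iso[OF SV(1,2,4)]])
    also have "\<dots> \<le> exp (- (\<epsilon>^2 / 4 * k0)) * (pconn (1/d) S * (1 - 1/d) ^ card (bd E S))"
      using SV(3) d d0 by (intro mult_right_mono mult_nonneg_nonneg pconn_nonneg) (auto intro!: mult_left_mono)
    finally show "pex p1 E (\<lambda>F1. pex p2 E (\<lambda>F2. of_bool (?ev S F1 F2)))
      \<le> exp (- (\<epsilon>^2 / 4 * k0)) * (pconn (1/d) S * (1 - 1/d) ^ card (bd E S))" .
  qed
  also have "\<dots> \<le> (\<Sum>v\<in>V. exp (- (\<epsilon>^2 / 4 * k0)) * 1)"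
    unfolding sum_distrib_left[symmetric]
  proof (intro mult_left_mono sum_mono)
    fix v
    show "(\<Sum>S\<in>fam v. pconn (1/d) S * (1 - 1/d) ^ card (bd E S)) \<le> 1"
      using d d0 ff by (intro animal_sum[of "1/real d"]) (auto simp: fam_def)
  qed auto
  finally show ?thesis by simp
qed

text \<open>Duality with the smaller density \<open>p'\<close>, at which the weights of connected
  closed sets add up to at most \<open>1\<close>. Going from \<open>p'\<close> to \<open>p\<close>
  multiplies the weight of \<open>S\<close> by at most \<open>(p / p') ^ (card S - 1)\<close> and by
  the gain from closing the boundary at the larger density; \<open>cond\<close> says that the gain
  outweighs one factor \<open>p / p'\<close> per vertex. The exponent \<open>card S - 1\<close>
  leaves \<open>p' / p\<close> over.\<close>

lemma small_cluster_prob: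
  fixes p p' \<kappa> :: real
  assumes p: "0 < p'" "p' \<le> p" "p \<le> 1" "p' < 1" and v: "v \<in> V"
    and iso: "\<And>S. S \<subseteq> V \<Longrightarrow> S \<noteq> {} \<Longrightarrow> card S < m \<Longrightarrow> (1 - \<kappa>) * d * card S \<le> card (bd E S)"
    and cond: "p / p' * exp (- (p - p') * ((1 - \<kappa>) * d)) \<le> 1"
  shows "pex p E (\<lambda>F. of_bool (card (cluster F V v) < m)) \<le> p' / p"
proof -
  define fam where "fam = {S. S \<subseteq> V \<and> v \<in> S \<and> card S < m}"
  have ff: "finite fam" using finV by (auto simp: fam_def)
  have "pex p E (\<lambda>F. of_bool (card (cluster F V v) < m)) \<le> (\<Sum>S\<in>fam. pex p E (\<lambda>F. of_bool (conn F S \<and> F \<inter> bd E S = {})))"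
  proof (rule pex_union_bound[OF _ p(3) ff])
    fix F assume F: "F \<subseteq> E" "card (cluster F V v) < m"
    let ?S = "cluster F V v"
    have SV: "?S \<subseteq> V" using cluster_subset[OF v] .
    have "F \<inter> bd E ?S = {}"
    proof (rule ccontr)
      assume "F \<inter> bd E ?S \<noteq> {}"
      then obtain e where e: "e \<in> F" "e \<in> bd E ?S" by blast
      then obtain x y where xy: "x \<in> ?S" "y \<notin> ?S" "e = {x,y}" using bd_iff[OF order_refl] by blast
      then have "x \<in> V" "y \<in> V" using edge_V e F by blast+
      then show False using cluster_step[of x F V v y] xy e by blast
    qed
    then show "\<exists>S\<in>fam. conn F S \<and> F \<inter> bd E S = {}"
      using F SV conn_cluster[OF v, of F] by (intro bexI[of _ ?S]) (auto simp: fam_def)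
  qed (use p in auto)
  also have "\<dots> \<le> (\<Sum>S\<in>fam. p' / p * (pconn p' S * (1 - p') ^ card (bd E S)))"
  proof (rule sum_mono)
    fix S assume S: "S \<in> fam"
    then have SV: "S \<subseteq> V" "S \<noteq> {}" "card S < m" by (auto simp: fam_def)
    have fS: "finite S" using SV finV finite_subset by blast
    let ?k = "card S" and ?b = "card (bd E S)"
    have k: "?k > 0" using SV fS by (simp add: card_gt_0_iff)
    have pc: "0 \<le> pconn p' S" using p by (intro pconn_nonneg) auto
    have "(1 - p) \<le> exp (- (p - p')) * (1 - p')"
    proof -
      have "1 - p = (1 - (p - p') / (1 - p')) * (1 - p')" using p by (simp add: field_simps)
      also have "\<dots> \<le> exp (- ((p - p') / (1 - p'))) * (1 - p')"
        using p exp_ge_add_one_self[of "- ((p - p') / (1 - p'))"] by (intro mult_right_mono) auto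
      also have "\<dots> \<le> exp (- (p - p')) * (1 - p')"
      proof -
        have "p - p' \<le> (p - p') / (1 - p')" using p mult_left_mono[of "1 - p'" 1 "p - p'"] by (simp add: pos_le_divide_eq)
        then show ?thesis using p by (intro mult_right_mono) auto
      qed
      finally show ?thesis .
    qed
    then have "(1 - p) ^ ?b \<le> (exp (- (p - p')) * (1 - p')) ^ ?b" using p by (intro power_mono) auto
    also have "\<dots> = exp (- (p - p') * ?b) * (1 - p') ^ ?b"
      by (simp only: power_mult_distrib exp_of_nat_mult[symmetric]) (simp add: mult.commute)
    also have "\<dots> \<le> exp (- (p - p') * ((1 - \<kappa>) * d * ?k)) * (1 - p') ^ ?b"
    proof (rule mult_right_mono)
      have "(p - p') * ((1 - \<kappa>) * d * ?k) \<le> (p - p') * ?b" using iso[OF SV] p by (intro mult_left_mono) auto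
      then show "exp (- (p - p') * ?b) \<le> exp (- (p - p') * ((1 - \<kappa>) * d * ?k))"
        unfolding exp_le_cancel_iff mult_minus_left by (rule le_imp_neg_le)
    qed (use p in auto)
    finally have 1: "(1 - p) ^ ?b \<le> exp (- (p - p') * ((1 - \<kappa>) * d * ?k)) * (1 - p') ^ ?b" .
    have "pex p E (\<lambda>F. of_bool (conn F S \<and> F \<inter> bd E S = {})) = pconn p S * (1 - p) ^ ?b" by (rule pconn_closed)
    also have "\<dots> \<le> ((p / p') ^ (?k - 1) * pconn p' S) * (exp (- (p - p') * ((1 - \<kappa>) * d * ?k)) * (1 - p') ^ ?b)"
      using 1 p pc fS by (intro mult_mono pconn_le) auto
    also have "(p / p') ^ (?k - 1) = p' / p * (p / p') ^ ?k" using k p by (cases ?k) (auto simp: field_simps)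
    also have "p' / p * (p / p') ^ ?k * pconn p' S * (exp (- (p - p') * ((1 - \<kappa>) * d * ?k)) * (1 - p') ^ ?b)
      = p' / p * (p / p' * exp (- (p - p') * ((1 - \<kappa>) * d))) ^ ?k * (pconn p' S * (1 - p') ^ ?b)"
      by (simp only: power_mult_distrib exp_of_nat_mult[symmetric]) (simp add: mult_ac)
    also have "\<dots> \<le> p' / p * 1 * (pconn p' S * (1 - p') ^ ?b)"
      using cond p pc by (intro mult_right_mono mult_left_mono power_le_one mult_nonneg_nonneg) auto
    finally show "pex p E (\<lambda>F. of_bool (conn F S \<and> F \<inter> bd E S = {})) \<le> p' / p * (pconn p' S * (1 - p') ^ ?b)" by simp
  qed
  also have "\<dots> \<le> p' / p * 1" unfolding sum_distrib_left[symmetric]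
    using p ff by (intro mult_left_mono animal_sum) (auto simp: fam_def)
  finally show ?thesis by simp
qed

end

section \<open>The escape probability\<close>

lemma inverse_one_minus_power_le:
  fixes x :: real
  assumes "0 \<le> x" "x \<le> 1/2"
  shows "(1 / (1 - x)) ^ N \<le> exp (2 * x * N)"
proof -
  have "- 2 * x \<le> - x - 2 * x^2" using assms mult_left_mono[of x "1/2" x] by (simp add: power2_eq_square)
  also have "\<dots> \<le> ln (1 - x)" using assms by (rule ln_one_minus_pos_lower_bound)
  finally have "exp (- 2 * x) \<le> 1 - x" using assms by (subst ln_ge_iff[symmetric]) auto
  then have "1 / (1 - x) \<le> exp (2 * x)" using assms by (simp add: exp_minus field_simps)
  then have "(1 / (1 - x)) ^ N \<le> exp (2 * x) ^ N" using assms by (intro power_mono) auto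
  then show ?thesis by (simp add: exp_of_nat_mult[symmetric] algebra_simps)
qed

context regular_host
begin

lemma code_mono: "code b F R W \<Longrightarrow> b \<le> b' \<Longrightarrow> code b' F R W"
  unfolding code_def by (meson order_trans)

text \<open>The conditions on \<open>\<Phi>\<close> are the three outcomes of
  \<open>walks_cases\<close>. Deleting at most \<open>b\<close> edges destroys at most
  \<open>5 * 2 * b * (2 * d) ^ 4 = 160 * b * d ^ 4\<close> walks: five positions, two directions,
  and \<open>2 * d\<close> choices for each of the other steps.\<close>

lemma path_prob_le:
  fixes q h \<Phi> :: real
  assumes q: "0 \<le> q" "q * d \<le> 1" "q \<le> 1" and WT: "W \<subseteq> V" "T \<subseteq> V" "W \<inter> T = {}"
    and D: "D \<subseteq> E" "card D \<le> b" and h: "0 \<le> h" "\<And>v. v \<in> V \<Longrightarrow> 2 * h \<le> walk2 (W \<union> T) v"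
    and \<Phi>: "\<Phi> \<le> d * h * (real d ^ 2 * card W / 2)" "\<Phi> \<le> d * h * (real d ^ 2 * card T / 2)"
      "\<And>A. A \<subseteq> V \<Longrightarrow> card W / 2 \<le> card A \<Longrightarrow> card A \<le> card V - card T / 2 \<Longrightarrow> \<Phi> \<le> h ^ 2 * card (bd E A)"
  shows "pex (1 - (1 - q) ^ 5) E (\<lambda>F. of_bool ((step (F - D) ^^ 5) W \<inter> T = {}))
    \<le> exp (- ((q / 4) ^ 5 * (\<Phi> - 160 * real b * real d ^ 4)))"
proof -
  let ?W = "indicator W :: 'v \<Rightarrow> real" and ?T = "indicator T :: 'v \<Rightarrow> real"
  have "\<Phi> \<le> ip (walk2 W) (adj (walk2 T)) + d * ip (walk2 W) (walk2 T)"
    using walks_cases[OF WT h] \<Phi> order_trans by blast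
  also have "\<dots> \<le> ip ?W ((op0 ^^ 5) ?T)" by (rule walks_ge)
  finally have 1: "\<Phi> \<le> ip ?W ((op0 ^^ 5) ?T)" .
  have i: "\<And>v. 0 \<le> ?W v" "\<And>v. ?W v \<le> 1" "\<And>v. 0 \<le> ?T v" "\<And>v. ?T v \<le> 1" by (auto simp: indicator_def)
  have "ip ?W ((op0 ^^ 5) ?T) - 5 * (2 * card D * (2 * real d) ^ 4 * 1 * 1) \<le> ip ?W ((opD D ^^ 5) ?T)"
    using ip_opD_pow[where f="?W" and g="?T" and a=1 and b=1 and D=D and j=4, OF i D(1)] by (simp add: numeral_eq_Suc)
  moreover have "5 * (2 * card D * (2 * real d) ^ 4 * 1 * 1) \<le> 160 * real b * real d ^ 4"
    using D(2) mult_right_mono[of "real (card D)" "real b" "real d ^ 4"] by (simp add: power_mult_distrib)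
  moreover have "ip ?W ((opD D ^^ 5) ?T) = (\<Sum>u\<in>W. (opD D ^^ 5) ?T u)"
  proof -
    have "V \<inter> W = W" using WT by blast
    then show ?thesis unfolding ip_def indicator_def of_bool_def
      using finV sum.inter_restrict[of V "(opD D ^^ 5) (\<lambda>x. if x \<in> T then 1 else 0)" W]
      by (simp add: if_distrib[of "\<lambda>x. x * _"] cong: if_cong)
  qed
  ultimately have "\<Phi> - 160 * real b * real d ^ 4 \<le> (\<Sum>u\<in>W. (opD D ^^ 5) ?T u)" using 1 by linarith
  then have "(q / 4) ^ 5 * (\<Phi> - 160 * real b * real d ^ 4) \<le> (q / 4) ^ 5 * (\<Sum>u\<in>W. (opD D ^^ 5) ?T u)"
    using q by (intro mult_left_mono) auto
  then show ?thesis using no_path_prob[OF q WT(1), of 5 D T] by (meson order_trans exp_le_cancel_iff neg_le_iff_le)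
qed

text \<open>The first round is fixed. The union runs not over \<open>S\<close> but over roots
  \<open>R\<close>, closure \<open>W\<close> and the set \<open>D\<close> of boundary edges near
  \<open>W\<close>. The factors on the right bound the number of root sets, the number of pairs
  \<open>(W, D)\<close> with given roots, and the probability that the second round avoids all
  paths. \<open>T0\<close> bounds from below the number of big vertices left outside
  \<open>W\<close>.\<close>

lemma escape_prob:
  fixes q h \<Phi> \<theta> a :: real
  assumes q: "0 \<le> q" "q * d \<le> 1" "q \<le> 1" and F1: "F1 \<subseteq> E" and m: "1 \<le> m" and n: "2 \<le> card V"
    and th: "0 < \<theta>" "\<theta> \<le> 1/2"
    and h: "0 \<le> h" "\<And>v. v \<in> V \<Longrightarrow> 2 * h \<le> walk2 (big m F1) v"
    and B: "k + T0 \<le> card (big m F1)"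
    and \<Phi>: "\<Phi> \<le> d * h * (real d ^ 2 * (a * k) / 2)" "\<Phi> \<le> d * h * (real d ^ 2 * T0 / 2)"
      "\<And>A. A \<subseteq> V \<Longrightarrow> a * k / 2 \<le> card A \<Longrightarrow> card A \<le> card V - T0 / 2 \<Longrightarrow> \<Phi> \<le> h ^ 2 * card (bd E A)"
  shows "pex (1 - (1 - q) ^ 5) E (\<lambda>F2. of_bool (\<exists>S\<subseteq>V. conn (F1 \<union> F2) S \<and> card S = k \<and>
      card (bd (F1 \<union> F2) S) \<le> b \<and> a * k \<le> card {v\<in>S. m \<le> card (cluster F1 S v)}))
    \<le> real (card V) ^ (k div m) * exp 2 * ((1 / \<theta>) ^ (3 * b) * exp (2 * \<theta> * (3 * k * Suc d ^ 6))) *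
       exp (- ((q / 4) ^ 5 * (\<Phi> - 160 * real b * real d ^ 4)))"
proof -
  let ?B = "big m F1" and ?p = "1 - (1 - q) ^ 5"
  have p: "0 \<le> ?p" "?p \<le> 1" using q by (auto intro: power_le_one)
  have BV: "?B \<subseteq> V" by (auto simp: big_def)
  define Rs where "Rs = {R. R \<subseteq> V \<and> card R * m \<le> k}"
  define P where "P R = {(W,D). W \<subseteq> ?B \<and> a * k \<le> card W \<and> card W \<le> k \<and> D \<subseteq> touch E (near W) \<and> card D \<le> b \<and> code b F1 R W}" for R
  have fRs: "finite Rs" using finV by (auto simp: Rs_def)
  have tE: "touch E X \<subseteq> E" for X by (auto simp: touch_def)
  have fP: "finite (P R)" for R
  proof (rule finite_subset)
    show "P R \<subseteq> Pow V \<times> Pow E" using tE BV by (fastforce simp: P_def)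
  qed (use finV finE in simp)
  let ?np = "\<lambda>W D F2. (step (F2 - D) ^^ 5) W \<inter> (?B - W) = {}"
  let ?X = "exp (- ((q / 4) ^ 5 * (\<Phi> - 160 * real b * real d ^ 4)))"
  let ?M = "(1 / \<theta>) ^ (3 * b) * exp (2 * \<theta> * (3 * k * Suc d ^ 6))"
  have "pex ?p E (\<lambda>F2. of_bool (\<exists>S\<subseteq>V. conn (F1 \<union> F2) S \<and> card S = k \<and>
      card (bd (F1 \<union> F2) S) \<le> b \<and> a * k \<le> card {v\<in>S. m \<le> card (cluster F1 S v)}))
    \<le> (\<Sum>RWD\<in>Sigma Rs P. pex ?p E (\<lambda>F2. of_bool (?np (fst (snd RWD)) (snd (snd RWD)) F2)))"
  proof (rule pex_union_bound[OF p])
    show "finite (Sigma Rs P)" using fRs fP by auto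
    fix F2 assume F2: "F2 \<subseteq> E" and "\<exists>S\<subseteq>V. conn (F1 \<union> F2) S \<and> card S = k \<and>
      card (bd (F1 \<union> F2) S) \<le> b \<and> a * k \<le> card {v\<in>S. m \<le> card (cluster F1 S v)}"
    then obtain S where S: "S \<subseteq> V" "card S = k" "card (bd (F1 \<union> F2) S) \<le> b" "a * k \<le> card {v\<in>S. m \<le> card (cluster F1 S v)}"
      by blast
    have FE: "F1 \<union> F2 \<subseteq> E" using F1 F2 by blast
    have fS: "finite S" using S finV finite_subset by blast
    obtain R W where RW: "R \<subseteq> V" "card R * m \<le> card S" "{v\<in>S. m \<le> card (cluster F1 S v)} \<subseteq> W" "W \<subseteq> S \<inter> ?B"
      "code (card (bd (F1 \<union> F2) S)) F1 R W"
      "\<forall>F'\<subseteq>F1 \<union> F2. (step (F' - bd (F1 \<union> F2) S \<inter> touch E (near W)) ^^ 5) W \<inter> (?B - W) = {}"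
      using cluster_closure[OF _ FE S(1), of F1 m] by auto
    let ?D = "bd (F1 \<union> F2) S \<inter> touch E (near W)"
    have fW: "finite W" using RW(4) fS finite_subset by blast
    have "card {v\<in>S. m \<le> card (cluster F1 S v)} \<le> card W" "card W \<le> k"
      using RW(3,4) fW fS S(2) by (auto intro!: card_mono)
    moreover have "card ?D \<le> b"
      using card_mono[OF fin_bd[OF FE], of ?D S] S(3) by auto
    ultimately have "(W, ?D) \<in> P R" using RW code_mono[OF RW(5) S(3)] S(4) by (auto simp: P_def)
    moreover have "R \<in> Rs" using RW S by (auto simp: Rs_def)
    moreover have "?np W ?D F2" using RW(6) by blast
    ultimately show "\<exists>RWD\<in>Sigma Rs P. ?np (fst (snd RWD)) (snd (snd RWD)) F2"
      by (intro bexI[of _ "(R, W, ?D)"]) auto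
  qed
  also have "\<dots> \<le> (\<Sum>RWD\<in>Sigma Rs P. ?X)"
  proof (rule sum_mono)
    fix RWD assume "RWD \<in> Sigma Rs P"
    then obtain R W D where eq: "RWD = (R, W, D)" and W: "W \<subseteq> ?B" "a * k \<le> card W" "card W \<le> k" "D \<subseteq> touch E (near W)" "card D \<le> b"
      by (cases RWD) (auto simp: P_def)
    have fB: "finite ?B" using BV finV finite_subset by blast
    have cT: "T0 \<le> card (?B - W)" using W B fB finite_subset[OF W(1) fB] by (simp add: card_Diff_subset)
    have WT: "W \<union> (?B - W) = ?B" using W by blast
    have "pex ?p E (\<lambda>F2. of_bool (?np W D F2)) \<le> ?X"
    proof (rule path_prob_le[OF q])
      show "W \<subseteq> V" "?B - W \<subseteq> V" "W \<inter> (?B - W) = {}" "D \<subseteq> E" "card D \<le> b"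
        using W BV order_trans[OF W(4) tE] by auto
      show "0 \<le> h" "\<And>v. v \<in> V \<Longrightarrow> 2 * h \<le> walk2 (W \<union> (?B - W)) v" using h WT by auto
      have dh: "0 \<le> d * h * (real d ^ 2 / 2)" using h by simp
      show "\<Phi> \<le> d * h * (real d ^ 2 * card W / 2)"
        using \<Phi>(1) mult_left_mono[OF W(2) dh] by (simp add: mult.assoc)
      have "real T0 \<le> real (card (?B - W))" using cT by simp
      from mult_left_mono[OF this dh] show "\<Phi> \<le> d * h * (real d ^ 2 * card (?B - W) / 2)"
        using \<Phi>(2) by (simp add: mult.assoc)
      fix A assume "A \<subseteq> V" "card W / 2 \<le> card A" "card A \<le> card V - card (?B - W) / 2"
      then show "\<Phi> \<le> h ^ 2 * card (bd E A)" using W(2) cT by (intro \<Phi>(3)) auto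
    qed
    then show "pex ?p E (\<lambda>F2. of_bool (?np (fst (snd RWD)) (snd (snd RWD)) F2)) \<le> ?X" using eq by simp
  qed
  also have "\<dots> = (\<Sum>R\<in>Rs. real (card (P R))) * ?X"
    using fRs fP by (simp add: card_SigmaI)
  also have "(\<Sum>R\<in>Rs. real (card (P R))) \<le> (\<Sum>R\<in>Rs. ?M)"
  proof (rule sum_mono)
    fix R
    have "real (card (P R)) \<le> (1 / \<theta>) ^ (3 * b) * (1 / (1 - \<theta>)) ^ (3 * k * Suc d ^ 6)"
      using BV th by (intro card_codes[OF F1]) (auto simp: P_def)
    also have "\<dots> \<le> ?M" using inverse_one_minus_power_le[of \<theta> "3 * k * Suc d ^ 6"] th by (intro mult_left_mono) auto
    finally show "real (card (P R)) \<le> ?M" .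
  qed
  also have "(\<Sum>R\<in>Rs. ?M) = card Rs * ?M" by simp
  also have "real (card Rs) \<le> real (card V) ^ (k div m) * exp 2"
  proof -
    let ?x = "1 / real (card V)"
    have "real (card Rs) \<le> (1 / ?x) ^ (k div m) * (1 / (1 - ?x)) ^ card V"
      using n m less_eq_div_iff_mult_less_eq[of m] by (intro card_pow_le_weight[OF finV]) (auto simp: Rs_def)
    also have "\<dots> \<le> (1 / ?x) ^ (k div m) * exp (2 * ?x * card V)"
      using n inverse_one_minus_power_le[of ?x "card V"] by (intro mult_left_mono) auto
    finally show ?thesis using n by simp
  qed
  finally show ?thesis using th by (simp add: mult_right_mono)
qed

end

context product_host
begin

section \<open>Big clusters in product graphs\<close>

lemma dg_pos: assumes "j \<in> I" shows "1 \<le> dg j"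
proof -
  obtain b where b: "b \<in> verts (G j)" using sizeG[OF assms] by fastforce
  then have "{b} \<noteq> verts (G j)" using sizeG(1)[OF assms] by (metis One_nat_def card_1_singleton_iff less_irrefl)
  then obtain y where "y \<in> verts (G j) - {b}" using b by blast
  then obtain a where "{b,a} \<in> edges (G j)"
    using conn_cut[OF conn_G[OF assms], of "{b}" b y] b by auto
  then have "nbj j b \<noteq> {}" by (auto simp: nbj_def)
  then show ?thesis using card_nbj[OF assms b] by (metis card_0_eq less_one not_le)
qed

lemma dg_le: assumes "j \<in> I" shows "dg j < C"
proof -
  obtain b where b: "b \<in> verts (G j)" using sizeG[OF assms] by fastforce
  have "nbj j b \<subseteq> verts (G j) - {b}" using edge_G[OF assms] by (auto simp: nbj_def)
  then have "dg j \<le> card (verts (G j) - {b})"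
    using card_nbj[OF assms b] finite_verts[OF assms] by (metis card_mono finite_Diff)
  then show ?thesis using sizeG[OF assms] b finite_verts[OF assms] by simp
qed

lemma card_PV: "card PV = (\<Prod>j\<in>I. card (verts (G j)))"
  unfolding PV_def by (rule card_PiE[OF finI])

lemma card_PV_bounds: "2 ^ card I \<le> card PV" "card PV \<le> C ^ card I"
proof -
  have "(\<Prod>j\<in>I. 2) \<le> (\<Prod>j\<in>I. card (verts (G j)))" using sizeG(1) by (intro prod_mono) force
  then show "2 ^ card I \<le> card PV" by (simp add: card_PV)
  have "(\<Prod>j\<in>I. card (verts (G j))) \<le> (\<Prod>j\<in>I. C)" using sizeG(2) by (intro prod_mono) force
  then show "card PV \<le> C ^ card I" by (simp add: card_PV)
qed

lemma PV_nonempty: "PV \<noteq> {}"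
  using card_PV_bounds(1) by (metis card.empty le_zero_eq power_not_zero zero_neq_numeral)

abbreviation "deg_sum J \<equiv> (\<Sum>j\<in>J. dg j)"

lemma deg_sum_le: "J \<subseteq> I \<Longrightarrow> deg_sum J \<le> card J * C"
  using sum_bounded_above[of J dg C] dg_le by (auto simp: subset_iff less_imp_le)

lemma deg_sum_ge: "J \<subseteq> I \<Longrightarrow> card J \<le> deg_sum J"
  using sum_bounded_below[of J 1 dg] dg_pos by auto

text \<open>The boundary is the degree sum minus the inner degrees, and by entropy the latter are on
  average at most \<open>C * ln K / ln 2\<close>, which \<open>\<kappa>\<close> relates to the
  degree of the copy. Copies are allowed as hosts since clusters are bounded inside them.\<close>

lemma small_set_isoperimetry:
  fixes \<kappa> :: real and K :: nat
  assumes J: "J \<subseteq> I" and C: "1 < C" and S: "S \<subseteq> VJ J c" "S \<noteq> {}" "card S \<le> K" and K: "1 \<le> K"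
    and \<kappa>: "C * (ln K / ln 2) \<le> \<kappa> * deg_sum J"
  shows "(1 - \<kappa>) * deg_sum J * card S \<le> card (bd (EJ J c) S)"
proof -
  interpret H: regular_host "VJ J c" "EJ J c" "deg_sum J" by (rule regular_EJ[OF J])
  have SP: "S \<subseteq> PV" using S by (auto simp: VJ_def)
  have fS: "finite S" using SP finite_PV finite_subset by blast
  have k: "0 < card S" using S fS by (simp add: card_gt_0_iff)
  have "(\<Sum>x\<in>S. real (card (H.nb x \<inter> S))) \<le> (\<Sum>x\<in>S. real (card ({u. {x,u} \<in> PE} \<inter> S)))"
  proof (rule sum_mono)
    fix x
    have "H.nb x \<subseteq> {u. {x,u} \<in> PE}" unfolding H.nb_def by (auto simp: EJ_def)
    then have "card (H.nb x \<inter> S) \<le> card ({u. {x,u} \<in> PE} \<inter> S)" using fS by (intro card_mono) auto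
    then show "real (card (H.nb x \<inter> S)) \<le> real (card ({u. {x,u} \<in> PE} \<inter> S))" by simp
  qed
  also have "\<dots> \<le> (C - 1) * (card S * (ln (card S) / ln 2))" by (rule inner_degree_sum[OF SP C])
  also have "\<dots> \<le> C * (card S * (ln K / ln 2))"
    using k S(3) K by (intro mult_mono mult_left_mono divide_right_mono) auto
  also have "\<dots> = card S * (C * (ln K / ln 2))" by simp
  also have "\<dots> \<le> card S * (\<kappa> * deg_sum J)" using \<kappa> by (intro mult_left_mono) auto
  finally have 1: "(\<Sum>x\<in>S. real (card (H.nb x \<inter> S))) \<le> card S * (\<kappa> * deg_sum J)" .
  have "real (deg_sum J * card S) = (\<Sum>x\<in>S. real (card (H.nb x \<inter> S))) + card (bd (EJ J c) S)"
    unfolding H.degree_sum[OF S(1)] by simp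
  then show ?thesis using 1 by (simp add: algebra_simps)
qed

lemma cluster_EJ_sub: "x \<in> VJ J c \<Longrightarrow> cluster (F \<inter> EJ J c) (VJ J c) x \<subseteq> cluster F PV x"
  by (rule cluster_mono) (auto simp: VJ_def)

text \<open>The cluster inside one copy is a function of the edges of that copy alone, so the bound
  for a regular host transfers to \<open>PE\<close> as a marginal.\<close>

lemma copy_big_prob:
  fixes p p' \<kappa> :: real
  assumes J: "J \<subseteq> I" and C: "1 < C" and p: "0 < p'" "p' \<le> p" "p \<le> 1" "p' < 1"
    and x: "x \<in> VJ J c" and m: "1 \<le> m" and \<kappa>: "C * (ln m / ln 2) \<le> \<kappa> * deg_sum J"
    and cond: "p / p' * exp (- (p - p') * ((1 - \<kappa>) * deg_sum J)) \<le> 1"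
  shows "1 - p' / p \<le> pex p PE (\<lambda>F. of_bool (m \<le> card (cluster (F \<inter> EJ J c) (VJ J c) x)))"
proof -
  interpret H: regular_host "VJ J c" "EJ J c" "deg_sum J" by (rule regular_EJ[OF J])
  interpret P: regular_host PV PE "deg_sum I" by (rule regular_PE)
  have sub: "EJ J c \<subseteq> PE" by (auto simp: EJ_def)
  have "pex p (EJ J c) (\<lambda>F. of_bool (card (cluster F (VJ J c) x) < m)) \<le> p' / p"
    by (rule H.small_cluster_prob[OF p x small_set_isoperimetry[OF J C _ _ _ _ \<kappa>] cond]) (use m in auto)
  moreover have "pex p (EJ J c) (\<lambda>F. of_bool (card (cluster F (VJ J c) x) < m)) =
      pex p PE (\<lambda>F. of_bool (card (cluster (F \<inter> EJ J c) (VJ J c) x) < m))"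
    using pex_marginal[OF P.finE sub, of p "\<lambda>F. of_bool (card (cluster F (VJ J c) x) < m)"] by simp
  moreover have "pex p PE (\<lambda>F. of_bool (m \<le> card (cluster (F \<inter> EJ J c) (VJ J c) x)))
      = pex p PE (\<lambda>F. 1 + (- 1) * of_bool (card (cluster (F \<inter> EJ J c) (VJ J c) x) < m))"
    by (intro pex_cong) auto
  ultimately show ?thesis by (simp only: pex_add pex_cmult pex_const[OF P.finE])
qed

lemma EJ_disjoint:
  assumes "J \<subseteq> I" "i \<in> I - J" "c i \<noteq> c' i"
  shows "EJ J c \<inter> EJ J c' = {}"
proof -
  have "VJ J c \<inter> VJ J c' = {}" using assms by (auto simp: VJ_def)
  then show ?thesis using PE_doubleton by (fastforce simp: EJ_def)
qed

text \<open>Changing one coordinate in \<open>A1\<close> and one in \<open>A2\<close> reaches \<open>card A1 * card A2\<close> vertices that lie in edge-disjoint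
  copies of the product over the remaining coordinates.\<close>

lemma walk2_big_prob:
  fixes p \<mu> \<tau> :: real
  assumes p: "0 \<le> p" "p \<le> 1" and A: "A1 \<subseteq> I" "A2 \<subseteq> I" "A1 \<inter> A2 = {}" and v: "v \<in> PV"
    and mean: "\<And>x. x \<in> PV \<Longrightarrow> \<mu> \<le> pex p PE (\<lambda>F. of_bool (m \<le> card (cluster (F \<inter> EJ (I - (A1 \<union> A2)) x) (VJ (I - (A1 \<union> A2)) x) x)))"
    and \<tau>: "0 \<le> \<tau>"
  shows "pex p PE (\<lambda>F. of_bool (regular_host.walk2 PE (regular_host.big PV m F) v < card A1 * card A2 * (\<mu> - \<tau>)))
    \<le> exp (- (card A1 * card A2 * \<tau>^2 / 2))"
proof -
  interpret P: regular_host PV PE "deg_sum I" by (rule regular_PE)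
  let ?J = "I - (A1 \<union> A2)"
  have fA: "finite A1" "finite A2" using A finI finite_subset by blast+
  \<comment> \<open>Any neighbour will do as the changed value: one alternative per coordinate
    already gives \<open>card A1 * card A2\<close> targets.\<close>
  define nv where "nv l = (SOME a. a \<in> nbj l (v l))" for l
  have nv: "nv l \<in> nbj l (v l)" if l: "l \<in> I" for l
  proof -
    have "nbj l (v l) \<noteq> {}" using card_nbj(1)[OF l PV_verts[OF v l]] dg_pos[OF l] by auto
    then show ?thesis unfolding nv_def by (simp add: some_in_eq)
  qed
  have nvv: "nv l \<noteq> v l" "nv l \<in> verts (G l)" if l: "l \<in> I" for l
  proof -
    have e: "{v l, nv l} \<in> edges (G l)" using nv[OF l] by (simp add: nbj_def)
    show "nv l \<noteq> v l" "nv l \<in> verts (G l)" using edge_G[OF l e] by metis+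
  qed
  define x1 where "x1 i = v(i := nv i)" for i
  define w where "w ij = v(fst ij := nv (fst ij), snd ij := nv (snd ij))" for ij
  let ?P = "A1 \<times> A2"
  have ij: "fst a \<in> I" "snd a \<in> I" "fst a \<noteq> snd a" if "a \<in> ?P" for a using that A by auto
  have x1: "x1 i \<in> PV" "x1 i \<in> P.nb v" if i: "i \<in> I" for i
  proof -
    show "x1 i \<in> PV" unfolding x1_def using upd_PV[OF v i] nvv[OF i] by blast
    then show "x1 i \<in> P.nb v" unfolding P.nb_def mem_Collect_eq PE_iff
      using v i nv[OF i] by (intro conjI bexI[of _ i]) (auto simp: x1_def agree_def nbj_def)
  qed
  have w: "w a \<in> PV" "w a \<in> P.nb (x1 (fst a))" if a: "a \<in> ?P" for a
  proof -
    have w': "w a = (x1 (fst a))(snd a := nv (snd a))" by (simp add: w_def x1_def)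
    show "w a \<in> PV" unfolding w' using upd_PV[OF x1(1)[OF ij(1)[OF a]] ij(2)[OF a]] nvv[OF ij(2)[OF a]] by blast
    then show "w a \<in> P.nb (x1 (fst a))" unfolding P.nb_def mem_Collect_eq PE_iff
      using x1(1)[OF ij(1)[OF a]] ij[OF a] nv[OF ij(2)[OF a]] by (intro conjI bexI[of _ "snd a"]) (auto simp: w' x1_def agree_def nbj_def)
  qed
  define Y where "Y a F = (of_bool (m \<le> card (cluster (F \<inter> EJ ?J (w a)) (VJ ?J (w a)) (w a))) :: real)" for a F
  \<comment> \<open>Two targets differ in a coordinate of \<open>A1 \<union> A2\<close>. Copies keep
    these coordinates frozen, so the copies through different targets share no edge.\<close>
  have diff: "\<exists>l\<in>A1 \<union> A2. w a l \<noteq> w b l" if ab: "a \<in> ?P" "b \<in> ?P" "a \<noteq> b" for a b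
  proof -
    obtain i j i' j' where e: "a = (i,j)" "b = (i',j')" "i \<in> A1" "j \<in> A2" "i' \<in> A1" "j' \<in> A2" using ab by auto
    have ne: "i \<noteq> j'" "i' \<noteq> j" "i \<noteq> j" using e A by auto
    have I: "i \<in> I" "j \<in> I" using e A by auto
    show ?thesis
    proof (cases "i = i'")
      case False
      then have "w a i \<noteq> w b i" using e ne nvv[OF I(1)] by (simp add: w_def)
      then show ?thesis using e by blast
    next
      case True
      then have "j \<noteq> j'" using ab e by auto
      then have "w a j \<noteq> w b j" using e ne nvv[OF I(2)] by (simp add: w_def)
      then show ?thesis using e by blast
    qed
  qed
  have disj: "disjoint_family_on (\<lambda>a. EJ ?J (w a)) ?P"
    unfolding disjoint_family_on_def
  proof (intro ballI impI)
    fix a b assume "a \<in> ?P" "b \<in> ?P" "a \<noteq> b"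
    from diff[OF this] obtain l where "l \<in> A1 \<union> A2" "w a l \<noteq> w b l" by blast
    then show "EJ ?J (w a) \<inter> EJ ?J (w b) = {}" using A by (intro EJ_disjoint[of _ l]) auto
  qed
  have wV: "w a \<in> VJ ?J (w a)" if "a \<in> ?P" for a using w[OF that] by (simp add: VJ_def)
  have YB: "Y a F \<le> indicator (P.big m F) (w a)" if a: "a \<in> ?P" for a F
  proof -
    have "cluster F PV (w a) \<subseteq> PV" by (rule cluster_subset[OF w(1)[OF a]])
    then have "finite (cluster F PV (w a))" using finite_PV finite_subset by blast
    then have "card (cluster (F \<inter> EJ ?J (w a)) (VJ ?J (w a)) (w a)) \<le> card (cluster F PV (w a))"
      using cluster_EJ_sub[OF wV[OF a]] by (intro card_mono) auto
    then show ?thesis using w(1)[OF a] by (auto simp: Y_def P.big_def indicator_def)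
  qed
  have walk: "(\<Sum>a\<in>?P. Y a F) \<le> P.walk2 (P.big m F) v" for F
  proof -
    have "(\<Sum>a\<in>?P. Y a F) \<le> (\<Sum>a\<in>?P. indicator (P.big m F) (w a))" using YB by (intro sum_mono)
    also have "\<dots> = (\<Sum>i\<in>A1. \<Sum>j\<in>A2. indicator (P.big m F) (w (i,j)))" by (simp add: sum.cartesian_product)
    also have "\<dots> \<le> (\<Sum>i\<in>A1. P.adj (indicator (P.big m F)) (x1 i))"
    proof (rule sum_mono)
      fix i assume i: "i \<in> A1"
      have inj: "inj_on (\<lambda>j. w (i,j)) A2"
      proof (rule inj_onI)
        fix j j' assume "j \<in> A2" "j' \<in> A2" "w (i,j) = w (i,j')"
        then show "j = j'" using diff[of "(i,j)" "(i,j')"] i by auto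
      qed
      have "(\<Sum>j\<in>A2. indicator (P.big m F) (w (i,j))) = (\<Sum>y\<in>(\<lambda>j. w (i,j)) ` A2. indicator (P.big m F) y :: real)"
        by (simp add: sum.reindex[OF inj])
      also have "\<dots> \<le> P.adj (indicator (P.big m F)) (x1 i)" unfolding P.adj_def
        using w(2)[of "(i,_)"] i P.fin_nb by (intro sum_mono2) auto
      finally show "(\<Sum>j\<in>A2. indicator (P.big m F) (w (i,j))) \<le> P.adj (indicator (P.big m F)) (x1 i)" .
    qed
    also have "\<dots> = (\<Sum>y\<in>x1 ` A1. P.adj (indicator (P.big m F)) y)"
    proof -
      have "inj_on x1 A1"
      proof (rule inj_onI)
        fix i i' assume "i \<in> A1" "i' \<in> A1" "x1 i = x1 i'"
        then show "i = i'" using nvv[of i] A by (metis fun_upd_apply subsetD x1_def)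
      qed
      then show ?thesis by (simp add: sum.reindex)
    qed
    also have "\<dots> \<le> P.walk2 (P.big m F) v" unfolding P.walk2_def P.adj_def[of "P.adj _" v]
      using x1(2) A P.fin_nb by (intro sum_mono2) (auto intro!: P.adj_nonneg)
    finally show ?thesis .
  qed
  have cP: "real (card ?P) = card A1 * card A2" by (simp add: card_cartesian_product)
  have "pex p PE (\<lambda>F. of_bool (P.walk2 (P.big m F) v < card A1 * card A2 * (\<mu> - \<tau>)))
    \<le> pex p PE (\<lambda>F. of_bool ((\<Sum>a\<in>?P. Y a F) < card ?P * (\<mu> - \<tau>)))"
    unfolding cP using walk by (intro pex_mono p) (auto intro: order_le_less_trans)
  also have "\<dots> \<le> exp (- (card ?P * \<tau>^2 / 2))"
  proof (rule pex_lower_tail[OF P.finE p _ disj])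
    show "finite ?P" using fA by simp
    fix a assume a: "a \<in> ?P"
    show "\<mu> \<le> pex p PE (Y a)" unfolding Y_def using mean[OF w(1)[OF a]] .
    fix F show "Y a F = Y a (F \<inter> EJ ?J (w a))" by (simp add: Y_def Int_assoc)
  qed (use \<tau> in \<open>auto simp: Y_def\<close>)
  finally show ?thesis unfolding cP .
qed

lemma card_VJ_eq:
  assumes "J \<subseteq> I" "c \<in> PV" "c' \<in> PV"
  shows "card (VJ J c) = card (VJ J c')"
proof -
  define \<phi> where "\<phi> c x = (\<lambda>i. if i \<in> I - J then c i else x i)" for c x :: "'i \<Rightarrow> 'a"
  have in_V: "\<phi> c x \<in> VJ J c" if "c \<in> PV" "x \<in> PV" for c x
    using that by (auto simp: \<phi>_def VJ_def PV_def PiE_def Pi_def extensional_def)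
  have inv: "\<phi> c (\<phi> c' x) = x" if "x \<in> VJ J c" for c c' x
    using that by (auto simp: \<phi>_def VJ_def fun_eq_iff)
  have sub: "VJ J c \<subseteq> PV" for c by (auto simp: VJ_def)
  have "bij_betw (\<phi> c') (VJ J c) (VJ J c')"
    by (rule bij_betw_byWitness[where f'="\<phi> c"]) (use inv in_V assms sub in blast)+
  then show ?thesis by (rule bij_betw_same_card)
qed

lemma card_big_prob:
  fixes p \<mu> \<tau> :: real
  assumes p: "0 \<le> p" "p \<le> 1" and J: "J \<subseteq> I"
    and mean: "\<And>x. x \<in> PV \<Longrightarrow> \<mu> \<le> pex p PE (\<lambda>F. of_bool (m \<le> card (cluster (F \<inter> EJ J x) (VJ J x) x)))"
    and \<tau>: "0 \<le> \<tau>"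
  shows "pex p PE (\<lambda>F. of_bool (card (regular_host.big PV m F) < card PV * (\<mu> - \<tau>)))
    \<le> exp (- (2 ^ card (I - J) * \<tau>^2 / 2))"
proof -
  interpret P: regular_host PV PE "deg_sum I" by (rule regular_PE)
  \<comment> \<open>Indexing by restrictions lists every copy once, whereas \<open>VJ J x\<close>
    names the same copy for each of its vertices \<open>x\<close>.\<close>
  define R where "R = (\<lambda>x. restrict x (I - J)) ` PV"
  define Vc where "Vc c = {x\<in>PV. restrict x (I - J) = c}" for c :: "'i \<Rightarrow> 'a"
  have fR: "finite R" using finite_PV by (simp add: R_def)
  have Vc_eq: "Vc (restrict x (I - J)) = VJ J x" for x
    by (auto simp: Vc_def VJ_def restrict_def fun_eq_iff)
  obtain x0 where x0: "x0 \<in> PV" using PV_nonempty by blast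
  define M where "M = card (VJ J x0)"
  have cVc: "card (Vc c) = M" if c: "c \<in> R" for c
  proof -
    obtain x where "x \<in> PV" "c = restrict x (I - J)" using c by (auto simp: R_def)
    then show ?thesis using Vc_eq card_VJ_eq[OF J _ x0] by (simp add: M_def)
  qed
  have VV: "PV = (\<Union>c\<in>R. Vc c)" by (auto simp: R_def Vc_def)
  have fVc: "finite (Vc c)" for c using finite_PV by (simp add: Vc_def)
  have dV: "\<forall>c\<in>R. \<forall>c'\<in>R. c \<noteq> c' \<longrightarrow> Vc c \<inter> Vc c' = {}" by (auto simp: Vc_def)
  have cPV: "card PV = card R * M"
  proof -
    have "card PV = (\<Sum>c\<in>R. card (Vc c))" unfolding VV by (rule card_UN_disjoint[OF fR]) (use fVc dV in auto)
    then show ?thesis using cVc by simp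
  qed
  have M0: "0 < M" using x0 finite_PV card_gt_0_iff unfolding M_def VJ_def by fastforce
  have cR: "2 ^ card (I - J) \<le> card R"
  proof -
    have "R = (\<Pi>\<^sub>E j\<in>I-J. verts (G j))"
    proof
      show "R \<subseteq> (\<Pi>\<^sub>E j\<in>I-J. verts (G j))"
        unfolding R_def by (intro image_subsetI PiE_I) (use PV_verts in auto)
      show "(\<Pi>\<^sub>E j\<in>I-J. verts (G j)) \<subseteq> R"
      proof
        fix c assume c: "c \<in> (\<Pi>\<^sub>E j\<in>I-J. verts (G j))"
        let ?x = "\<lambda>i. if i \<in> I - J then c i else x0 i"
        have xP: "?x \<in> PV" using c x0 by (auto simp: PV_def PiE_def Pi_def extensional_def)
        have "restrict ?x (I - J) = c" using c by (auto simp: restrict_def fun_eq_iff PiE_def extensional_def)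
        then show "c \<in> R" unfolding R_def using xP by (intro image_eqI[OF sym])
      qed
    qed
    then have "card R = (\<Prod>j\<in>I-J. card (verts (G j)))" using finI by (simp add: card_PiE)
    moreover have "(\<Prod>j\<in>I-J. 2) \<le> (\<Prod>j\<in>I-J. card (verts (G j)))" using sizeG(1) by (intro prod_mono) force
    ultimately show ?thesis by simp
  qed
  define Ec where "Ec c = {e\<in>PE. e \<subseteq> Vc c}" for c
  have Ec_eq: "Ec (restrict x (I - J)) = EJ J x" for x by (simp add: Ec_def EJ_def Vc_eq)
  define Y where "Y c F = (\<Sum>x\<in>Vc c. of_bool (m \<le> card (cluster (F \<inter> Ec c) (Vc c) x))) / M" for c F
  have MY: "M * Y c F = (\<Sum>x\<in>Vc c. of_bool (m \<le> card (cluster (F \<inter> Ec c) (Vc c) x)))" for c F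
    using M0 by (simp add: Y_def)
  have big: "M * (\<Sum>c\<in>R. Y c F) \<le> card (P.big m F)" for F
  proof -
    have "M * (\<Sum>c\<in>R. Y c F) = (\<Sum>c\<in>R. \<Sum>x\<in>Vc c. of_bool (m \<le> card (cluster (F \<inter> Ec c) (Vc c) x)))"
      unfolding sum_distrib_left by (simp only: MY)
    also have "\<dots> \<le> (\<Sum>c\<in>R. \<Sum>x\<in>Vc c. of_bool (x \<in> P.big m F))"
    proof (intro sum_mono)
      fix c x assume cx: "c \<in> R" "x \<in> Vc c"
      then have c: "c = restrict x (I - J)" and xP: "x \<in> PV" by (auto simp: Vc_def)
      have "finite (cluster F PV x)" using cluster_subset[OF xP] finite_PV finite_subset by blast
      then have "card (cluster (F \<inter> Ec c) (Vc c) x) \<le> card (cluster F PV x)"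
        unfolding c Ec_eq Vc_eq using xP by (intro card_mono cluster_EJ_sub) (auto simp: VJ_def)
      then show "of_bool (m \<le> card (cluster (F \<inter> Ec c) (Vc c) x)) \<le> (of_bool (x \<in> P.big m F) :: real)"
        using xP by (auto simp: P.big_def)
    qed
    also have "\<dots> = (\<Sum>x\<in>PV. of_bool (x \<in> P.big m F))"
      by (subst (3) VV, rule sum.UNION_disjoint[symmetric, OF fR]) (use fVc dV in auto)
    also have "\<dots> = card (PV \<inter> {x. x \<in> P.big m F})" using finite_PV by (subst sum_of_bool_eq) auto
    also have "PV \<inter> {x. x \<in> P.big m F} = P.big m F" by (auto simp: P.big_def)
    finally show ?thesis .
  qed
  have "pex p PE (\<lambda>F. of_bool (card (P.big m F) < card PV * (\<mu> - \<tau>)))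
    \<le> pex p PE (\<lambda>F. of_bool ((\<Sum>c\<in>R. Y c F) < card R * (\<mu> - \<tau>)))"
  proof (intro pex_mono p)
    fix F
    have "(\<Sum>c\<in>R. Y c F) < card R * (\<mu> - \<tau>)" if "card (P.big m F) < card PV * (\<mu> - \<tau>)"
    proof -
      have "M * (\<Sum>c\<in>R. Y c F) < M * (card R * (\<mu> - \<tau>))" using big[of F] that cPV by (simp add: algebra_simps)
      then show ?thesis using M0 by simp
    qed
    then show "of_bool (card (P.big m F) < card PV * (\<mu> - \<tau>)) \<le> (of_bool ((\<Sum>c\<in>R. Y c F) < card R * (\<mu> - \<tau>)) :: real)"
      by simp
  qed
  also have "\<dots> \<le> exp (- (card R * \<tau>^2 / 2))"
  proof (rule pex_lower_tail[OF P.finE p fR])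
    show "disjoint_family_on Ec R" unfolding disjoint_family_on_def
    proof (intro ballI impI)
      fix c c' assume "c \<in> R" "c' \<in> R" "c \<noteq> c'"
      then have "Vc c \<inter> Vc c' = {}" using dV by blast
      then show "Ec c \<inter> Ec c' = {}" using PE_doubleton by (fastforce simp: Ec_def)
    qed
    fix c assume c: "c \<in> R"
    have "\<mu> * M = (\<Sum>x\<in>Vc c. \<mu>)" using cVc[OF c] by simp
    also have "\<dots> \<le> (\<Sum>x\<in>Vc c. pex p PE (\<lambda>F. of_bool (m \<le> card (cluster (F \<inter> Ec c) (Vc c) x))))"
    proof (rule sum_mono)
      fix x assume x: "x \<in> Vc c"
      then have "c = restrict x (I - J)" "x \<in> PV" by (auto simp: Vc_def)
      then show "\<mu> \<le> pex p PE (\<lambda>F. of_bool (m \<le> card (cluster (F \<inter> Ec c) (Vc c) x)))"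
        using mean[of x] by (simp add: Ec_eq Vc_eq)
    qed
    also have "\<dots> = M * pex p PE (Y c)"
    proof -
      have "M * pex p PE (Y c) = pex p PE (\<lambda>F. M * Y c F)" by (rule pex_cmult[symmetric])
      also have "\<dots> = pex p PE (\<lambda>F. \<Sum>x\<in>Vc c. of_bool (m \<le> card (cluster (F \<inter> Ec c) (Vc c) x)))"
        by (simp only: MY)
      finally show ?thesis by (simp only: pex_sum)
    qed
    finally show "\<mu> \<le> pex p PE (Y c)" using M0 by (simp add: mult.commute)
    fix F
    show "Y c F = Y c (F \<inter> Ec c)" by (simp add: Y_def Int_assoc)
    show "0 \<le> Y c F" unfolding Y_def by (intro divide_nonneg_nonneg sum_nonneg) auto
    have "(\<Sum>x\<in>Vc c. of_bool (m \<le> card (cluster (F \<inter> Ec c) (Vc c) x))) \<le> (\<Sum>x\<in>Vc c. 1 :: real)"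
      by (intro sum_mono) auto
    then show "Y c F \<le> 1" using cVc[OF c] M0 by (simp add: Y_def)
  qed (use \<tau> in auto)
  also have "\<dots> \<le> exp (- (2 ^ card (I - J) * \<tau>^2 / 2))"
  proof -
    have "2 ^ card (I - J) \<le> real (card R)" using cR by (metis numeral_power_le_of_nat_cancel_iff)
    then show ?thesis by (simp add: mult_right_mono)
  qed
  finally show ?thesis .
qed

end

section \<open>Choice of parameters\<close>

lemma ln_le_self: fixes x :: real assumes "0 < x" shows "ln x \<le> x" 
  using ln_le_minus_one[OF assms] by simp

text \<open>The function \<open>x * ln (n / x)\<close> is small near both ends, and the upper bound
  on \<open>x\<close> keeps it away from \<open>n\<close>. If \<open>x \<le> k\<close>, the
  logarithm is at least \<open>L = ln (n / k)\<close>. If \<open>x > k\<close> and the logarithm is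
  at least \<open>L / 2\<close>, then \<open>x > k\<close> suffices. Otherwise \<open>x\<close>
  exceeds \<open>k * exp (L / 2)\<close>, hence \<open>k * L / 2\<close>, and the logarithm is still
  at least \<open>\<eta>\<close>.\<close>

lemma scaled_entropy_lower:
  fixes a k x n \<eta> :: real
  assumes a: "0 < a" "a \<le> \<eta>" "\<eta> \<le> 1" and k: "0 < k" "k \<le> n" and x: "a * k / 2 \<le> x" "x \<le> (1 - \<eta>) * n"
  shows "a / 2 * (k * ln (n / k)) \<le> x * ln (n / x)"
proof -
  define L where "L = ln (n / k)"
  have L0: "0 \<le> L" unfolding L_def using k by simp
  have x0: "0 < x" using x a k by (smt (verit) divide_pos_pos mult_pos_pos)
  have n0: "0 < n" using k by simp
  have nx: "ln (n / x) = ln n - ln x" "L = ln n - ln k" using n0 x0 k by (auto simp: ln_div L_def)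
  have a1: "a / 2 * (k * L) \<le> \<eta> / 2 * (k * L)" using a k L0 by (intro mult_right_mono) auto
  consider "x \<le> k" | "k < x" "L / 2 \<le> ln (n / x)" | "k < x" "ln (n / x) < L / 2" by linarith
  then show ?thesis
  proof cases
    case 1
    then have "ln x \<le> ln k" using x0 k by simp
    then have "L \<le> ln (n / x)" using nx by simp
    then have "a * k / 2 * L \<le> x * ln (n / x)" using x L0 x0 by (intro mult_mono) auto
    then show ?thesis by (simp add: L_def algebra_simps)
  next
    case 2
    then have "k * (L / 2) \<le> x * ln (n / x)" using L0 k x0 by (intro mult_mono) auto
    moreover have "\<eta> / 2 * (k * L) \<le> 1 / 2 * (k * L)" using a k L0 by (intro mult_right_mono) auto
    ultimately show ?thesis using a1 by (simp add: L_def)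
  next
    case 3
    have "ln k + L / 2 < ln x" using 3(2) nx by linarith
    then have "exp (ln k + L / 2) < x" using x0 by (metis exp_less_cancel_iff exp_ln)
    then have "k * exp (L / 2) < x" using k by (simp add: exp_add)
    moreover have "L / 2 \<le> exp (L / 2)" using exp_ge_add_one_self[of "L/2"] by linarith
    then have "k * (L / 2) \<le> k * exp (L / 2)" using k by (intro mult_left_mono) auto
    ultimately have xk: "k * (L / 2) \<le> x" by linarith
    have "x / n \<le> 1 - \<eta>" using x n0 by (simp add: field_simps)
    moreover have "ln (x / n) \<le> x / n - 1" using x0 n0 by (intro ln_le_minus_one) simp
    ultimately have "\<eta> \<le> ln (n / x)" using n0 x0 by (simp add: ln_div)
    then have "k * (L / 2) * \<eta> \<le> x * ln (n / x)" using xk a x0 by (intro mult_mono) auto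
    then show ?thesis using a1 by (simp add: L_def algebra_simps)
  qed
qed

text \<open>To second order the first claim reads \<open>f^2 \<le> e^2\<close> for
  \<open>f = 17/20 * \<epsilon>\<close>. The exact dual is \<open>f = e\<close> to leading order;
  staying below it leaves room for \<open>\<kappa>\<close> and the cubic terms. The second claim has
  slack because \<open>e + f\<close> is at least \<open>1.83 * \<epsilon>\<close>.\<close>

lemma dual_parameter:
  fixes \<epsilon> e \<kappa> :: real
  assumes eps: "0 < \<epsilon>" "\<epsilon> \<le> 1/100" and e: "(49/50) * \<epsilon> \<le> e" "e \<le> \<epsilon>" and \<kappa>: "0 \<le> \<kappa>" "\<kappa> \<le> \<epsilon>^3"
  shows "(1 + e) / (1 - (17/20) * \<epsilon>) * exp (- (e + (17/20) * \<epsilon>) * (1 - \<kappa>)) \<le> 1" "(1 - (17/20) * \<epsilon>) / (1 + e) \<le> 1 - (17/10) * \<epsilon>"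
proof -
  let ?f = "(17/20) * \<epsilon>"
  have e2: "\<epsilon>^3 \<le> \<epsilon>^2 / 100" using eps mult_right_mono[of \<epsilon> "1/100" "\<epsilon>^2"] by (simp add: numeral_eq_Suc)
  have "ln (1 + e) \<le> e - e^2/2 + e^3/2" using e eps by (intro ln_one_plus_le) auto
  moreover have "- (?f + ?f^2/2 + ?f^3) \<le> ln (1 - ?f)" using eps by (intro ln_one_minus_ge) auto
  moreover have "e^3 \<le> \<epsilon>^3" using e eps by (intro power_mono) auto
  moreover have "((49/50) * \<epsilon>)^2 \<le> e^2" using e eps by (intro power_mono) auto
  moreover have "(e + ?f) * \<kappa> \<le> 2 * \<epsilon> * \<epsilon>^3" using e eps \<kappa> by (intro mult_mono) auto
  moreover have "2 * \<epsilon> * \<epsilon>^3 \<le> \<epsilon>^3" using eps mult_right_mono[of "2 * \<epsilon>" 1 "\<epsilon>^3"] by simp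
  moreover have "?f^2 = (289/400) * \<epsilon>^2" "?f^3 \<le> \<epsilon>^3" "((49/50) * \<epsilon>)^2 = (2401/2500) * \<epsilon>^2"
    using eps by (auto simp: power2_eq_square power_mult_distrib)
  ultimately have "ln (1 + e) - ln (1 - ?f) - ((e + ?f) - (e + ?f) * \<kappa>) \<le> 0"
    using e2 zero_le_power2[of \<epsilon>] by linarith
  then have "ln ((1 + e) / (1 - ?f)) + - (e + ?f) * (1 - \<kappa>) \<le> 0"
  proof -
    assume a: "ln (1 + e) - ln (1 - ?f) - ((e + ?f) - (e + ?f) * \<kappa>) \<le> 0"
    have "ln ((1 + e) / (1 - ?f)) = ln (1 + e) - ln (1 - ?f)" using e eps by (subst ln_div) auto
    moreover have "- (e + ?f) * (1 - \<kappa>) = - ((e + ?f) - (e + ?f) * \<kappa>)" by algebra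
    ultimately show ?thesis using a by linarith
  qed
  then have "exp (ln ((1 + e) / (1 - ?f)) + - (e + ?f) * (1 - \<kappa>)) \<le> exp 0" by (rule exp_mono)
  then show "(1 + e) / (1 - ?f) * exp (- (e + ?f) * (1 - \<kappa>)) \<le> 1" using e eps by (simp add: exp_add)
  have "(1 - (17/10) * \<epsilon>) * (1 + (49/50) * \<epsilon>) \<le> (1 - (17/10) * \<epsilon>) * (1 + e)" using e eps by (intro mult_left_mono) auto
  moreover have "(1 - (17/10) * \<epsilon>) * (1 + (49/50) * \<epsilon>) = 1 - (18/25) * \<epsilon> - (833/500) * (\<epsilon> * \<epsilon>)" by (simp add: field_simps)
  moreover have "\<epsilon> * \<epsilon> \<le> \<epsilon> * (1/100)" using eps by (intro mult_left_mono) auto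
  ultimately have "1 - ?f \<le> (1 - (17/10) * \<epsilon>) * (1 + e)" using eps by linarith
  then show "(1 - ?f) / (1 + e) \<le> 1 - (17/10) * \<epsilon>" using e eps by (simp add: divide_le_eq)
qed

text \<open>All exponents are measured in \<open>\<Lambda> = k * L / d\<close>. The paths gain
  \<open>c4\<close>; the roots cost \<open>C / d\<close>, the named objects \<open>30 * c\<close>
  (three kinds at \<open>10 * ln d\<close> each), the rest of the windows \<open>384 / d^3\<close>,
  and the destroyed walks \<open>c\<close>. As \<open>31 / 240\<close> and \<open>1 / 4\<close> add
  up to less than \<open>1 / 2\<close>, half of the gain survives.\<close>

lemma escape_exponent:
  fixes \<epsilon> c c3 c4 L n d :: real and k b N m :: nat
  assumes eps: "0 < \<epsilon>" "\<epsilon> \<le> 1/100" and d: "2 \<le> d" and c4: "c4 = (\<epsilon>^3 / 20) ^ 5 * c3" and c: "c = c4 / 240" and c3: "0 < c3"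
    and L: "1 \<le> L" and n: "1 \<le> n" "ln n \<le> d * C" and b: "b \<le> c * k * L / (d * ln d)"
    and N: "real N \<le> 3 * k * (2 * d) ^ 6" and m: "m = d ^ 3"
    and large: "160 \<le> d * ln d" "384 / d^3 + C / d \<le> c4 / 4"
  shows "n ^ (k div m) * exp 2 * ((1 / (1 / d ^ 10)) ^ (3 * b) * exp (2 * (1 / d ^ 10) * N)) *
       exp (- ((\<epsilon>^3 / (5 * d) / 4) ^ 5 * (c3 * d ^ 4 * k * L - 160 * real b * d ^ 4)))
     \<le> exp (2 - c4 / 2 * (k / d))"
proof -
  define \<Lambda> where "\<Lambda> = k * L / d"
  have d0: "0 < d" "0 < ln d" using d by auto
  have \<Lambda>0: "0 \<le> \<Lambda>" using L d0 by (simp add: \<Lambda>_def)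
  have kL: "k / d \<le> \<Lambda>" unfolding \<Lambda>_def using L d0 mult_left_mono[of 1 L "real k"] by (intro divide_right_mono) auto
  have e3: "0 < \<epsilon>^3" "\<epsilon>^3 \<le> 1" using eps by (auto intro: power_le_one)
  have c40: "0 < c4" using c4 c3 e3 by simp
  have bL: "b * ln d \<le> c * \<Lambda>"
  proof -
    have "b * ln d \<le> c * k * L / (d * ln d) * ln d" using b d0 by (intro mult_right_mono) auto
    then show ?thesis using d0 by (simp add: \<Lambda>_def)
  qed
  have t1: "n ^ (k div m) \<le> exp (C / d * \<Lambda>)"
  proof -
    have m0: "0 < real m" using m d0 by simp
    have "real (k div m) \<le> k / m" by (rule of_nat_div_le_of_nat)
    then have "real (k div m) * ln n \<le> k / m * (d * C)" using n m0 by (intro mult_mono) auto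
    also have "\<dots> = C / d * (k / d)" using d0 by (simp add: m power3_eq_cube)
    also have "\<dots> \<le> C / d * \<Lambda>"
    proof (rule mult_left_mono[OF kL])
      have "0 \<le> d * C" using n ln_ge_zero[of n] by linarith
      then show "0 \<le> C / d" using d0 by (simp add: zero_le_mult_iff)
    qed
    finally have "exp (real (k div m) * ln n) \<le> exp (C / d * \<Lambda>)" by simp
    then show ?thesis using n by (simp add: exp_of_nat_mult)
  qed
  have t2: "(1 / (1 / d ^ 10)) ^ (3 * b) \<le> exp (30 * c * \<Lambda>)"
  proof -
    have "(1 / (1 / d ^ 10)) ^ (3 * b) = d ^ (30 * b)" using d0 by (simp add: power_mult[symmetric])
    also have "\<dots> = exp (real (30 * b) * ln d)" unfolding exp_of_nat_mult using d0 by simp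
    also have "\<dots> \<le> exp (30 * c * \<Lambda>)" using bL by simp
    finally show ?thesis .
  qed
  have t3: "exp (2 * (1 / d ^ 10) * N) \<le> exp (384 / d^3 * \<Lambda>)"
  proof -
    have "2 * (1 / d ^ 10) * N \<le> 2 * (1 / d ^ 10) * (3 * k * (2 * d) ^ 6)" using N d0 by (intro mult_left_mono) auto
    also have "\<dots> = 384 / d^3 * (k / d)" using d0 by (simp add: power_mult_distrib field_simps) (simp add: numeral_eq_Suc)
    also have "\<dots> \<le> 384 / d^3 * \<Lambda>" using kL d0 by (intro mult_left_mono) auto
    finally show ?thesis by simp
  qed
  have t4: "- ((\<epsilon>^3 / (5 * d) / 4) ^ 5 * (c3 * d ^ 4 * k * L - 160 * real b * d ^ 4)) \<le> - c4 * \<Lambda> + c * \<Lambda>"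
  proof -
    have X: "X * (c3 * d ^ 4 * k * L - 160 * real b * d ^ 4) = (X * d ^ 4) * (c3 * k * L - 160 * b)" for X
      by (simp add: algebra_simps)
    have "(\<epsilon>^3 / (5 * d) / 4) ^ 5 * d ^ 4 = (\<epsilon>^3 / 20) ^ 5 / d"
      using d0 by (simp add: power_divide power_mult_distrib field_simps) (simp add: numeral_eq_Suc)
    then have e: "(\<epsilon>^3 / (5 * d) / 4) ^ 5 * (c3 * d ^ 4 * k * L - 160 * real b * d ^ 4) = (\<epsilon>^3 / 20) ^ 5 / d * (c3 * k * L - 160 * b)"
      unfolding X by (simp only:)
    have "(\<epsilon>^3 / 20) ^ 5 / d * (160 * b) \<le> 1 / d * (160 * b)"
      using e3 d0 by (intro mult_right_mono divide_right_mono power_le_one) auto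
    also have "\<dots> \<le> ln d * b" using large(1) d0 mult_right_mono[of 160 "d * ln d" "real b"] by (simp add: field_simps)
    also have "\<dots> \<le> c * \<Lambda>" using bL by (simp add: mult.commute)
    finally have "(\<epsilon>^3 / 20) ^ 5 / d * (160 * b) \<le> c * \<Lambda>" .
    moreover have "(\<epsilon>^3 / 20) ^ 5 / d * (c3 * k * L) = c4 * \<Lambda>" by (simp add: c4 \<Lambda>_def)
    ultimately show ?thesis unfolding e by (simp add: right_diff_distrib)
  qed
  have "n ^ (k div m) * exp 2 * ((1 / (1 / d ^ 10)) ^ (3 * b) * exp (2 * (1 / d ^ 10) * N)) *
       exp (- ((\<epsilon>^3 / (5 * d) / 4) ^ 5 * (c3 * d ^ 4 * k * L - 160 * real b * d ^ 4)))
    \<le> exp (C / d * \<Lambda>) * exp 2 * (exp (30 * c * \<Lambda>) * exp (384 / d^3 * \<Lambda>)) * exp (- c4 * \<Lambda> + c * \<Lambda>)"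
    using t1 t2 t3 t4 n d0 by (intro mult_mono) auto
  also have "\<dots> = exp (2 + (C / d + 384 / d^3 + 31 * c - c4) * \<Lambda>)"
    by (simp add: exp_add[symmetric] algebra_simps)
  also have "\<dots> \<le> exp (2 - c4 / 2 * (k / d))"
  proof -
    have "C / d + 384 / d^3 + 31 * c - c4 \<le> - (c4 / 2)" using large(2) c c40 by simp
    then have "(C / d + 384 / d^3 + 31 * c - c4) * \<Lambda> \<le> - (c4 / 2) * \<Lambda>" using \<Lambda>0 by (intro mult_right_mono)
    also have "\<dots> \<le> - (c4 / 2) * (k / d)" using kL c40 by (intro mult_left_mono_neg) auto
    finally show ?thesis by simp
  qed
  finally show ?thesis .
qed

text \<open>The second round consists of five rounds of density \<open>q\<close>, one for each step
  of a path. Bernoulli's inequality shows that the first round keeps density at least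
  \<open>p - 5 * q\<close>.\<close>

lemma two_round_parameters:
  fixes p q :: real
  assumes q: "0 \<le> q" "q < 1" and p: "5 * q \<le> p" "p \<le> 1"
  defines "p1 \<equiv> 1 - (1 - p) / (1 - q) ^ 5"
  shows "1 - p = (1 - p1) * (1 - (1 - (1 - q) ^ 5))" "p - 5 * q \<le> p1" "p1 \<le> p"
proof -
  have pos: "0 < (1 - q) ^ 5" using q by simp
  show "1 - p = (1 - p1) * (1 - (1 - (1 - q) ^ 5))" using pos q by (simp add: p1_def)
  have "(1 - q) ^ 5 \<le> 1" using q by (intro power_le_one) auto
  then have "(1 - p) * (1 - q) ^ 5 \<le> (1 - p) * 1" using p by (intro mult_left_mono) auto
  then have "1 - p \<le> (1 - p) / (1 - q) ^ 5" using pos by (simp add: pos_le_divide_eq)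
  then show "p1 \<le> p" by (simp add: p1_def)
  have "1 + real 5 * (-q) \<le> (1 + (-q)) ^ 5" using q by (intro Bernoulli_inequality) auto
  then have B: "1 - 5 * q \<le> (1 - q) ^ 5" by simp
  have "1 - p \<le> (1 - p + 5 * q) * (1 - 5 * q)"
  proof -
    have "(1 - p + 5 * q) * (1 - 5 * q) = 1 - p + 5 * q * (p - 5 * q)" by (simp add: algebra_simps)
    then show ?thesis using q p by simp
  qed
  also have "\<dots> \<le> (1 - p + 5 * q) * (1 - q) ^ 5" using B q p by (intro mult_left_mono) auto
  finally have "(1 - p) / (1 - q) ^ 5 \<le> 1 - p + 5 * q" using pos by (simp add: pos_divide_le_eq)
  then show "p - 5 * q \<le> p1" by (simp add: p1_def)
qed

section \<open>Mean cluster sizes and the escape bound with all constants in place\<close>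

context product_host
begin

text \<open>A copy misses at most a fraction \<open>\<epsilon> / 200\<close> of the degree, so
  \<open>p1\<close> is still \<open>(1 + e) / dJ\<close> with \<open>e\<close> between
  \<open>49/50 * \<epsilon>\<close> and \<open>\<epsilon>\<close>, and the dual density
  \<open>p'\<close> of the copy applies.\<close>

lemma copy_mean:
  fixes \<epsilon> p1 :: real and dI dJ :: nat
  assumes dd: "dI = deg_sum I" "dJ = deg_sum J" and eps: "0 < \<epsilon>" "\<epsilon> \<le> 1/100" and C: "1 < C" and J: "J \<subseteq> I" and D: "(1 - \<epsilon> / 200) * dI \<le> dJ"
    and d: "2 \<le> dI" and p1: "(1 + \<epsilon> - \<epsilon>^3) / dI \<le> p1" "p1 \<le> (1 + \<epsilon>) / dI"
    and m: "1 \<le> m" "C * (ln (real m) / ln 2) \<le> \<epsilon>^3 * dJ" and x: "x \<in> PV"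
  shows "17/10 * \<epsilon> \<le> pex p1 PE (\<lambda>F. of_bool (m \<le> card (cluster (F \<inter> EJ J x) (VJ J x) x)))"
proof -
  let ?d = "real dI" and ?D = "real dJ"
  have d0: "0 < ?d" using d by simp
  have "dJ \<le> dI" unfolding dd using J finI by (intro sum_mono2) auto
  then have Dd: "?D \<le> ?d" by simp
  have "0 < (1 - \<epsilon> / 200) * ?d" using eps d0 by (intro mult_pos_pos) auto
  then have D0: "0 < ?D" using D by linarith
  then have D1: "1 \<le> ?D" by simp
  have e3: "\<epsilon>^3 \<le> \<epsilon> / 10000" "0 \<le> \<epsilon>^3"
  proof -
    have "\<epsilon>^2 \<le> (1/100)^2" using eps by (intro power_mono) auto
    then have "\<epsilon> * \<epsilon>^2 \<le> \<epsilon> * (1/10000)" using eps by (intro mult_left_mono) (auto simp: power2_eq_square)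
    then show "\<epsilon>^3 \<le> \<epsilon> / 10000" by (simp add: numeral_eq_Suc)
  qed (use eps in simp)
  define e where "e = p1 * ?D - 1"
  have p1d: "1 + \<epsilon> - \<epsilon>^3 \<le> p1 * ?d" "p1 * ?d \<le> 1 + \<epsilon>" using p1 d0 by (auto simp: field_simps)
  have p10: "0 < p1"
  proof -
    have "0 < p1 * ?d" using p1d e3 eps by linarith
    then show ?thesis using d0 by (simp add: zero_less_mult_iff)
  qed
  have e: "(49/50) * \<epsilon> \<le> e" "e \<le> \<epsilon>"
  proof -
    have "(1 + \<epsilon> - \<epsilon>^3) * (1 - \<epsilon> / 200) \<le> p1 * ?d * (1 - \<epsilon> / 200)" using p1d eps by (intro mult_right_mono) auto
    also have "\<dots> \<le> p1 * ?D" using mult_left_mono[OF D, of p1] p10 by (simp add: algebra_simps)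
    finally have 1: "(1 + \<epsilon> - \<epsilon>^3) * (1 - \<epsilon> / 200) \<le> 1 + e" by (simp add: e_def)
    have "(1 + \<epsilon> - \<epsilon>^3) * (1 - \<epsilon> / 200) = 1 + \<epsilon> - \<epsilon>^3 - \<epsilon> / 200 * (1 + \<epsilon>) + \<epsilon>^3 * (\<epsilon> / 200)" by (simp add: field_simps)
    moreover have "0 \<le> \<epsilon>^3 * (\<epsilon> / 200)" using eps by simp
    moreover have "\<epsilon> / 200 * (1 + \<epsilon>) \<le> \<epsilon> / 200 * (101/100)" using eps by (intro mult_left_mono) auto
    ultimately show "(49/50) * \<epsilon> \<le> e" using 1 e3 eps by linarith
    have "p1 * ?D \<le> p1 * ?d" using Dd p10 by (intro mult_left_mono) auto
    then show "e \<le> \<epsilon>" using p1d by (simp add: e_def)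
  qed
  define p' where "p' = (1 - (17/20) * \<epsilon>) / ?D"
  have p1e: "p1 = (1 + e) / ?D" using D0 by (simp add: e_def)
  have e30: "0 \<le> \<epsilon>^3" "\<epsilon>^3 \<le> \<epsilon>^3" using eps by auto
  have p': "0 < p'" "p' \<le> p1" "p1 \<le> 1" "p' < 1"
  proof -
    show "0 < p'" using eps D0 by (simp add: p'_def)
    show "p' \<le> p1" unfolding p'_def p1e using eps e D0 by (intro divide_right_mono) auto
    have "1 + \<epsilon> \<le> ?d" using d eps by simp
    then have "p1 * ?d \<le> 1 * ?d" using p1d by simp
    then show "p1 \<le> 1" using d0 by (simp only: mult_le_cancel_right_pos)
    show "p' < 1" unfolding p'_def using eps D1 by (simp add: divide_less_eq)
  qed
  have "1 - p' / p1 \<le> pex p1 PE (\<lambda>F. of_bool (m \<le> card (cluster (F \<inter> EJ J x) (VJ J x) x)))"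
  proof (rule copy_big_prob[OF J C p' _ m[unfolded dd]])
    show "x \<in> VJ J x" using x by (simp add: VJ_def)
    have "p1 / p' = (1 + e) / (1 - (17/20) * \<epsilon>)" using D0 by (simp add: p1e p'_def)
    moreover have "(p1 - p') * ((1 - \<epsilon>^3) * ?D) = (e + (17/20) * \<epsilon>) * (1 - \<epsilon>^3)"
    proof -
      have "(p1 - p') * ?D = e + (17/20) * \<epsilon>" using D0 by (simp add: p1e p'_def field_simps)
      then show ?thesis by (metis mult.assoc mult.commute)
    qed
    ultimately show "p1 / p' * exp (- (p1 - p') * ((1 - \<epsilon>^3) * deg_sum J)) \<le> 1"
      unfolding dd(2)[symmetric] using dual_parameter(1)[OF eps e e30] by (simp only: mult_minus_left)
  qed
  moreover have "p' / p1 \<le> 1 - (17/10) * \<epsilon>"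
    using dual_parameter(2)[OF eps e e30] D0 by (simp add: p1e p'_def)
  ultimately show ?thesis by linarith
qed

text \<open>\<open>F1\<close> is an outcome of the first round in which every vertex has many walks
  of length two into big clusters and the big clusters cover many vertices; the probability concerns
  the second round alone. Each size \<open>k\<close> is treated separately by the escape
  bound.\<close>

lemma mid_range_prob:
  fixes \<epsilon> \<nu> a c c3 c4 K :: real
  defines "d \<equiv> deg_sum I" and "n \<equiv> card PV"
  assumes C: "1 < C" and eps: "0 < \<epsilon>" "\<epsilon> \<le> 1/100"
    and \<nu>: "0 < \<nu>" "\<nu> \<le> 1" and a: "a = \<epsilon>^3 / 120" and c3: "c3 = \<nu>^2 * a / (8 * real C^2)"
    and c4: "c4 = (\<epsilon>^3 / 20) ^ 5 * c3" and c: "c = c4 / 240"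
    and d: "2 \<le> d" "160 \<le> d * ln d" "384 / d^3 + C / d \<le> c4 / 4"
    and n: "20 \<le> \<epsilon> * n" and K: "1 \<le> K"
    and F1: "F1 \<subseteq> PE" and W: "\<And>v. v \<in> PV \<Longrightarrow> \<nu> * d^2 \<le> regular_host.walk2 PE (regular_host.big PV (d^3) F1) v"
    and B: "16/10 * \<epsilon> * n \<le> card (regular_host.big PV (d^3) F1)"
  shows "pex (1 - (1 - \<epsilon>^3 / (5 * d)) ^ 5) PE (\<lambda>F2. of_bool (\<exists>S\<subseteq>PV. conn (F1 \<union> F2) S \<and>
     K \<le> card S \<and> card S \<le> 3 * \<epsilon> * n / 2 \<and> card (bd (F1 \<union> F2) S) < c * card S * ln (n / card S) / (d * ln d) \<and>
     a * card S \<le> card {v\<in>S. d^3 \<le> card (cluster F1 S v)}))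
    \<le> n * exp (2 - c4 / 2 * (K / d))"
proof -
  interpret P: regular_host PV PE d unfolding d_def by (rule regular_PE)
  let ?q = "\<epsilon>^3 / (5 * real d)" and ?B = "P.big (d^3) F1"
  let ?p2 = "1 - (1 - ?q) ^ 5"
  have d0: "0 < real d" using d by simp
  have e3: "0 < \<epsilon>^3" "\<epsilon>^3 \<le> 1" using eps by (auto intro: power_le_one)
  have q: "0 \<le> ?q" "?q * d \<le> 1" "?q \<le> 1"
  proof -
    show "0 \<le> ?q" using e3 by simp
    show "?q * d \<le> 1" using e3 d0 by simp
    show "?q \<le> 1" using e3 d by (simp add: divide_le_eq)
  qed
  have p2: "0 \<le> ?p2" "?p2 \<le> 1" using q by (auto intro: power_le_one)
  have n0: "0 < real n" using n eps by (smt (verit) mult_nonneg_nonpos)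
  have a0: "0 < a" "a \<le> \<epsilon> / 40" "a \<le> 1/2"
  proof -
    show "0 < a" using a e3(1) by linarith
    have "\<epsilon>^3 \<le> \<epsilon>^1" using eps by (intro power_decreasing) auto
    then show "a \<le> \<epsilon> / 40" using a eps by simp
    then show "a \<le> 1/2" using eps by simp
  qed
  have Cr: "1 < real C" using C by simp
  have c30: "0 < c3" using c3 \<nu> a0 Cr by simp
  have c40: "0 < c4" unfolding c4 using c30 e3 by (intro mult_pos_pos) auto
  have lnC: "ln (real C) \<le> C" using ln_le_self[of "real C"] Cr by simp
  have lnn: "ln n \<le> d * real C"
  proof -
    have "real n \<le> real C ^ card I" using card_PV_bounds(2) unfolding n_def by (metis of_nat_le_iff of_nat_power)
    then have "ln n \<le> ln (real C ^ card I)" using n0 Cr by (subst ln_le_cancel_iff) auto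
    also have "\<dots> = card I * ln C" using Cr by (simp add: ln_realpow)
    also have "\<dots> \<le> d * real C"
    proof -
      have "card I \<le> d" using deg_sum_ge[of I] by (simp add: d_def)
      then show ?thesis using lnC Cr by (intro mult_mono) simp_all
    qed
    finally show ?thesis .
  qed
  have n2: "2 \<le> n"
  proof -
    have "\<epsilon> * real n \<le> 1 * real n" using eps n0 by (intro mult_right_mono) auto
    then show ?thesis using n by simp
  qed
  \<comment> \<open>Big clusters cover \<open>16/10 * \<epsilon> * n\<close> vertices and
    \<open>S\<close> at most \<open>15/10 * \<epsilon> * n\<close>; the difference remains as
    target. The hypothesis \<open>20 \<le> \<epsilon> * n\<close> absorbs the rounding.\<close>
  define T0 where "T0 = nat \<lfloor>\<epsilon> * n / 10\<rfloor>"
  have T0: "\<epsilon> * n / 20 \<le> T0" "T0 \<le> \<epsilon> * n / 10"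
  proof -
    have "0 \<le> \<epsilon> * n / 10" using eps by simp
    then show "T0 \<le> \<epsilon> * n / 10" unfolding T0_def by (rule of_nat_floor)
    have "\<epsilon> * n / 10 - 1 \<le> T0" unfolding T0_def by linarith
    then show "\<epsilon> * n / 20 \<le> T0" using n by linarith
  qed
  define b where "b k = nat \<lfloor>c * k * ln (n / k) / (d * ln d)\<rfloor>" for k :: nat
  define ks where "ks = {k. k \<le> n \<and> K \<le> real k \<and> real k \<le> 3 * \<epsilon> * n / 2}"
  let ?Q = "\<lambda>k F2. \<exists>S\<subseteq>PV. conn (F1 \<union> F2) S \<and> card S = k \<and>
      card (bd (F1 \<union> F2) S) \<le> b k \<and> a * k \<le> card {v\<in>S. d^3 \<le> card (cluster F1 S v)}"
  have fks: "finite ks" "card ks \<le> n"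
  proof -
    have "ks \<subseteq> {1..n}" using K by (auto simp: ks_def)
    then show "finite ks" "card ks \<le> n" using finite_subset card_mono[of "{1..n}" ks] by auto
  qed
  have "pex ?p2 PE (\<lambda>F2. of_bool (\<exists>S\<subseteq>PV. conn (F1 \<union> F2) S \<and>
     K \<le> card S \<and> card S \<le> 3 * \<epsilon> * n / 2 \<and> card (bd (F1 \<union> F2) S) < c * card S * ln (n / card S) / (d * ln d) \<and>
     a * card S \<le> card {v\<in>S. d^3 \<le> card (cluster F1 S v)}))
    \<le> (\<Sum>k\<in>ks. pex ?p2 PE (\<lambda>F2. of_bool (?Q k F2)))"
  proof (rule pex_union_bound[OF p2 fks(1)])
    fix F2 assume "\<exists>S\<subseteq>PV. conn (F1 \<union> F2) S \<and>
     K \<le> card S \<and> card S \<le> 3 * \<epsilon> * n / 2 \<and> card (bd (F1 \<union> F2) S) < c * card S * ln (n / card S) / (d * ln d) \<and>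
     a * card S \<le> card {v\<in>S. d^3 \<le> card (cluster F1 S v)}"
    then obtain S where S: "S \<subseteq> PV" "conn (F1 \<union> F2) S" "K \<le> card S" "card S \<le> 3 * \<epsilon> * n / 2"
      "card (bd (F1 \<union> F2) S) < c * card S * ln (n / card S) / (d * ln d)" "a * card S \<le> card {v\<in>S. d^3 \<le> card (cluster F1 S v)}"
      by blast
    have "card S \<in> ks" using S card_mono[OF finite_PV S(1)] by (simp add: ks_def n_def)
    moreover have "card (bd (F1 \<union> F2) S) \<le> b (card S)" unfolding b_def using S(5) by (simp add: le_nat_iff le_floor_iff)
    ultimately show "\<exists>k\<in>ks. ?Q k F2" using S by blast
  qed
  also have "\<dots> \<le> (\<Sum>k\<in>ks. exp (2 - c4 / 2 * (K / d)))"
  proof (rule sum_mono)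
    fix k assume k: "k \<in> ks"
    define L where "L = ln (n / k)"
    have k1: "1 \<le> real k" "K \<le> k" "k \<le> 3 * \<epsilon> * n / 2" "k \<le> n" using k K by (auto simp: ks_def)
    have k0: "0 < real k" using k1 by simp
    have L1: "1 \<le> L"
    proof -
      have "\<epsilon> * real n \<le> 1/100 * real n" using eps by (intro mult_right_mono) auto
      then have "real k \<le> 3/200 * real n" using k1(3) by linarith
      then have "3 * real k \<le> n" using k0 by linarith
      then have "3 \<le> n / k" using k0 by (simp add: field_simps)
      then have "exp 1 \<le> n / k" using e_less_272 by linarith
      then show ?thesis unfolding L_def using k0 n0 by (subst ln_ge_iff) auto
    qed
    have Ld: "L \<le> d * real C"
    proof -
      have "L = ln n - ln k" unfolding L_def using k0 n0 by (simp add: ln_div)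
      moreover have "0 \<le> ln (real k)" using k1 by simp
      ultimately show ?thesis using lnn by linarith
    qed
    have kLn: "k * L \<le> n"
    proof -
      have "L \<le> n / k - 1" unfolding L_def using k0 n0 by (intro ln_le_minus_one) simp
      then have "k * L \<le> k * (n / k - 1)" using k0 by (intro mult_left_mono) auto
      then show ?thesis using k0 by (simp add: right_diff_distrib)
    qed
    \<comment> \<open>\<open>h\<close> is half of the guaranteed number of walks, so that every
      vertex has at least \<open>h\<close> walks to \<open>W\<close> or to the rest of the big
      vertices. \<open>c3\<close> is small enough to keep \<open>\<Phi>\<close> below three bounds:
      the first uses \<open>L \<le> d * C\<close>, the second \<open>k * L \<le> n\<close>, the
      third isoperimetry.\<close>
    define h where "h = \<nu> * d^2 / 2"
    define \<Phi> where "\<Phi> = c3 * d^4 * k * L"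
    have d4: "0 \<le> real d ^ 4" by simp
    have \<Phi>1: "\<Phi> \<le> d * h * (real d ^ 2 * (a * k) / 2)"
    proof -
      have "c3 * C \<le> \<nu> * a / 4"
      proof -
        have "c3 * C = \<nu> * a / 4 * (\<nu> / (2 * C))" using Cr by (simp add: c3 power2_eq_square)
        also have "\<dots> \<le> \<nu> * a / 4 * 1" using \<nu> a0 Cr by (intro mult_left_mono) (auto simp: divide_le_eq)
        finally show ?thesis by simp
      qed
      have "\<Phi> \<le> c3 * d^4 * k * (d * real C)" unfolding \<Phi>_def using Ld c30 by (intro mult_left_mono) auto
      also have "\<dots> = (c3 * C) * (real d^5 * k)" by (simp add: numeral_eq_Suc algebra_simps)
      also have "\<dots> \<le> \<nu> * a / 4 * (real d^5 * k)" using \<open>c3 * C \<le> _\<close> by (intro mult_right_mono) auto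
      also have "\<dots> = d * h * (real d ^ 2 * (a * k) / 2)" by (simp add: h_def numeral_eq_Suc algebra_simps)
      finally show ?thesis .
    qed
    have \<Phi>2: "\<Phi> \<le> d * h * (real d ^ 2 * T0 / 2)"
    proof -
      have "c3 \<le> \<nu> * \<epsilon> / 80"
      proof -
        have C1: "1 \<le> real C^2" using Cr by simp
        have "\<nu> * a \<le> 1 * a" using \<nu> a0 by (intro mult_right_mono) auto
        moreover have "a * 1 \<le> a * (8 * real C^2)" using C1 a0 by (intro mult_left_mono) auto
        ultimately have "\<nu> * a / (8 * real C^2) \<le> a" using C1 a0 by (simp add: divide_le_eq)
        moreover have "\<epsilon>^3 \<le> \<epsilon>^1" using eps by (intro power_decreasing) auto
        then have "a \<le> \<epsilon> / 80" using a eps by simp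
        ultimately have "\<nu> * a / (8 * real C^2) \<le> \<epsilon> / 80" by (rule order_trans)
        then have "\<nu> * (\<nu> * a / (8 * real C^2)) \<le> \<nu> * (\<epsilon> / 80)" using \<nu> by (intro mult_left_mono) auto
        then show ?thesis by (simp add: c3 power2_eq_square)
      qed
      have "\<Phi> = c3 * d^4 * (k * L)" by (simp add: \<Phi>_def)
      also have "\<dots> \<le> c3 * d^4 * n" using kLn c30 by (intro mult_left_mono) auto
      also have "\<dots> \<le> \<nu> * \<epsilon> / 80 * d^4 * n" using \<open>c3 \<le> _\<close> by (intro mult_right_mono) auto
      also have "\<dots> = \<nu> * d^4 / 4 * (\<epsilon> * n / 20)" by simp
      also have "\<dots> \<le> \<nu> * d^4 / 4 * T0" using T0 \<nu> by (intro mult_left_mono) auto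
      also have "\<dots> \<le> d * (\<nu> * d^4 / 4 * T0)"
        using d \<nu> mult_right_mono[of 1 "real d" "\<nu> * d^4 / 4 * T0"] by simp
      also have "\<dots> = d * h * (real d ^ 2 * T0 / 2)" by (simp add: h_def numeral_eq_Suc algebra_simps)
      finally show ?thesis .
    qed
    have \<Phi>3: "\<Phi> \<le> h ^ 2 * card (bd PE A)" if A: "A \<subseteq> PV" "a * k / 2 \<le> card A" "card A \<le> card PV - T0 / 2" for A
    proof -
      have "0 < a * k / 2" using a0 k0 by simp
      then have Ane: "A \<noteq> {}" using A(2) by auto
      have "a / 2 * (k * ln (n / k)) \<le> card A * ln (n / card A)"
      proof (rule scaled_entropy_lower[of a "\<epsilon> / 40"])
        \<comment> \<open>Half of \<open>T0 \<ge> \<epsilon> * n / 20\<close> vertices are missing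
          from \<open>A\<close>, which gives \<open>\<eta> = \<epsilon> / 40\<close>.\<close>
        show "real (card A) \<le> (1 - \<epsilon> / 40) * real n" using A(3) T0 unfolding n_def[symmetric] by (simp add: algebra_simps)
      qed (use a0 eps k1 k0 A in auto)
      also have "\<dots> \<le> C * ln C * card (bd PE A)" using edge_isoperimetry[OF A(1) Ane] by (simp add: n_def)
      also have "\<dots> \<le> real C * real C * real (card (bd PE A))" using lnC Cr by (intro mult_right_mono mult_left_mono) auto
      finally have i: "a / 2 * (k * L) \<le> real C^2 * card (bd PE A)" by (simp add: L_def power2_eq_square)
      have "\<Phi> = h^2 / real C^2 * (a / 2 * (k * L))" using Cr by (simp add: \<Phi>_def h_def c3 power_mult_distrib power_divide field_simps)
      also have "\<dots> \<le> h^2 / real C^2 * (real C^2 * card (bd PE A))" using i by (intro mult_left_mono) auto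
      also have "\<dots> = h^2 * card (bd PE A)" using Cr by simp
      finally show ?thesis .
    qed
    have th: "0 < 1 / real d ^ 10" "1 / real d ^ 10 \<le> 1/2"
    proof -
      have "(2::real) ^ 1 \<le> 2 ^ 10" by simp
      also have "\<dots> \<le> real d ^ 10" using d by (intro power_mono) auto
      finally show "1 / real d ^ 10 \<le> 1/2" using d0 by (simp add: field_simps)
    qed (use d0 in simp)
    have "pex ?p2 PE (\<lambda>F2. of_bool (?Q k F2))
      \<le> real (card PV) ^ (k div d^3) * exp 2 * ((1 / (1 / real d ^ 10)) ^ (3 * b k) * exp (2 * (1 / real d ^ 10) * (3 * k * Suc d ^ 6))) *
       exp (- ((?q / 4) ^ 5 * (\<Phi> - 160 * real (b k) * real d ^ 4)))"
    proof (rule P.escape_prob[OF q F1 _ _ th, where h=h and ?T0.0=T0])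
      show "1 \<le> d^3" using d by simp
      show "2 \<le> card PV" using n2 by (simp add: n_def)
      show "0 \<le> h" using \<nu> by (simp add: h_def)
      show "\<And>v. v \<in> PV \<Longrightarrow> 2 * h \<le> P.walk2 ?B v" using W by (simp add: h_def)
      have "real k + real T0 \<le> 16/10 * \<epsilon> * n" using k1(3) T0 by simp
      then show "k + T0 \<le> card ?B" using B by linarith
    qed (use \<Phi>1 \<Phi>2 \<Phi>3 in auto)
    also have "\<dots> \<le> exp (2 - c4 / 2 * (k / d))"
    proof -
      have N: "real (3 * k * Suc d ^ 6) \<le> 3 * k * (2 * real d) ^ 6"
      proof -
        have "real (Suc d) ^ 6 \<le> (2 * real d) ^ 6" using d by (intro power_mono) auto
        then have "real (3 * k) * real (Suc d) ^ 6 \<le> real (3 * k) * (2 * real d) ^ 6" by (intro mult_left_mono) auto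
        then show ?thesis by (simp only: of_nat_mult of_nat_power of_nat_numeral)
      qed
      have "0 \<le> c" "0 \<le> ln (real d)" using c c40 d(1) by auto
      then have "0 \<le> c * k * L / (d * ln d)" using L1 by simp
      then have bk: "real (b k) \<le> c * k * L / (d * ln d)" unfolding b_def L_def by (rule of_nat_floor)
      have m3: "real (d^3) = real d ^ 3" by simp
      have d2: "2 \<le> real d" "160 \<le> real d * ln (real d)" using d by auto
      have n1: "1 \<le> real n" using n2 by simp
      show ?thesis unfolding \<Phi>_def n_def[symmetric]
        using escape_exponent[OF eps d2(1) c4 c c30 L1 n1 lnn bk N m3 d2(2) d(3)]
        by (simp only: of_nat_mult of_nat_power of_nat_numeral)
    qed
    also have "\<dots> \<le> exp (2 - c4 / 2 * (K / d))"
    proof -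
      have "0 \<le> c4 / 2" using c40 by simp
      moreover have "K / d \<le> k / d" using k1 d0 by (intro divide_right_mono) auto
      ultimately have "c4 / 2 * (K / d) \<le> c4 / 2 * (k / d)" by (intro mult_left_mono)
      then show ?thesis by simp
    qed
    finally show "pex ?p2 PE (\<lambda>F2. of_bool (?Q k F2)) \<le> exp (2 - c4 / 2 * (K / d))" .
  qed
  also have "\<dots> = card ks * exp (2 - c4 / 2 * (K / d))" by simp
  also have "\<dots> \<le> n * exp (2 - c4 / 2 * (K / d))" using fks by (intro mult_right_mono) auto
  finally show ?thesis .
qed

section \<open>The failure probability\<close>

text \<open>The four terms belong to four kinds of failure: missing expansion of small connected
  sets (counted at outer and at inner endpoints, hence the \<open>2\<close>), a vertex with few
  walks into big clusters, too few big vertices, and a set of the middle range with small boundary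
  although the first round was good.\<close>

lemma failure_prob_le:
  fixes \<epsilon> \<gamma> \<nu> a c c3 c4 K k0 :: real and d n r :: nat
  assumes dn: "d = deg_sum I" "n = card PV" and C: "1 < C" and eps: "0 < \<epsilon>" "\<epsilon> \<le> 1 / (100 * real C)"
    and \<gamma>: "\<gamma> = \<epsilon> / (400 * real C)" and \<nu>: "\<nu> = 2/5 * \<epsilon> * \<gamma>^2 / real C^2"
    and a: "a = \<epsilon>^3 / 120" and c3: "c3 = \<nu>^2 * a / (8 * real C^2)"
    and c4: "c4 = (\<epsilon>^3 / 20) ^ 5 * c3" and c: "c = c4 / 240"
    and k0: "k0 = 9 * ln C * d / \<epsilon>^2" and K: "K = n powr (\<epsilon>^5)"
    and A: "A1 \<subseteq> I" "A2 \<subseteq> I" "A1 \<inter> A2 = {}" "card A1 = r" "card A2 = r"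
    and r: "\<gamma> * card I / 2 \<le> r" "r \<le> \<gamma> * card I"
    and d: "1 / d \<le> \<epsilon>^3" "2 \<le> d" "160 \<le> d * ln d" "384 / real d^3 + C / d \<le> c4 / 4"
      "6 * C * ln d / ln 2 \<le> \<epsilon>^3 * d" "9 * ln C / \<epsilon>^2 \<le> d"
    and n: "20 \<le> \<epsilon> * n" and Kd: "d * d^3 * d^2 + d^3 + d^2 \<le> K"
  shows "pex ((1 + \<epsilon>) / d) PE (\<lambda>F. of_bool (\<exists>S\<subseteq>PV. conn F S \<and>
      (k0 \<le> card S \<and> card S \<le> K \<and> card (vertex_boundary (Graph PV F) S) < c * card S \<or>
       K \<le> card S \<and> card S \<le> 3 * \<epsilon> * n / 2 \<and> card (bd F S) < c * card S * ln (n / card S) / (d * ln d))))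
    \<le> 2 * (n * exp (- (\<epsilon>^2 / 4 * k0))) + n * exp (- (real r * real r * (\<epsilon>/10)^2 / 2))
      + exp (- (2 ^ (2 * r) * (\<epsilon>/10)^2 / 2)) + n * exp (2 - c4 / 2 * (K / d))"
proof -
  interpret P: regular_host PV PE d unfolding dn by (rule regular_PE)
  let ?p = "(1 + \<epsilon>) / d" and ?q = "\<epsilon>^3 / (5 * real d)"
  let ?p2 = "1 - (1 - ?q) ^ 5"
  let ?p1 = "1 - (1 - ?p) / (1 - ?q) ^ 5"
  let ?J = "I - (A1 \<union> A2)"
  have d0: "0 < real d" using d by simp
  have Cr: "1 < real C" using C by simp
  have epsC: "\<epsilon> * C \<le> 1 / 100" using eps Cr by (simp add: field_simps)
  have "\<epsilon> * 1 \<le> \<epsilon> * C" using eps Cr by (intro mult_left_mono) auto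
  then have e100: "\<epsilon> \<le> 1/100" using epsC by linarith
  have e3: "0 < \<epsilon>^3" "\<epsilon>^3 \<le> \<epsilon>"
  proof -
    have "\<epsilon>^3 \<le> \<epsilon>^1" using eps e100 by (intro power_decreasing) auto
    then show "\<epsilon>^3 \<le> \<epsilon>" by simp
  qed (use eps in simp)
  have lnC: "ln (real C) \<le> C" "0 < ln (real C)" using ln_le_self[of "real C"] Cr by auto
  have n0: "0 < real n" using n eps by (smt (verit) mult_nonneg_nonpos)
  have cId: "card I \<le> d" using deg_sum_ge[of I] by (simp add: dn)
  have dCI: "real d \<le> C * card I" using deg_sum_le[of I] unfolding dn by (metis order_refl of_nat_le_iff of_nat_mult mult.commute)
  have lnn: "ln n \<le> d * ln (real C)"
  proof -
    have "real n \<le> real C ^ card I" using card_PV_bounds(2) unfolding dn by (metis of_nat_le_iff of_nat_power)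
    then have "ln n \<le> ln (real C ^ card I)" using n0 Cr by (subst ln_le_cancel_iff) auto
    also have "\<dots> = card I * ln C" using Cr by (simp add: ln_realpow)
    also have "\<dots> \<le> d * ln C" using cId lnC by (intro mult_right_mono) auto
    finally show ?thesis .
  qed
  have q: "0 \<le> ?q" "?q < 1" "5 * ?q = \<epsilon>^3 / d"
  proof -
    show "0 \<le> ?q" using e3 by simp
    have "\<epsilon>^3 < 5 * real d" using e3 e100 d by simp
    then show "?q < 1" using d0 by (simp add: divide_less_eq)
  qed simp
  have p: "5 * ?q \<le> ?p" "?p \<le> 1"
  proof -
    show "5 * ?q \<le> ?p" unfolding q(3) using e3 eps d0 by (intro divide_right_mono) auto
    show "?p \<le> 1" using e100 d d0 by (simp add: divide_le_eq)
  qed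
  note tr = two_round_parameters[OF q(1,2) p]
  have p1: "(1 + \<epsilon> - \<epsilon>^3) / d \<le> ?p1" "?p1 \<le> ?p"
    using tr(2,3) unfolding q(3) by (simp_all add: diff_divide_distrib)
  have p2: "0 \<le> ?p2" "?p2 \<le> 1" using q by (auto intro: power_le_one)
  have p1b: "0 \<le> ?p1" "?p1 \<le> 1"
  proof -
    have "0 \<le> (1 + \<epsilon> - \<epsilon>^3) / d" using e3 by simp
    then show "0 \<le> ?p1" using p1(1) by linarith
    show "?p1 \<le> 1" using p1(2) p(2) by linarith
  qed
  have \<gamma>b: "0 < \<gamma>" "\<gamma> \<le> 1" unfolding \<gamma> using eps Cr e100 by (auto simp: divide_le_eq)
  have \<nu>b: "0 < \<nu>" "\<nu> \<le> 1"
  proof -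
    show "0 < \<nu>" unfolding \<nu> using eps \<gamma>b Cr by simp
    have "2/5 * \<epsilon> * \<gamma>^2 \<le> 1 * 1" using eps e100 \<gamma>b by (intro mult_mono power_le_one) auto
    moreover have "1 \<le> real C^2" using Cr by simp
    ultimately show "\<nu> \<le> 1" unfolding \<nu> by (simp add: divide_le_eq)
  qed
  have a0: "0 < a" using a e3 by linarith
  have C2: "1 \<le> real C^2" using Cr by simp
  have c3b: "0 < c3" "c3 * C \<le> a / 8"
  proof -
    show "0 < c3" unfolding c3 using \<nu>b a0 Cr by simp
    have "c3 * C = \<nu>^2 * a / (8 * C)" using Cr by (simp add: c3 power2_eq_square)
    also have "\<dots> \<le> 1 * a / 8" using \<nu>b a0 Cr by (intro frac_le mult_mono power_le_one) auto
    finally show "c3 * C \<le> a / 8" by simp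
  qed
  have c4b: "0 < c4" "c4 \<le> c3"
  proof -
    show "0 < c4" unfolding c4 using c3b e3 by (intro mult_pos_pos) auto
    have "(\<epsilon>^3 / 20) ^ 5 \<le> 1" using e3 e100 by (intro power_le_one) auto
    then show "c4 \<le> c3" unfolding c4 using c3b by (simp add: mult_left_le_one_le)
  qed
  have cb: "0 \<le> c" "c * C \<le> a / 2" "c \<le> 2 * a"
  proof -
    show "0 \<le> c" using c c4b by simp
    have "c \<le> c3" using c c4b by simp
    then have "c * C \<le> c3 * C" using Cr by (intro mult_right_mono) auto
    then show "c * C \<le> a / 2" using c3b a0 by linarith
    moreover have "c * 1 \<le> c * C" using Cr \<open>0 \<le> c\<close> by (intro mult_left_mono) auto
    ultimately show "c \<le> 2 * a" using a0 by linarith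
  qed
  have cA: "2 * a * (- ln (\<epsilon>^3)) \<le> \<epsilon>^2 / 20" "0 \<le> 2 * a"
  proof -
    \<comment> \<open>The origin of \<open>a = \<epsilon>^3 / 120\<close>: since
      \<open>- ln (\<epsilon>^3) \<le> 3 / \<epsilon>\<close>, it makes
      \<open>2 * a * 3 / \<epsilon>\<close> equal to \<open>\<epsilon>^2 / 20\<close>, the allowance
      in the expansion bound.\<close>
    have "ln (1 / \<epsilon>) \<le> 1 / \<epsilon>" using eps by (intro ln_le_self) simp
    then have "- ln (\<epsilon>^3) \<le> 3 / \<epsilon>" using eps by (simp add: ln_realpow ln_div)
    then have "2 * a * (- ln (\<epsilon>^3)) \<le> 2 * a * (3 / \<epsilon>)" using a0 by (intro mult_left_mono) auto
    also have "\<dots> = \<epsilon>^2 / 20" using eps by (simp add: a numeral_eq_Suc field_simps)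
    finally show "2 * a * (- ln (\<epsilon>^3)) \<le> \<epsilon>^2 / 20" .
  qed (use a0 in simp)
  have K1: "1 \<le> K" unfolding K using n0 eps by (intro ge_one_powr_ge_zero) auto
  have lnK: "ln K \<le> \<epsilon>^5 * (real d * real C)"
  proof -
    have "ln K = \<epsilon>^5 * ln n" using n0 by (simp add: K ln_powr)
    also have "\<dots> \<le> \<epsilon>^5 * (real d * real C)"
    proof (rule mult_left_mono)
      have "d * ln (real C) \<le> real d * real C" using lnC by (intro mult_left_mono) auto
      then show "ln n \<le> real d * real C" using lnn by linarith
    qed (use eps in simp)
    finally show ?thesis .
  qed
  have iso: "(1 - \<epsilon>^3) * d * card S \<le> card (bd PE S)" if S: "S \<subseteq> PV" "S \<noteq> {}" "card S \<le> K" for S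
  proof -
    define Kn where "Kn = nat \<lfloor>K\<rfloor>"
    have Kn: "card S \<le> Kn" "1 \<le> Kn" "real Kn \<le> K" using S(3) K1 by (auto simp: Kn_def le_nat_iff le_floor_iff)
    have "C * (ln Kn / ln 2) \<le> \<epsilon>^3 * d"
    proof -
      have "ln Kn \<le> ln K" using Kn K1 by (subst ln_le_cancel_iff) auto
      then have "ln Kn \<le> \<epsilon>^5 * (real d * real C)" using lnK by linarith
      moreover have "1/2 \<le> ln (2::real)" using ln2_ge_two_thirds by simp
      ultimately have "ln Kn / ln 2 \<le> \<epsilon>^5 * (real d * real C) / (1/2)" using eps by (intro frac_le) auto
      then have "C * (ln Kn / ln 2) \<le> C * (\<epsilon>^5 * (real d * real C) * 2)" by (intro mult_left_mono) auto
      \<comment> \<open>The exponent \<open>5\<close> is \<open>3 + 2\<close>: a loss of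
        \<open>\<kappa> = \<epsilon>^3\<close> is tolerated, and the other
        \<open>\<epsilon>^2\<close> cancels \<open>C^2\<close> since
        \<open>\<epsilon> * C \<le> 1 / 100\<close>.\<close>
      also have "\<dots> = \<epsilon>^3 * d * (2 * (\<epsilon> * C) * (\<epsilon> * C))" by (simp add: numeral_eq_Suc algebra_simps)
      also have "\<dots> \<le> \<epsilon>^3 * d * 1"
      proof (rule mult_left_mono)
        have "(\<epsilon> * C) * (\<epsilon> * C) \<le> 1/100 * (1/100)" using epsC eps by (intro mult_mono) auto
        then show "2 * (\<epsilon> * C) * (\<epsilon> * C) \<le> 1" by linarith
      qed (use e3 in simp)
      finally show ?thesis by simp
    qed
    then show ?thesis using small_set_isoperimetry[of I S undefined Kn "\<epsilon>^3"] S Kn C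
      by (simp only: VJ_I EJ_I dn[symmetric]) simp
  qed
  have D: "(1 - \<epsilon> / 200) * d \<le> deg_sum ?J"
  proof -
    have AI: "A1 \<union> A2 \<subseteq> I" using A by blast
    have "deg_sum (A1 \<union> A2) \<le> card (A1 \<union> A2) * C" using AI by (rule deg_sum_le)
    also have "\<dots> \<le> (r + r) * C" using card_Un_le[of A1 A2] A by (intro mult_right_mono) auto
    finally have "real (deg_sum (A1 \<union> A2)) \<le> 2 * real r * C" by (metis mult_2 of_nat_add of_nat_le_iff of_nat_mult)
    also have "\<dots> \<le> 2 * (\<gamma> * card I) * C" using r by (intro mult_right_mono mult_left_mono) auto
    also have "\<dots> = \<epsilon> / 200 * card I" using Cr by (simp add: \<gamma>)
    also have "\<dots> \<le> \<epsilon> / 200 * d" using cId eps by (intro mult_left_mono) auto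
    finally have 1: "real (deg_sum (A1 \<union> A2)) \<le> \<epsilon> / 200 * d" .
    have "d = deg_sum ?J + deg_sum (A1 \<union> A2)" unfolding dn by (rule sum.subset_diff[OF AI finI])
    then have "real d = real (deg_sum ?J) + real (deg_sum (A1 \<union> A2))" by (metis of_nat_add)
    moreover have "(1 - \<epsilon> / 200) * real d = real d - \<epsilon> / 200 * real d" by (simp only: left_diff_distrib mult_1)
    ultimately show ?thesis using 1 by linarith
  qed
  let ?m = "d^3"
  let ?big = "\<lambda>F1. P.big ?m F1"
  have mean: "17/10 * \<epsilon> \<le> pex ?p1 PE (\<lambda>F. of_bool (?m \<le> card (cluster (F \<inter> EJ ?J x) (VJ ?J x) x)))" if x: "x \<in> PV" for x
  proof (rule copy_mean[OF dn(1) refl eps(1) e100 C _ D d(2) p1 _ _ x])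
    show "1 \<le> ?m" using d by simp
    have "C * (ln (real ?m) / ln 2) = 6 * C * ln d / ln 2 / 2" using d0 by (simp add: ln_realpow)
    also have "\<dots> \<le> \<epsilon>^3 * d / 2" using d(5) by simp
    also have "\<dots> \<le> \<epsilon>^3 * deg_sum ?J"
    proof -
      have "d / 2 \<le> (1 - \<epsilon> / 200) * d" using e100 d0 by simp
      then have "d / 2 \<le> real (deg_sum ?J)" using D by linarith
      then have "\<epsilon>^3 * (d / 2) \<le> \<epsilon>^3 * deg_sum ?J" using e3 by (intro mult_left_mono) auto
      then show ?thesis by (simp only: times_divide_eq_right)
    qed
    finally show "C * (ln (real ?m) / ln 2) \<le> \<epsilon>^3 * deg_sum ?J" .
  qed blast
  \<comment> \<open>The requirement \<open>2 * a\<close> is twice what the middle range needs: one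
    half is given up for the boundary edges of \<open>S\<close>, of which there are at most
    \<open>a * card S\<close> when (b) fails.\<close>
  define X where "X N F1 F2 = (\<exists>S\<subseteq>PV. conn (F1 \<union> F2) S \<and> k0 \<le> card S \<and> card S \<le> K \<and>
      card {v\<in>N S. F1 \<inter> P.edges_at S v \<noteq> {}} < 2 * a * card S)" for N F1 F2
  have Xp: "pex ?p1 PE (\<lambda>F1. pex ?p2 PE (\<lambda>F2. of_bool (X N F1 F2))) \<le> n * exp (- (\<epsilon>^2 / 4 * k0))"
    if N: "\<And>S. N S = S \<or> N S = PV - S" for N
    unfolding X_def dn(2)
    by (rule P.expansion_prob[OF eps(1) e100 d(1,2) refl p1 tr(1) p2 cA less_imp_le[OF e3(1)] order_refl iso N])
  define Y1 where "Y1 F1 = (\<exists>v\<in>PV. P.walk2 (?big F1) v < real r * real r * (17/10 * \<epsilon> - \<epsilon>/10))" for F1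
  have Y1p: "pex ?p1 PE (\<lambda>F1. of_bool (Y1 F1)) \<le> n * exp (- (real r * real r * (\<epsilon>/10)^2 / 2))"
  proof -
    have "pex ?p1 PE (\<lambda>F1. of_bool (Y1 F1)) \<le>
      (\<Sum>v\<in>PV. pex ?p1 PE (\<lambda>F1. of_bool (P.walk2 (?big F1) v < real r * real r * (17/10 * \<epsilon> - \<epsilon>/10))))"
      by (rule pex_union_bound[OF p1b finite_PV]) (simp add: Y1_def)
    also have "\<dots> \<le> (\<Sum>v\<in>PV. exp (- (real r * real r * (\<epsilon>/10)^2 / 2)))"
    proof (rule sum_mono)
      fix v assume v: "v \<in> PV"
      show "pex ?p1 PE (\<lambda>F1. of_bool (P.walk2 (?big F1) v < real r * real r * (17/10 * \<epsilon> - \<epsilon>/10)))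
        \<le> exp (- (real r * real r * (\<epsilon>/10)^2 / 2))"
        using walk2_big_prob[OF p1b A(1,2,3) v mean, of "\<epsilon>/10"] eps A(4,5) by simp
    qed
    finally show ?thesis by (simp add: dn)
  qed
  define Y2 where "Y2 F1 = (card (?big F1) < n * (17/10 * \<epsilon> - \<epsilon>/10))" for F1
  have Y2p: "pex ?p1 PE (\<lambda>F1. of_bool (Y2 F1)) \<le> exp (- (2 ^ (2 * r) * (\<epsilon>/10)^2 / 2))"
  proof -
    have "I - ?J = A1 \<union> A2" using A by blast
    then have "card (I - ?J) = 2 * r" using A finI finite_subset[of _ I] by (simp add: card_Un_disjoint)
    then show ?thesis unfolding Y2_def dn(2)
      using card_big_prob[OF p1b _ mean, of "\<epsilon>/10"] eps by (simp add: Diff_subset)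
  qed
  define Z where "Z F1 F2 = (\<exists>S\<subseteq>PV. conn (F1 \<union> F2) S \<and>
     K \<le> card S \<and> card S \<le> 3 * \<epsilon> * n / 2 \<and> card (bd (F1 \<union> F2) S) < c * card S * ln (n / card S) / (d * ln d) \<and>
     a * card S \<le> card {v\<in>S. ?m \<le> card (cluster F1 S v)})" for F1 F2
  \<comment> \<open>With \<open>card I \<ge> d / C\<close> and
    \<open>r \<ge> \<gamma> * card I / 2\<close>, the number of walks is at least
    \<open>(\<gamma> * d / (2 * C))^2 * 16/10 * \<epsilon>\<close>; this is how \<open>\<nu>\<close>
    is defined.\<close>
  have rd: "\<nu> * real d^2 \<le> real r * real r * (17/10 * \<epsilon> - \<epsilon>/10)"
  proof -
    have "\<gamma> * (d / C) / 2 \<le> \<gamma> * card I / 2"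
      using dCI \<gamma>b Cr by (intro divide_right_mono mult_left_mono) (auto simp: divide_le_eq mult.commute)
    then have "\<gamma> * (d / C) / 2 \<le> r" using r by linarith
    then have "(\<gamma> * (d / C) / 2) * (\<gamma> * (d / C) / 2) \<le> real r * real r" using \<gamma>b Cr by (intro mult_mono) auto
    then have "(\<gamma> * (d / C) / 2) * (\<gamma> * (d / C) / 2) * (16/10 * \<epsilon>) \<le> real r * real r * (16/10 * \<epsilon>)"
      using eps by (intro mult_right_mono) auto
    moreover have "(\<gamma> * (d / C) / 2) * (\<gamma> * (d / C) / 2) * (16/10 * \<epsilon>) = \<nu> * real d^2"
      using Cr by (simp add: \<nu> power2_eq_square)
    ultimately show ?thesis by simp
  qed
  \<comment> \<open>The success of the first round is put into the indicator, so that the bound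
    holds for every fixed \<open>F1\<close>.\<close>
  have Zp: "pex ?p2 PE (\<lambda>F2. of_bool (\<not> Y1 F1 \<and> \<not> Y2 F1 \<and> Z F1 F2)) \<le> n * exp (2 - c4 / 2 * (K / d))"
    if F1: "F1 \<subseteq> PE" for F1
  proof (cases "Y1 F1 \<or> Y2 F1")
    case True
    then have "(\<lambda>F2. of_bool (\<not> Y1 F1 \<and> \<not> Y2 F1 \<and> Z F1 F2)) = (\<lambda>F2. 0 :: real)" by auto
    then show ?thesis using P.finE by (simp add: pex_const)
  next
    case False
    have W: "\<nu> * real (deg_sum I)^2 \<le> P.walk2 (P.big ((deg_sum I)^3) F1) v" if v: "v \<in> PV" for v
    proof -
      have "real r * real r * (17/10 * \<epsilon> - \<epsilon>/10) \<le> P.walk2 (?big F1) v" using False v by (force simp: Y1_def not_less)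
      then show ?thesis using rd unfolding dn(1)[symmetric] by simp
    qed
    have B: "16/10 * \<epsilon> * card PV \<le> card (P.big ((deg_sum I)^3) F1)"
      using False unfolding dn[symmetric] Y2_def by (simp add: algebra_simps)
    have "pex ?p2 PE (\<lambda>F2. of_bool (Z F1 F2)) \<le> n * exp (2 - c4 / 2 * (K / d))"
      unfolding Z_def dn
      by (rule mid_range_prob[OF C eps(1) e100 \<nu>b a c3 c4 c d(2-4)[unfolded dn] n[unfolded dn] K1 F1 W B])
    then show ?thesis using False by simp
  qed
  have cover: "of_bool (\<exists>S\<subseteq>PV. conn (F1 \<union> F2) S \<and>
      (k0 \<le> card S \<and> card S \<le> K \<and> card (vertex_boundary (Graph PV (F1 \<union> F2)) S) < c * card S \<or>
       K \<le> card S \<and> card S \<le> 3 * \<epsilon> * n / 2 \<and> card (bd (F1 \<union> F2) S) < c * card S * ln (n / card S) / (d * ln d)))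
     \<le> of_bool (X (\<lambda>S. PV - S) F1 F2) + of_bool (X (\<lambda>S. S) F1 F2) + of_bool (Y1 F1) + of_bool (Y2 F1)
        + (of_bool (\<not> Y1 F1 \<and> \<not> Y2 F1 \<and> Z F1 F2) :: real)"
    if F: "F1 \<subseteq> PE" "F2 \<subseteq> PE" for F1 F2
  proof -
    have FE: "F1 \<union> F2 \<subseteq> PE" using F by blast
    have "X (\<lambda>S. PV - S) F1 F2 \<or> X (\<lambda>S. S) F1 F2 \<or> Z F1 F2"
      if S: "S \<subseteq> PV" "conn (F1 \<union> F2) S" and
       cs: "k0 \<le> card S \<and> card S \<le> K \<and> card (vertex_boundary (Graph PV (F1 \<union> F2)) S) < c * card S \<or>
       K \<le> card S \<and> card S \<le> 3 * \<epsilon> * n / 2 \<and> card (bd (F1 \<union> F2) S) < c * card S * ln (n / card S) / (d * ln d)" for S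
      using cs
    proof
      assume h: "k0 \<le> card S \<and> card S \<le> K \<and> card (vertex_boundary (Graph PV (F1 \<union> F2)) S) < c * card S"
      have "{v\<in>PV - S. F1 \<inter> P.edges_at S v \<noteq> {}} \<subseteq> vertex_boundary (Graph PV (F1 \<union> F2)) S"
      proof
        fix v assume v: "v \<in> {v\<in>PV - S. F1 \<inter> P.edges_at S v \<noteq> {}}"
        then obtain e where e: "e \<in> F1" "e \<in> bd PE S" "v \<in> e" by (auto simp: P.edges_at_def)
        then obtain x y where "x \<in> S" "y \<notin> S" "e = {x,y}" using P.bd_iff[OF order_refl] by blast
        then show "v \<in> vertex_boundary (Graph PV (F1 \<union> F2)) S" using v e by (auto simp: vertex_boundary_def)
      qed
      moreover have "finite (vertex_boundary (Graph PV (F1 \<union> F2)) S)"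
        using finite_PV by (auto simp: vertex_boundary_def)
      ultimately have "card {v\<in>PV - S. F1 \<inter> P.edges_at S v \<noteq> {}} \<le> card (vertex_boundary (Graph PV (F1 \<union> F2)) S)"
        by (intro card_mono)
      moreover have "c * card S \<le> 2 * a * card S" using cb by (intro mult_right_mono) auto
      ultimately have "X (\<lambda>S. PV - S) F1 F2" unfolding X_def using S h by (intro exI[of _ S]) auto
      then show ?thesis by blast
    next
      assume h: "K \<le> card S \<and> card S \<le> 3 * \<epsilon> * n / 2 \<and> card (bd (F1 \<union> F2) S) < c * card S * ln (n / card S) / (d * ln d)"
      show ?thesis
      proof (cases "X (\<lambda>S. S) F1 F2")
        case False
        \<comment> \<open>Pieces have between \<open>d^2\<close> and about \<open>d^6\<close>
          vertices. The lower bound exceeds \<open>k0\<close>, the upper one stays below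
          \<open>K\<close>, so every piece lies in the range where failure of \<open>X\<close>
          provides expansion.\<close>
        have inner: "2 * a * card U \<le> card {v\<in>U. F1 \<inter> {e\<in>bd PE U. v \<in> e} \<noteq> {}}"
          if U: "U \<subseteq> PV" "conn (F1 \<union> F2) U" "d^2 \<le> card U" "card U \<le> d * ?m * d^2 + ?m + d^2" for U
        proof -
          have "k0 = 9 * ln C / \<epsilon>^2 * d" by (simp add: k0)
          also have "\<dots> \<le> real d * real d" using d(6) by (intro mult_right_mono) auto
          also have "\<dots> \<le> card U" using U(3) by (simp add: power2_eq_square flip: of_nat_mult)
          finally have "k0 \<le> card U" .
          moreover have "card U \<le> K" using U(4) Kd by linarith
          ultimately show ?thesis using False U(1,2) unfolding X_def P.edges_at_def by force
        qed
        have "d^2 \<le> card S"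
        proof -
          have "real (d^2) \<le> K" using Kd by (smt (verit) of_nat_0_le_iff of_nat_add)
          then show ?thesis using h by linarith
        qed
        then have "2 * a * card S \<le> card {v\<in>S. ?m \<le> card (cluster F1 S v)} + card (bd (F1 \<union> F2) S)"
          using P.large_pieces[OF _ FE S(1,2), of F1 "d^2" ?m "2 * a"] inner d(2) by simp
        \<comment> \<open>A set violating (b) has a boundary that is small compared with
          \<open>S\<close>: \<open>ln (n / card S) \<le> d * C\<close> and
          \<open>ln d \<ge> 1/2\<close> make the bound in (b) at most
          \<open>2 * c * C * card S\<close>.\<close>
        moreover have "card (bd (F1 \<union> F2) S) \<le> a * card S"
        proof -
          have S0: "0 < real (card S)" using h K1 by linarith
          have "ln (n / card S) \<le> ln n" using h K1 n0 by (simp add: ln_div)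
          also have "\<dots> \<le> d * ln (real C)" by (rule lnn)
          also have "\<dots> \<le> real d * real C" using lnC by (intro mult_left_mono) auto
          finally have L: "ln (n / card S) \<le> real d * real C" .
          have l2: "1/2 \<le> ln (real d)"
          proof -
            have "ln 2 \<le> ln (real d)" using d by (subst ln_le_cancel_iff) auto
            then show ?thesis using ln2_ge_two_thirds by linarith
          qed
          have "c * card S * ln (n / card S) / (d * ln d) \<le> c * card S * (real d * real C) / (d * (1/2))"
          proof (rule frac_le)
            show "c * card S * ln (n / card S) \<le> c * card S * (real d * real C)" using L cb by (intro mult_left_mono) auto
            show "d * (1/2) \<le> d * ln (real d)" using l2 by (intro mult_left_mono) auto
          qed (use cb d0 in auto)
          also have "\<dots> = 2 * (c * C) * card S" using d0 by simp
          also have "\<dots> \<le> a * card S" using cb by (intro mult_right_mono) auto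
          finally show ?thesis using h by linarith
        qed
        ultimately have "a * card S \<le> card {v\<in>S. ?m \<le> card (cluster F1 S v)}" by linarith
        then have "Z F1 F2" unfolding Z_def using S h by blast
        then show ?thesis by blast
      qed blast
    qed
    then show ?thesis by (auto simp: of_bool_def)
  qed
  have "pex ?p PE (\<lambda>F. of_bool (\<exists>S\<subseteq>PV. conn F S \<and>
      (k0 \<le> card S \<and> card S \<le> K \<and> card (vertex_boundary (Graph PV F) S) < c * card S \<or>
       K \<le> card S \<and> card S \<le> 3 * \<epsilon> * n / 2 \<and> card (bd F S) < c * card S * ln (n / card S) / (d * ln d))))
    \<le> pex ?p1 PE (\<lambda>F1. pex ?p2 PE (\<lambda>F2. of_bool (X (\<lambda>S. PV - S) F1 F2) + of_bool (X (\<lambda>S. S) F1 F2) + of_bool (Y1 F1) + of_bool (Y2 F1)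
        + of_bool (\<not> Y1 F1 \<and> \<not> Y2 F1 \<and> Z F1 F2)))"
    unfolding pex_rounds[OF P.finE tr(1)] using cover by (intro pex_mono p1b p2)
  also have "\<dots> = pex ?p1 PE (\<lambda>F1. pex ?p2 PE (\<lambda>F2. of_bool (X (\<lambda>S. PV - S) F1 F2))) + pex ?p1 PE (\<lambda>F1. pex ?p2 PE (\<lambda>F2. of_bool (X (\<lambda>S. S) F1 F2)))
     + pex ?p1 PE (\<lambda>F1. of_bool (Y1 F1)) + pex ?p1 PE (\<lambda>F1. of_bool (Y2 F1))
     + pex ?p1 PE (\<lambda>F1. pex ?p2 PE (\<lambda>F2. of_bool (\<not> Y1 F1 \<and> \<not> Y2 F1 \<and> Z F1 F2)))"
    by (simp only: pex_add pex_const[OF P.finE])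
  also have "pex ?p1 PE (\<lambda>F1. pex ?p2 PE (\<lambda>F2. of_bool (\<not> Y1 F1 \<and> \<not> Y2 F1 \<and> Z F1 F2))) \<le> n * exp (2 - c4 / 2 * (K / d))"
  proof -
    have "pex ?p1 PE (\<lambda>F1. pex ?p2 PE (\<lambda>F2. of_bool (\<not> Y1 F1 \<and> \<not> Y2 F1 \<and> Z F1 F2)))
      \<le> pex ?p1 PE (\<lambda>F1. n * exp (2 - c4 / 2 * (K / d)))" by (rule pex_mono[OF p1b Zp])
    then show ?thesis by (simp only: pex_const[OF P.finE])
  qed
  finally show ?thesis using Xp[of "\<lambda>S. PV - S"] Xp[of "\<lambda>S. S"] Y1p Y2p by simp
qed

end

text \<open>One summand for each kind of failure, in terms of \<open>t\<close> alone. Since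
  \<open>t \<le> d \<le> C * t\<close> and \<open>2 ^ t \<le> n \<le> C ^ t\<close> hold for all
  admissible base graphs, the estimate is uniform in them. The last summand is doubly exponentially
  small because \<open>K\<close> grows exponentially in \<open>t\<close>.\<close>

definition error_bound :: "real \<Rightarrow> real \<Rightarrow> real \<Rightarrow> real \<Rightarrow> real \<Rightarrow> real" where
  "error_bound C \<epsilon> \<gamma> c4 t = 2 * exp (- (5/4 * ln C * t)) + exp (ln C * t - \<gamma>^2 * \<epsilon>^2 / 800 * t^2)
     + exp (- (\<gamma> * \<epsilon>^2 / 200 * t)) + exp (ln C * t + 2 - c4 / 2 * (exp (\<epsilon>^5 * ln 2 * t) / (C * t)))"

lemma error_bound_tendsto_0:
  assumes "1 < C" "0 < \<epsilon>" "0 < \<gamma>" "0 < c4"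
  shows "((\<lambda>t::nat. error_bound C \<epsilon> \<gamma> c4 (real t)) \<longlongrightarrow> 0) sequentially"
proof -
  define lC where "lC = ln C"
  define a where "a = \<gamma>^2 * \<epsilon>^2 / 800"
  define b where "b = \<gamma> * \<epsilon>^2 / 200"
  define \<rho> where "\<rho> = \<epsilon>^5 * ln 2"
  have pos: "0 < lC" "0 < a" "0 < b" "0 < \<rho>" using assms by (auto simp: lC_def a_def b_def \<rho>_def)
  have 1: "((\<lambda>t::nat. 2 * exp (- (5/4 * lC * real t))) \<longlongrightarrow> 0) sequentially" using pos by real_asymp
  have 2: "((\<lambda>t::nat. exp (lC * real t - a * real t^2)) \<longlongrightarrow> 0) sequentially" using pos by real_asymp
  have 3: "((\<lambda>t::nat. exp (- (b * real t))) \<longlongrightarrow> 0) sequentially" using pos by real_asymp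
  have 4: "((\<lambda>t::nat. exp (lC * real t + 2 - c4 / 2 * (exp (\<rho> * real t) / (C * real t)))) \<longlongrightarrow> 0) sequentially"
    using pos assms by real_asymp
  show ?thesis unfolding error_bound_def lC_def[symmetric] a_def[symmetric] b_def[symmetric] \<rho>_def[symmetric]
    using tendsto_add[OF tendsto_add[OF tendsto_add[OF 1 2] 3] 4] by simp
qed

text \<open>The numerical hypotheses on \<open>d\<close>, \<open>n\<close> and \<open>K\<close>,
  rewritten for \<open>t\<close>. The last condition ensures that rounding
  \<open>\<gamma> * t\<close> down to an integer \<open>r\<close> at most halves it.\<close>

definition large_enough :: "real \<Rightarrow> real \<Rightarrow> real \<Rightarrow> real \<Rightarrow> real \<Rightarrow> bool" where
  "large_enough C \<epsilon> \<gamma> c4 t \<longleftrightarrow> 1 / t \<le> \<epsilon>^3 \<and> 2 \<le> t \<and> 160 \<le> t * ln t \<and> 384 / t^3 + C / t \<le> c4 / 4 \<and>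
     6 * C * ln (C * t) / ln 2 \<le> \<epsilon>^3 * t \<and> 9 * ln C / \<epsilon>^2 \<le> t \<and> 20 \<le> \<epsilon> * 2 powr t \<and>
     (C * t)^6 + (C * t)^3 + (C * t)^2 \<le> exp (\<epsilon>^5 * ln 2 * t) \<and> 2 \<le> \<gamma> * t"

lemma eventually_large_enough:
  assumes "1 < C" "0 < \<epsilon>" "0 < \<gamma>" "0 < c4"
  shows "eventually (\<lambda>t::nat. large_enough C \<epsilon> \<gamma> c4 (real t)) sequentially"
proof -
  define l2 where "l2 = ln (2::real)"
  define \<rho> where "\<rho> = \<epsilon>^5 * l2"
  define e3 where "e3 = \<epsilon>^3"
  define e2 where "e2 = 9 * ln C / \<epsilon>^2"
  have pos: "0 < \<rho>" "0 < e3" "0 < l2" using assms by (auto simp: \<rho>_def e3_def l2_def)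
  show ?thesis unfolding large_enough_def \<rho>_def[symmetric] e3_def[symmetric] e2_def[symmetric] l2_def[symmetric]
  proof (intro eventually_conj)
    show "eventually (\<lambda>t::nat. 1 / real t \<le> e3) sequentially" using pos by real_asymp
    show "eventually (\<lambda>t::nat. 2 \<le> real t) sequentially" by real_asymp
    show "eventually (\<lambda>t::nat. 160 \<le> real t * ln (real t)) sequentially" by real_asymp
    show "eventually (\<lambda>t::nat. 384 / real t^3 + C / real t \<le> c4 / 4) sequentially" using assms by real_asymp
    show "eventually (\<lambda>t::nat. 6 * C * ln (C * real t) / l2 \<le> e3 * real t) sequentially" using assms pos by real_asymp
    show "eventually (\<lambda>t::nat. e2 \<le> real t) sequentially" by real_asymp
    show "eventually (\<lambda>t::nat. 20 \<le> \<epsilon> * 2 powr real t) sequentially" using assms by real_asymp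
    show "eventually (\<lambda>t::nat. (C * real t)^6 + (C * real t)^3 + (C * real t)^2 \<le> exp (\<rho> * real t)) sequentially"
      using assms pos by real_asymp
    show "eventually (\<lambda>t::nat. 2 \<le> \<gamma> * real t) sequentially" using assms by real_asymp
  qed
qed

lemma failure_prob_le_error_bound:
  fixes \<epsilon> \<gamma> \<nu> a c c3 c4 :: real and C t d n :: nat
  assumes H: "product_host {1..t} G dg C" and C: "1 < C" and eps: "0 < \<epsilon>" "\<epsilon> \<le> 1 / (100 * real C)"
    and \<gamma>: "\<gamma> = \<epsilon> / (400 * real C)" and \<nu>: "\<nu> = 2/5 * \<epsilon> * \<gamma>^2 / real C^2"
    and a: "a = \<epsilon>^3 / 120" and c3: "c3 = \<nu>^2 * a / (8 * real C^2)"
    and c4: "c4 = (\<epsilon>^3 / 20) ^ 5 * c3" and c: "c = c4 / 240"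
    and t: "large_enough C \<epsilon> \<gamma> c4 t"
  defines "P \<equiv> cartesian_product {1..t} G" and "d \<equiv> \<Sum>j=1..t. dg j"
  defines "n \<equiv> card (verts P)"
  shows "pex ((1 + \<epsilon>) / d) (edges P) (\<lambda>F. of_bool (\<exists>S\<subseteq>verts P. conn F S \<and>
      (9 * ln C * d / \<epsilon>^2 \<le> card S \<and> card S \<le> n powr (\<epsilon>^5) \<and> card (vertex_boundary (Graph (verts P) F) S) < c * card S \<or>
       n powr (\<epsilon>^5) \<le> card S \<and> card S \<le> 3 * \<epsilon> * n / 2 \<and> card (bd F S) < c * card S * ln (n / card S) / (d * ln d))))
    \<le> error_bound C \<epsilon> \<gamma> c4 t" "2 \<le> d"
proof -
  interpret product_host "{1..t}" G dg C by (rule H)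
  have P: "verts P = PV" "edges P = PE" unfolding P_def by (simp_all only: verts_cartesian_product PE_def)
  have dn: "d = deg_sum {1..t}" "n = card PV" by (simp_all add: d_def n_def P)
  have td: "t \<le> d" using deg_sum_ge[OF subset_refl] unfolding dn by simp
  have dt: "d \<le> C * t" using deg_sum_le[OF subset_refl] unfolding dn by (simp add: mult.commute)
  have rt: "real t \<le> real d" "real d \<le> C * real t" using td dt by (simp_all only: of_nat_le_iff flip: of_nat_mult)
  note L = t[unfolded large_enough_def]
  have t2: "2 \<le> real t" using L by blast
  have Cr: "1 < real C" using C by simp
  have d0: "0 < real d" "0 < real t" using rt t2 by auto
  show d2: "2 \<le> d" using rt t2 by simp
  have n2: "2 powr t \<le> n" "n \<le> C ^ t"
    using card_PV_bounds by (simp_all add: dn powr_realpow)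
  have n0: "0 < real n" using n2(1) by (smt (verit) powr_gt_zero)
  define K where "K = n powr (\<epsilon>^5)"
  have K: "exp (\<epsilon>^5 * ln 2 * t) \<le> K"
  proof -
    have "exp (\<epsilon>^5 * ln 2 * t) = (2 powr t) powr (\<epsilon>^5)" by (simp add: powr_powr powr_def algebra_simps)
    also have "\<dots> \<le> K" unfolding K_def using n2 eps by (intro powr_mono2) auto
    finally show ?thesis .
  qed
  have \<gamma>0: "0 < \<gamma>" "\<gamma> \<le> 1/2"
  proof -
    show "0 < \<gamma>" unfolding \<gamma> using eps Cr by simp
    have "1 / (100 * real C) \<le> 1 / (100 :: real)" using Cr by (intro divide_left_mono) auto
    then have "\<epsilon> \<le> 1/100" using eps by linarith
    then show "\<gamma> \<le> 1/2" unfolding \<gamma> using Cr eps by (simp add: divide_le_eq)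
  qed
  define r where "r = nat \<lfloor>\<gamma> * t\<rfloor>"
  have r: "\<gamma> * t / 2 \<le> r" "r \<le> \<gamma> * t"
  proof -
    show "r \<le> \<gamma> * t" unfolding r_def using \<gamma>0 by (intro of_nat_floor) simp
    have "2 \<le> \<gamma> * t" using L by blast
    moreover have "\<gamma> * t - 1 \<le> r" unfolding r_def by linarith
    ultimately show "\<gamma> * t / 2 \<le> r" by linarith
  qed
  have r2: "2 * r \<le> t"
  proof -
    have "\<gamma> * t \<le> 1/2 * t" using \<gamma>0 by (intro mult_right_mono) auto
    then show ?thesis using r by linarith
  qed
  have lnd: "ln t \<le> ln d" "ln d \<le> ln (C * t)" "0 \<le> ln (real t)"
  proof -
    show "ln t \<le> ln d" using rt d0 by simp
    show "ln d \<le> ln (C * t)" using rt d0 Cr by (simp only: ln_le_cancel_iff mult_pos_pos of_nat_mult)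
    show "0 \<le> ln (real t)" using t2 by simp
  qed
  have c40: "0 < c4"
  proof -
    have "0 < \<nu>" unfolding \<nu> using eps \<gamma>0 Cr by simp
    then have "0 < c3" unfolding c3 a using eps Cr by simp
    then show ?thesis unfolding c4 using eps by (intro mult_pos_pos) auto
  qed
  have "pex ((1 + \<epsilon>) / d) PE (\<lambda>F. of_bool (\<exists>S\<subseteq>PV. conn F S \<and>
      (9 * ln C * d / \<epsilon>^2 \<le> card S \<and> card S \<le> K \<and> card (vertex_boundary (Graph PV F) S) < c * card S \<or>
       K \<le> card S \<and> card S \<le> 3 * \<epsilon> * n / 2 \<and> card (bd F S) < c * card S * ln (n / card S) / (d * ln d))))
    \<le> 2 * (n * exp (- (\<epsilon>^2 / 4 * (9 * ln C * d / \<epsilon>^2)))) + n * exp (- (real r * real r * (\<epsilon>/10)^2 / 2))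
      + exp (- (2 ^ (2 * r) * (\<epsilon>/10)^2 / 2)) + n * exp (2 - c4 / 2 * (K / d))"
  \<comment> \<open>The coordinates \<open>1..r\<close> and \<open>r+1..2*r\<close> are the ones
    that get changed; \<open>\<gamma> \<le> 1/2\<close> makes room for both ranges.\<close>
  proof (rule failure_prob_le[where ?A1.0="{1..r}" and ?A2.0="{r+1..2*r}" and K=K and ?k0.0="9 * ln C * d / \<epsilon>^2", OF dn C eps \<gamma> \<nu> a c3 c4 c refl K_def])
    show "{1..r} \<subseteq> {1..t}" "{r+1..2*r} \<subseteq> {1..t}" "{1..r} \<inter> {r+1..2*r} = {}" using r2 by auto
    show "card {1..r} = r" "card {r+1..2*r} = r" by auto
    show "\<gamma> * card {1..t} / 2 \<le> r" "r \<le> \<gamma> * card {1..t}" using r by auto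
    have "1 / real d \<le> 1 / real t" using rt d0 by (intro divide_left_mono) auto
    then show "1 / d \<le> \<epsilon>^3" using L by linarith
    show "2 \<le> d" by (rule d2)
    have "t * ln t \<le> d * ln d" using rt lnd by (intro mult_mono) auto
    then show "160 \<le> d * ln d" using L by linarith
    have "384 / real d^3 \<le> 384 / real t^3" using rt d0 by (intro divide_left_mono power_mono) auto
    moreover have "C / real d \<le> C / real t" using rt d0 by (intro divide_left_mono) auto
    ultimately show "384 / real d^3 + C / d \<le> c4 / 4" using L by linarith
    have "6 * C * ln d / ln 2 \<le> 6 * C * ln (C * t) / ln 2" using lnd by (intro divide_right_mono mult_left_mono) auto
    also have "\<dots> \<le> \<epsilon>^3 * t" using L by simp
    also have "\<dots> \<le> \<epsilon>^3 * d" using rt eps by (intro mult_left_mono) auto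
    finally show "6 * C * ln d / ln 2 \<le> \<epsilon>^3 * d" .
    show "9 * ln C / \<epsilon>^2 \<le> d" using L rt by linarith
    have "\<epsilon> * 2 powr t \<le> \<epsilon> * n" using n2 eps by (intro mult_left_mono) auto
    then show "20 \<le> \<epsilon> * n" using L by linarith
    have "real (d * d^3 * d^2 + d^3 + d^2) = real d^6 + real d^3 + real d^2" by (simp add: numeral_eq_Suc)
    also have "\<dots> \<le> (C * real t)^6 + (C * real t)^3 + (C * real t)^2" using rt by (intro add_mono power_mono) auto
    also have "\<dots> \<le> K" using L K by linarith
    finally show "real (d * d^3 * d^2 + d^3 + d^2) \<le> K" .
  qed
  also have "\<dots> \<le> error_bound C \<epsilon> \<gamma> c4 t"
  proof -
    have nexp: "n \<le> exp (ln C * t)"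
    proof -
      have "real n \<le> real C ^ t" using n2(2) by (metis of_nat_le_iff of_nat_power)
      also have "\<dots> = exp (ln C * t)" using Cr by (simp add: exp_of_nat2_mult)
      finally show ?thesis .
    qed
    have lC: "0 < ln (real C)" using Cr by simp
    \<comment> \<open>The constant \<open>9\<close> of (a) pays off here: the exponent
      \<open>9/4 * ln C * d\<close> exceeds \<open>ln n \<le> ln C * t\<close> by
      \<open>5/4 * ln C * t\<close>.\<close>
    have "n * exp (- (\<epsilon>^2 / 4 * (9 * ln C * d / \<epsilon>^2))) \<le> exp (ln C * t) * exp (- (9/4 * ln C * t))"
    proof (intro mult_mono nexp)
      have "\<epsilon>^2 / 4 * (9 * ln C * d / \<epsilon>^2) = 9/4 * ln C * d" using eps by simp
      moreover have "9/4 * ln C * t \<le> 9/4 * ln C * d" using rt lC by (intro mult_left_mono) auto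
      ultimately show "exp (- (\<epsilon>^2 / 4 * (9 * ln C * d / \<epsilon>^2))) \<le> exp (- (9/4 * ln C * t))" unfolding exp_le_cancel_iff by linarith
    qed auto
    also have "\<dots> = exp (- (5/4 * ln C * t))" by (simp add: exp_add[symmetric])
    finally have 1: "n * exp (- (\<epsilon>^2 / 4 * (9 * ln C * d / \<epsilon>^2))) \<le> exp (- (5/4 * ln C * t))" .
    have "n * exp (- (real r * real r * (\<epsilon>/10)^2 / 2)) \<le> exp (ln C * t) * exp (- (\<gamma>^2 * \<epsilon>^2 / 800 * real t^2))"
    proof (intro mult_mono nexp)
      have "(\<gamma> * t / 2) * (\<gamma> * t / 2) \<le> real r * real r" using r \<gamma>0 by (intro mult_mono) auto
      then have "(\<gamma> * t / 2) * (\<gamma> * t / 2) * (\<epsilon>^2 / 200) \<le> real r * real r * (\<epsilon>^2 / 200)" by (intro mult_right_mono) auto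
      moreover have "(\<gamma> * t / 2) * (\<gamma> * t / 2) * (\<epsilon>^2 / 200) = \<gamma>^2 * \<epsilon>^2 / 800 * real t^2" by (simp add: power2_eq_square)
      moreover have "real r * real r * (\<epsilon>/10)^2 / 2 = real r * real r * (\<epsilon>^2 / 200)" by (simp add: power2_eq_square)
      ultimately show "exp (- (real r * real r * (\<epsilon>/10)^2 / 2)) \<le> exp (- (\<gamma>^2 * \<epsilon>^2 / 800 * real t^2))" unfolding exp_le_cancel_iff by linarith
    qed auto
    then have 2: "n * exp (- (real r * real r * (\<epsilon>/10)^2 / 2)) \<le> exp (ln C * t - \<gamma>^2 * \<epsilon>^2 / 800 * real t^2)"
      by (simp only: exp_add[symmetric] add_uminus_conv_diff)
    have 3: "exp (- (2 ^ (2 * r) * (\<epsilon>/10)^2 / 2)) \<le> exp (- (\<gamma> * \<epsilon>^2 / 200 * t))"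
    proof -
      have "\<gamma> * t \<le> 2 * r" using r by simp
      also have "real (2 * r) \<le> 2 ^ (2 * r)" using less_exp[of "2 * r"] by (metis less_imp_le of_nat_le_iff of_nat_numeral of_nat_power)
      finally have "\<gamma> * t * (\<epsilon>^2 / 200) \<le> 2 ^ (2 * r) * (\<epsilon>^2 / 200)" by (intro mult_right_mono) auto
      moreover have "2 ^ (2 * r) * (\<epsilon>/10)^2 / 2 = 2 ^ (2 * r) * (\<epsilon>^2 / 200)" by (simp add: power2_eq_square)
      moreover have "\<gamma> * t * (\<epsilon>^2 / 200) = \<gamma> * \<epsilon>^2 / 200 * t" by simp
      ultimately show ?thesis unfolding exp_le_cancel_iff by linarith
    qed
    have "n * exp (2 - c4 / 2 * (K / d)) \<le> exp (ln C * t) * exp (2 - c4 / 2 * (exp (\<epsilon>^5 * ln 2 * t) / (real C * real t)))"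
    proof (intro mult_mono nexp)
      have "exp (\<epsilon>^5 * ln 2 * t) / (real C * real t) \<le> K / d" using K rt d0 by (intro frac_le) (auto simp: K_def)
      then have "c4 / 2 * (exp (\<epsilon>^5 * ln 2 * t) / (real C * real t)) \<le> c4 / 2 * (K / d)" using c40 by (intro mult_left_mono) auto
      then show "exp (2 - c4 / 2 * (K / d)) \<le> exp (2 - c4 / 2 * (exp (\<epsilon>^5 * ln 2 * t) / (real C * real t)))" unfolding exp_le_cancel_iff by linarith
    qed auto
    then have 4: "n * exp (2 - c4 / 2 * (K / d)) \<le> exp (ln C * t + 2 - c4 / 2 * (exp (\<epsilon>^5 * ln 2 * t) / (real C * real t)))"
      by (simp only: exp_add[symmetric] add_diff_eq)
    show ?thesis unfolding error_bound_def using 1 2 3 4 by linarith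
  qed
  finally show "pex ((1 + \<epsilon>) / d) (edges P) (\<lambda>F. of_bool (\<exists>S\<subseteq>verts P. conn F S \<and>
      (9 * ln C * d / \<epsilon>^2 \<le> card S \<and> card S \<le> n powr (\<epsilon>^5) \<and> card (vertex_boundary (Graph (verts P) F) S) < c * card S \<or>
       n powr (\<epsilon>^5) \<le> card S \<and> card S \<le> 3 * \<epsilon> * n / 2 \<and> card (bd F S) < c * card S * ln (n / card S) / (d * ln d))))
    \<le> error_bound C \<epsilon> \<gamma> c4 t"
    unfolding P K_def .
qed

text \<open>The threshold \<open>1 / (100 * C)\<close> for \<open>\<epsilon>\<close> serves twice:
  it puts \<open>\<epsilon>\<close> below \<open>1/100\<close> and bounds
  \<open>\<epsilon> * C\<close>. The constant \<open>c\<close> is computed from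
  \<open>\<epsilon>\<close> and \<open>C\<close> through \<open>\<gamma>\<close>,
  \<open>\<nu>\<close>, \<open>a\<close>, \<open>c3\<close> and \<open>c4\<close> before the base
  graphs are given, and the same \<open>c\<close> serves (a) and (b).\<close>

theorem theorem4:
  fixes C :: nat
  assumes "C > 1"
  shows "\<exists>\<epsilon>\<^sub>0>0. \<forall>\<epsilon>::real. 0 < \<epsilon> \<and> \<epsilon> \<le> \<epsilon>\<^sub>0 \<longrightarrow>
    (\<exists>c::real. c > 0 \<and>
      (\<forall>(G :: nat \<Rightarrow> nat \<Rightarrow> 'a graph) (deg :: nat \<Rightarrow> nat \<Rightarrow> nat).
        (\<forall>t. \<forall>j\<in>{1..t}.
           simple_graph (G t j) \<and> regular_graph (deg t j) (G t j) \<and> connected_graph (G t j) \<and>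
           1 < card (verts (G t j)) \<and> card (verts (G t j)) \<le> C) \<longrightarrow>
        (\<lambda>t. let P = cartesian_product {1..t} (G t);
                 n = real (card (verts P));
                 d = real (\<Sum>j=1..t. deg t j)
             in measure_pmf.prob (random_subgraph P ((1 + \<epsilon>) / d))
               {H. \<forall>L S. largest_component H L \<and> S \<subseteq> L \<and>
                     connected_graph (induced_subgraph H S) \<longrightarrow>
                   (let k = real (card S) in
                     (9 * ln (real C) * d / \<epsilon>\<^sup>2 \<le> k \<and> k \<le> n powr (\<epsilon> ^ 5) \<longrightarrow>
                        real (card (vertex_boundary H S)) \<ge> c * k) \<and>
                     (n powr (\<epsilon> ^ 5) \<le> k \<and> k \<le> 3 * \<epsilon> * n / 2 \<longrightarrow>
                        real (card (edge_boundary H S)) \<ge> c * k * ln (n / k) / (d * ln d)))})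
          \<longlonglongrightarrow> 1))"
proof (rule exI[of _ "1 / (100 * real C)"], intro conjI allI impI)
  have Cr: "1 < real C" using assms by simp
  show "0 < 1 / (100 * real C)" using Cr by simp
  fix \<epsilon> :: real assume "0 < \<epsilon> \<and> \<epsilon> \<le> 1 / (100 * real C)"
  then have eps: "0 < \<epsilon>" "\<epsilon> \<le> 1 / (100 * real C)" by auto
  define \<gamma> where "\<gamma> = \<epsilon> / (400 * real C)"
  define \<nu> where "\<nu> = 2/5 * \<epsilon> * \<gamma>^2 / real C^2"
  define a where "a = \<epsilon>^3 / 120"
  define c3 where "c3 = \<nu>^2 * a / (8 * real C^2)"
  define c4 where "c4 = (\<epsilon>^3 / 20) ^ 5 * c3"
  define c where "c = c4 / 240"
  have pos: "0 < \<gamma>" "0 < c4"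
  proof -
    show "0 < \<gamma>" unfolding \<gamma>_def using eps Cr by simp
    then have "0 < \<nu>" unfolding \<nu>_def using eps Cr by simp
    then have "0 < c3" unfolding c3_def a_def using eps Cr by simp
    then show "0 < c4" unfolding c4_def using eps by (intro mult_pos_pos) auto
  qed
  show "\<exists>c::real. c > 0 \<and>
      (\<forall>(G :: nat \<Rightarrow> nat \<Rightarrow> 'a graph) (deg :: nat \<Rightarrow> nat \<Rightarrow> nat).
        (\<forall>t. \<forall>j\<in>{1..t}.
           simple_graph (G t j) \<and> regular_graph (deg t j) (G t j) \<and> connected_graph (G t j) \<and>
           1 < card (verts (G t j)) \<and> card (verts (G t j)) \<le> C) \<longrightarrow>
        (\<lambda>t. let P = cartesian_product {1..t} (G t);
                 n = real (card (verts P));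
                 d = real (\<Sum>j=1..t. deg t j)
             in measure_pmf.prob (random_subgraph P ((1 + \<epsilon>) / d))
               {H. \<forall>L S. largest_component H L \<and> S \<subseteq> L \<and>
                     connected_graph (induced_subgraph H S) \<longrightarrow>
                   (let k = real (card S) in
                     (9 * ln (real C) * d / \<epsilon>\<^sup>2 \<le> k \<and> k \<le> n powr (\<epsilon> ^ 5) \<longrightarrow>
                        real (card (vertex_boundary H S)) \<ge> c * k) \<and>
                     (n powr (\<epsilon> ^ 5) \<le> k \<and> k \<le> 3 * \<epsilon> * n / 2 \<longrightarrow>
                        real (card (edge_boundary H S)) \<ge> c * k * ln (n / k) / (d * ln d)))})
          \<longlonglongrightarrow> 1)"
  proof (rule exI[of _ c], intro conjI allI impI)
    show "c > 0" using pos by (simp add: c_def)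
    fix G :: "nat \<Rightarrow> nat \<Rightarrow> 'a graph" and deg :: "nat \<Rightarrow> nat \<Rightarrow> nat"
    assume hyp: "\<forall>t. \<forall>j\<in>{1..t}.
           simple_graph (G t j) \<and> regular_graph (deg t j) (G t j) \<and> connected_graph (G t j) \<and>
           1 < card (verts (G t j)) \<and> card (verts (G t j)) \<le> C"
    define P where "P t = cartesian_product {1..t} (G t)" for t
    define n where "n t = card (verts (P t))" for t
    define d where "d t = (\<Sum>j=1..t. deg t j)" for t
    define good where "good t H \<longleftrightarrow> (\<forall>L S. largest_component H L \<and> S \<subseteq> L \<and>
                     connected_graph (induced_subgraph H S) \<longrightarrow>
                   (let k = real (card S) in
                     (9 * ln (real C) * real (d t) / \<epsilon>\<^sup>2 \<le> k \<and> k \<le> real (n t) powr (\<epsilon> ^ 5) \<longrightarrow>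
                        real (card (vertex_boundary H S)) \<ge> c * k) \<and>
                     (real (n t) powr (\<epsilon> ^ 5) \<le> k \<and> k \<le> 3 * \<epsilon> * real (n t) / 2 \<longrightarrow>
                        real (card (edge_boundary H S)) \<ge> c * k * ln (real (n t) / k) / (real (d t) * ln (real (d t))))))" for t and H :: "(nat \<Rightarrow> 'a) graph"
    define f where "f t = measure_pmf.prob (random_subgraph (P t) ((1 + \<epsilon>) / real (d t))) {H. good t H}" for t
    have lower: "1 - error_bound C \<epsilon> \<gamma> c4 (real t) \<le> f t" if t: "large_enough C \<epsilon> \<gamma> c4 (real t)" for t
    proof -
      have H: "product_host {1..t} (G t) (deg t) C"
        by unfold_locales (use hyp in auto)
      interpret product_host "{1..t}" "G t" "deg t" C by (rule H)
      interpret R: regular_host PV PE "deg_sum {1..t}" by (rule regular_PE)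
      have PG: "verts (P t) = PV" "edges (P t) = PE" unfolding P_def by (simp_all only: verts_cartesian_product PE_def)
      let ?p = "(1 + \<epsilon>) / real (d t)"
      let ?bad = "\<lambda>F. \<exists>S\<subseteq>PV. conn F S \<and>
        (9 * ln C * d t / \<epsilon>^2 \<le> card S \<and> card S \<le> n t powr (\<epsilon>^5) \<and> card (vertex_boundary (Graph PV F) S) < c * card S \<or>
         n t powr (\<epsilon>^5) \<le> card S \<and> card S \<le> 3 * \<epsilon> * n t / 2 \<and> card (bd F S) < c * card S * ln (n t / card S) / (d t * ln (d t)))"
      note EF = failure_prob_le_error_bound[OF H assms eps \<gamma>_def \<nu>_def a_def c3_def c4_def c_def t, folded P_def d_def n_def]
      have d2: "2 \<le> d t" by (rule EF(2))
      have bad: "pex ?p PE (\<lambda>F. of_bool (?bad F)) \<le> error_bound C \<epsilon> \<gamma> c4 (real t)"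
        using EF(1) unfolding PG .
      have e1: "\<epsilon> \<le> 1"
      proof -
        have "1 / (100 * real C) \<le> 1" using Cr by simp
        then show ?thesis using eps by linarith
      qed
      have p: "0 \<le> ?p" "?p \<le> 1" using eps e1 d2 by (simp_all add: divide_le_eq)
      \<comment> \<open>The complement of the bad event asserts both bounds for every connected
        vertex set, in particular for those inside a largest component.\<close>
      have "1 - of_bool (?bad F) \<le> (of_bool (good t (Graph PV F)) :: real)" if F: "F \<subseteq> PE" for F
      proof -
        have "good t (Graph PV F)" if nb: "\<not> ?bad F"
          unfolding good_def
        proof (intro allI impI)
          fix L S assume LS: "largest_component (Graph PV F) L \<and> S \<subseteq> L \<and> connected_graph (induced_subgraph (Graph PV F) S)"
          have "L \<subseteq> PV" using LS by (auto simp: largest_component_def components_def)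
          then have SP: "S \<subseteq> PV" using LS by blast
          have "conn F S" using conn_if_connected_graph[OF _ SP] LS by blast
          moreover have "edge_boundary (Graph PV F) S = bd F S" by (simp add: edge_boundary_def bd_def)
          ultimately show "let k = real (card S) in
             (9 * ln (real C) * real (d t) / \<epsilon>\<^sup>2 \<le> k \<and> k \<le> real (n t) powr (\<epsilon> ^ 5) \<longrightarrow>
                real (card (vertex_boundary (Graph PV F) S)) \<ge> c * k) \<and>
             (real (n t) powr (\<epsilon> ^ 5) \<le> k \<and> k \<le> 3 * \<epsilon> * real (n t) / 2 \<longrightarrow>
                real (card (edge_boundary (Graph PV F) S)) \<ge> c * k * ln (real (n t) / k) / (real (d t) * ln (real (d t))))"
            using nb SP unfolding Let_def by (auto simp: not_less)
        qed
        then show ?thesis by auto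
      qed
      then have "pex ?p PE (\<lambda>F. 1 + (- 1) * of_bool (?bad F)) \<le> pex ?p PE (\<lambda>F. of_bool (good t (Graph PV F)))"
        using p by (intro pex_mono) auto
      then have "1 - pex ?p PE (\<lambda>F. of_bool (?bad F)) \<le> pex ?p PE (\<lambda>F. of_bool (good t (Graph PV F)))"
        by (simp only: pex_add pex_cmult pex_const[OF R.finE])
      also have "\<dots> = f t"
        unfolding f_def using prob_random_subgraph[of "P t" ?p "good t"] p R.finE by (simp add: PG)
      finally show ?thesis using bad by linarith
    qed
    have "f \<longlonglongrightarrow> 1"
    proof (rule tendsto_sandwich)
      show "eventually (\<lambda>t. 1 - error_bound C \<epsilon> \<gamma> c4 (real t) \<le> f t) sequentially"
        using eventually_large_enough[OF Cr eps(1) pos] lower by (auto elim: eventually_mono)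
      show "eventually (\<lambda>t. f t \<le> 1) sequentially" by (simp add: f_def)
      show "(\<lambda>t. 1 - error_bound C \<epsilon> \<gamma> c4 (real t)) \<longlonglongrightarrow> 1"
        using tendsto_diff[OF tendsto_const error_bound_tendsto_0[OF Cr eps(1) pos], of 1] by simp
    qed simp
    then show "(\<lambda>t. let P = cartesian_product {1..t} (G t);
                 n = real (card (verts P));
                 d = real (\<Sum>j=1..t. deg t j)
             in measure_pmf.prob (random_subgraph P ((1 + \<epsilon>) / d))
               {H. \<forall>L S. largest_component H L \<and> S \<subseteq> L \<and>
                     connected_graph (induced_subgraph H S) \<longrightarrow>
                   (let k = real (card S) in
                     (9 * ln (real C) * d / \<epsilon>\<^sup>2 \<le> k \<and> k \<le> n powr (\<epsilon> ^ 5) \<longrightarrow>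
                        real (card (vertex_boundary H S)) \<ge> c * k) \<and>
                     (n powr (\<epsilon> ^ 5) \<le> k \<and> k \<le> 3 * \<epsilon> * n / 2 \<longrightarrow>
                        real (card (edge_boundary H S)) \<ge> c * k * ln (n / k) / (d * ln d)))})
          \<longlonglongrightarrow> 1"
      unfolding f_def good_def P_def n_def d_def Let_def .
  qed
qed

end
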